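(* Let $\theta\in\mathbb R$ and let $(X_n)_{n\ge1}$ be a sequence of iid real random variables. Let $(\lambda_n)$ be a sequence of nonnegative random variables which converge to some $\lambda\in\mathbb R$ almost surely. (1) If $\sup_n|\lambda_n|<\infty$ almost surely and $(X_n)$ are drawn from some distribution $P\in\mathrm{DAN}(\theta)$, then $(E_n^{\mathrm{IWR}}(\theta;\lambda_n))_{n\ge1}$ is a sharp asymptotic e-variable, i.e. $\limsup_{n\to\infty}\mathbb E_P[E_n^{\mathrm{IWR}}(\theta;\lambda_n)]=1$. (2) Additionally, if $(\lambda_n)$ is a deterministic sequence which converges to $\lambda$ and the $X_i$ have $\mathcal P$-uniformly bounded skew for some $\mathcal P\subseteq\mathrm{DAN}(\theta)$, then $(E_n^{\mathrm{IWR}}(\theta;\lambda_n))_{n\ge1}$ is a $\mathcal P$-uniform asymptotic e-variable, i.e. $\limsup_{n\to\infty}\sup_{P\in\mathcal P}\mathbb E_P[E_n^{\mathrm{IWR}}(\theta;\lambda_n)]\le1$.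
   Context: Under $P$, the variables $X_1,X_2,\dots$ are iid with law $P$. Define $$S_n(\theta)=\sum_{i\le n}(X_i-\theta),\quad V_n(\theta)=\Big(\sum_{i\le n}(X_i-\theta)^2\Big)^{1/2},\quad E_n^{\mathrm{IWR}}(\theta;\lambda)=\exp\Big(\lambda\frac{S_n(\theta)}{V_n(\theta)}-\frac{\lambda^2}{2}\Big),$$ with the convention $0/0=0$. $\mathrm{DAN}(\theta)$ is the set of distributions $P$ on $\mathbb R$ with mean $\theta$ in the domain of attraction of a Gaussian: there exist sequences $(a_n)$ and $(b_n)$ such that $(\sum_{i\le n}X_i-b_n)/a_n\to N(0,1)$ in distribution under $P$. $\mathcal P$-uniformly bounded skew means $\sup_{P\in\mathcal P}\mathbb E_P|X_1-\mathbb E_PX_1|^3/\sigma_P^3<\infty$, where $\sigma_P^2$ is the variance of $X_1$ under $P$.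
   Formalization: In (1), "sup_n |λ_n| < ∞ almost surely" is taken as a deterministic bound: some constant C has sup_n |λ_n| ≤ C a.s. With only a random finite supremum the claim fails, e.g. Rademacher X_i, θ = 0, λ_n = T_n·1{T_n > 2√(log n)}, T_n = S_n/V_n. *)

theory Defs
  imports "HOL-Probability.Probability"
begin

text \<open>Sequences are indexed from 0: \<open>X i\<close> is the variable written $X_{i+1}$ on paper, so the
  first \<open>n\<close> variables are \<open>X i\<close> with \<open>i < n\<close>. A law on the reals is a \<open>real_distribution\<close>.\<close>

definition iid_with_law :: "'a measure \<Rightarrow> (nat \<Rightarrow> 'a \<Rightarrow> real) \<Rightarrow> real measure \<Rightarrow> bool" where
  "iid_with_law M X P \<longleftrightarrow>
     prob_space M \<and>
     prob_space.indep_vars M (\<lambda>_. borel) X UNIV \<and>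
     (\<forall>i. distr M borel (X i) = P)"

definition S_stat :: "(nat \<Rightarrow> 'a \<Rightarrow> real) \<Rightarrow> real \<Rightarrow> nat \<Rightarrow> 'a \<Rightarrow> real" where
  "S_stat X \<theta> n \<omega> = (\<Sum>i<n. X i \<omega> - \<theta>)"

definition V_stat :: "(nat \<Rightarrow> 'a \<Rightarrow> real) \<Rightarrow> real \<Rightarrow> nat \<Rightarrow> 'a \<Rightarrow> real" where
  "V_stat X \<theta> n \<omega> = sqrt (\<Sum>i<n. (X i \<omega> - \<theta>)\<^sup>2)"

text \<open>The convention $0/0 = 0$ is the library's \<open>x / 0 = 0\<close>: where \<open>V_stat\<close> vanishes, so
  does \<open>S_stat\<close>.\<close>

definition E_IWR :: "(nat \<Rightarrow> 'a \<Rightarrow> real) \<Rightarrow> nat \<Rightarrow> real \<Rightarrow> real \<Rightarrow> 'a \<Rightarrow> real" where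
  "E_IWR X n \<theta> l \<omega> = exp (l * (S_stat X \<theta> n \<omega> / V_stat X \<theta> n \<omega>) - l\<^sup>2 / 2)"

text \<open>Under the product measure the coordinates form an iid sequence with law \<open>P\<close>. Nothing is
  assumed about the sign of \<open>a n\<close>; since \<open>x / 0 = 0\<close>, the convergence itself forces
  \<open>a n \<noteq> 0\<close> for all but finitely many \<open>n\<close>, and it excludes point masses.\<close>

definition DAN :: "real \<Rightarrow> real measure set" where
  "DAN \<theta> = {P. real_distribution P \<and>
     integrable P (\<lambda>x. x) \<and> (\<integral>x. x \<partial>P) = \<theta> \<and>
     (\<exists>a b :: nat \<Rightarrow> real.
        weak_conv_m
          (\<lambda>n. distr (\<Pi>\<^sub>M i\<in>(UNIV::nat set). P) borel (\<lambda>x. ((\<Sum>i<n. x i) - b n) / a n))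
          std_normal_distribution)}"

definition mean :: "real measure \<Rightarrow> real" where
  "mean P = (\<integral>x. x \<partial>P)"

definition stddev :: "real measure \<Rightarrow> real" where
  "stddev P = sqrt (\<integral>x. (x - mean P)\<^sup>2 \<partial>P)"

text \<open>Bochner integrals are 0 for non-integrable functions, so finiteness of the third absolute
  moment, which finiteness of the supremum presupposes, is required explicitly. It also makes the
  variance finite.\<close>

definition uniformly_bounded_skew :: "real measure set \<Rightarrow> bool" where
  "uniformly_bounded_skew \<P> \<longleftrightarrow>
     (\<forall>P\<in>\<P>. integrable P (\<lambda>x. \<bar>x - mean P\<bar> ^ 3)) \<and>
     bdd_above ((\<lambda>P. (\<integral>x. \<bar>x - mean P\<bar> ^ 3 \<partial>P) / stddev P ^ 3) ` \<P>)"

text \<open>E-variables take values in \<open>ennreal\<close>, which builds in nonnegativity and makes every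
  expectation meaningful, possibly infinite.\<close>

definition sharp_asymptotic_evar :: "'a measure \<Rightarrow> (nat \<Rightarrow> 'a \<Rightarrow> ennreal) \<Rightarrow> bool" where
  "sharp_asymptotic_evar M E \<longleftrightarrow> limsup (\<lambda>n. \<integral>\<^sup>+\<omega>. E n \<omega> \<partial>M) = 1"

text \<open>\<open>Pr P\<close> is the probability measure on the sample space when the true law is \<open>P\<close>.\<close>

definition uniform_asymptotic_evar ::
    "(real measure \<Rightarrow> 'a measure) \<Rightarrow> real measure set \<Rightarrow> (nat \<Rightarrow> 'a \<Rightarrow> ennreal) \<Rightarrow> bool" where
  "uniform_asymptotic_evar Pr \<P> E \<longleftrightarrow>
     limsup (\<lambda>n. SUP P\<in>\<P>. \<integral>\<^sup>+\<omega>. E n \<omega> \<partial>(Pr P)) \<le> 1"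

end

theory Submission
  imports Defs
begin

text \<open>
  Let \<open>X\<close> have mean zero, let \<open>S\<close> and \<open>V\<close> be the centred sum and the self-normaliser of \<open>n\<close> terms, and let
  \<open>h u = 1 - exp (- (u\<^sup>2 / 2))\<close>. The proof rests on one property of the law: at large scales \<open>c\<close> the
  mean \<open>T\<close> of \<open>\<bar>X / c\<bar> * h (X / c)\<close> is negligible against the mean \<open>U\<close> of \<open>h (X / c)\<close>. This says that
  truncated third moments are negligible against truncated variances, and it makes sense without a
  finite variance.

  The property controls self-normalised sums because of the expansion
  \<open>exp (l * u - A * u\<^sup>2) = 1 + l * u + (l\<^sup>2 - 2 * A) * h u + O (\<bar>u\<bar> * h u)\<close>, valid for all real \<open>u\<close> when
  \<open>A > 0\<close> (\<open>damped_exp_expansion\<close>). At the scale \<open>a\<close> with \<open>n * U = 1 / 2\<close>, independence and the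
  vanishing mean show that the expectation of \<open>exp (l * S / a - A * (V / a)\<^sup>2)\<close> tends to
  \<open>exp (l\<^sup>2 / 2 - A)\<close> (\<open>damped_limit\<close>). This plays the role of a central limit theorem: for \<open>l = 0\<close> the limit
  shows that \<open>V / a\<close> tends to \<open>1\<close> in probability, so \<open>exp (l * S / V - l\<^sup>2 / 2)\<close> is close in probability
  to the damped exponential with \<open>A = 1\<close>, multiplied by \<open>exp (1 - l\<^sup>2 / 2)\<close>, whose mean tends to \<open>1\<close>.

  Convergence of means then needs uniform integrability, that is, bounded exponential moments of
  \<open>S / V\<close> (\<open>exp_self_normalised_bound\<close>). If \<open>V \<ge> a\<close>, terms larger than \<open>a\<close> contribute at most \<open>1\<close> each to
  \<open>S / V\<close>, and few such terms occur. If \<open>c \<le> V \<le> 2 * c\<close> for a smaller scale \<open>c\<close>, damping costs only a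
  constant factor and yields a bound exponentially small in \<open>n * U\<close>, which grows geometrically as \<open>c\<close>
  is halved. For \<open>V\<close> below a constant, \<open>\<bar>S / V\<bar> \<le> sqrt n\<close> is beaten by an exponentially small probability.
  All constants depend only on how fast \<open>T / U\<close> tends to \<open>0\<close> and on lower bounds for \<open>U\<close>, so the
  conclusion holds along sequences of laws in a class where these are uniform
  (\<open>IWR_expectation_tendsto_1\<close>). With bounded skewness and unit variance, \<open>T\<close> is of order
  \<open>1 / c ^ 3\<close> and \<open>U\<close> of order \<open>1 / c\<^sup>2\<close> uniformly, which gives the uniform statement.

  For a single law in the domain of attraction the property is extracted from characteristic
  functions (\<open>cubic_gap_negligible\<close>). The modulus of the characteristic function eliminates the
  centring constants; since the mean is zero, it determines the real part to leading order. Averaging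
  over Gaussian frequencies shows that \<open>n * U\<close> at scale \<open>1 / (r * y n)\<close>, where \<open>1 / y n\<close> is the norming
  constant, tends to \<open>r\<^sup>2 / 2\<close>. The identity
  \<open>4 * h u - h (2 * u) = (h u)\<^sup>2 * (q\<^sup>2 + 2 * q + 3)\<close> with \<open>q = 1 - h u\<close> turns this exact quadratic
  behaviour into the statement that the mean of \<open>(h (X / c))\<^sup>2\<close> is \<open>o (U)\<close>; monotonicity of \<open>U\<close> extends
  it to all scales, and a geometric series over dyadic scales upgrades it to \<open>T = o (U)\<close>.
\<close>

section \<open>The saturating quadratic kernel\<close>

text \<open>This is \<open>1\<close> minus the characteristic function of the standard normal law: it behaves like
  \<open>u\<^sup>2 / 2\<close> near \<open>0\<close> and saturates at \<open>1\<close>. Its mean is finite without a second moment, it is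
  monotone in \<open>\<bar>u\<bar>\<close>, and it is an average of \<open>1 - cos (g * u)\<close> over Gaussian \<open>g\<close>; the first two
  properties serve the analysis of self-normalised sums, the last one the passage from
  characteristic functions.\<close>

definition gauss_gap :: "real \<Rightarrow> real" where
  "gauss_gap u = 1 - exp (- (u\<^sup>2 / 2))"

lemma gauss_gap_0 [simp]: "gauss_gap 0 = 0"
  by (simp add: gauss_gap_def)

lemma gauss_gap_nonneg [simp]: "0 \<le> gauss_gap u"
  by (simp add: gauss_gap_def)

lemma gauss_gap_le_1 [simp]: "gauss_gap u \<le> 1"
  by (simp add: gauss_gap_def)

lemma gauss_gap_pos: "u \<noteq> 0 \<Longrightarrow> 0 < gauss_gap u"
  by (simp add: gauss_gap_def)

lemma gauss_gap_measurable [measurable]: "gauss_gap \<in> borel_measurable borel"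
  unfolding gauss_gap_def by measurable

lemma gauss_gap_mono: "\<bar>u\<bar> \<le> \<bar>v\<bar> \<Longrightarrow> gauss_gap u \<le> gauss_gap v"
  by (simp add: gauss_gap_def abs_le_square_iff)

lemma gauss_gap_le_square: "gauss_gap u \<le> u\<^sup>2 / 2"
  using exp_ge_add_one_self[of "- (u\<^sup>2 / 2)"] unfolding gauss_gap_def by linarith

lemma gauss_gap_le_abs: "gauss_gap u \<le> \<bar>u\<bar>"
proof (cases "\<bar>u\<bar> \<le> 1")
  case True
  have "\<bar>u\<bar>\<^sup>2 \<le> \<bar>u\<bar>" using mult_left_le[OF True, of "\<bar>u\<bar>"] by (simp add: power2_eq_square)
  then show ?thesis using gauss_gap_le_square[of u] by simp
next
  case False
  then show ?thesis using gauss_gap_le_1[of u] by linarith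
qed

lemma exp_minus_le_inverse: "0 < z \<Longrightarrow> z \<le> exp y \<Longrightarrow> exp (- y) \<le> 1 / z" for y z :: real
  using frac_le[of 1 1 z "exp y"] by (simp add: exp_minus inverse_eq_divide)

lemma gauss_gap_ge_cubic: "u\<^sup>2 / 2 - \<bar>u\<bar> ^ 3 / 2 \<le> gauss_gap u"
proof (cases "\<bar>u\<bar> \<le> 1")
  case True
  define y where "y = u\<^sup>2 / 2"
  have y0: "0 \<le> y" by (simp add: y_def)
  have "exp (- y) \<le> 1 / (1 + y + y\<^sup>2 / 2)"
    using exp_lower_Taylor_quadratic[OF y0] y0
    by (intro exp_minus_le_inverse) (auto simp: add_pos_nonneg)
  also have "\<dots> \<le> 1 - y + y\<^sup>2 / 2"
  proof -
    have "(1 - y + y\<^sup>2/2) * (1 + y + y\<^sup>2/2) = 1 + (y\<^sup>2)\<^sup>2 / 4"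
      by (simp add: power2_eq_square algebra_simps)
    moreover have "0 < 1 + y + y\<^sup>2/2" using y0 by (simp add: add_pos_nonneg)
    ultimately show ?thesis by (simp add: divide_le_eq)
  qed
  finally have "y - y\<^sup>2 / 2 \<le> gauss_gap u" by (simp add: gauss_gap_def y_def)
  moreover have "y\<^sup>2 / 2 \<le> \<bar>u\<bar> ^ 3 / 2"
  proof -
    have "\<bar>u\<bar> ^ 3 * \<bar>u\<bar> = u ^ 4"
      using power_Suc2[of "\<bar>u\<bar>" 3] by simp
    then have "y\<^sup>2 = \<bar>u\<bar> ^ 3 * (\<bar>u\<bar> / 4)"
      by (simp add: y_def power_divide)
    also have "\<dots> \<le> \<bar>u\<bar> ^ 3 * 1" using True by (intro mult_left_mono) auto
    finally show ?thesis by simp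
  qed
  ultimately show ?thesis by (simp add: y_def)
next
  case False
  have "\<bar>u\<bar>\<^sup>2 \<le> \<bar>u\<bar> ^ 3" using False by (intro power_increasing) auto
  then have "u\<^sup>2 \<le> \<bar>u\<bar> ^ 3" by simp
  then show ?thesis using gauss_gap_nonneg[of u] by linarith
qed

lemma gauss_gap_ge_quarter_square: "\<bar>u\<bar> \<le> 1 \<Longrightarrow> u\<^sup>2 / 4 \<le> gauss_gap u"
proof -
  assume u: "\<bar>u\<bar> \<le> 1"
  define y where "y = u\<^sup>2 / 2"
  have y: "0 \<le> y" "y \<le> 1 / 2" using u by (auto simp: y_def abs_square_le_1)
  have "1 + y \<le> exp y" by (rule exp_ge_add_one_self)
  then have "exp (- y) \<le> 1 / (1 + y)"
    using y by (intro exp_minus_le_inverse) auto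
  also have "\<dots> \<le> 1 - y / 2"
  proof -
    have "y * y \<le> y * 1" using y by (intro mult_left_mono) auto
    then have "1 \<le> (1 - y / 2) * (1 + y)" using y by (simp add: algebra_simps)
    then show ?thesis using y by (simp only: divide_le_eq) simp
  qed
  finally show ?thesis by (simp add: gauss_gap_def y_def)
qed

lemma gauss_gap_ge_quarter: "1 \<le> \<bar>u\<bar> \<Longrightarrow> 1 / 4 \<le> gauss_gap u"
  using gauss_gap_mono[of 1 u] gauss_gap_ge_quarter_square[of 1] by simp

text \<open>With \<open>q = exp (- (u\<^sup>2 / 2))\<close> the difference \<open>4 * (1 - q) - (1 - q ^ 4)\<close> factors as
  \<open>(1 - q)\<^sup>2 * (q\<^sup>2 + 2 * q + 3)\<close>. The difference vanishes for an exactly quadratic function, so it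
  measures the deviation from quadratic growth under doubling, and this deviation is comparable
  to the square of the function.\<close>

lemma gauss_gap_double:
  shows gauss_gap_double_lower: "3 * (gauss_gap u)\<^sup>2 \<le> 4 * gauss_gap u - gauss_gap (2 * u)"
    and gauss_gap_double_upper: "4 * gauss_gap u - gauss_gap (2 * u) \<le> 6 * (gauss_gap u)\<^sup>2"
proof -
  define q where "q = exp (- (u\<^sup>2 / 2))"
  have q: "0 \<le> q" "q \<le> 1" by (auto simp: q_def)
  have "exp (- ((2 * u)\<^sup>2 / 2)) = exp (of_nat 4 * - (u\<^sup>2 / 2))"
    by (simp add: power_mult_distrib)
  then have "exp (- ((2 * u)\<^sup>2 / 2)) = q ^ 4" unfolding q_def exp_of_nat_mult .
  then have hq2: "gauss_gap (2 * u) = 1 - q ^ 4" by (simp add: gauss_gap_def)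
  have hq: "gauss_gap u = 1 - q" by (simp add: gauss_gap_def q_def)
  have eq: "4 * gauss_gap u - gauss_gap (2 * u) = (1 - q)\<^sup>2 * (q\<^sup>2 + 2 * q + 3)"
    unfolding hq hq2 by algebra
  show "3 * (gauss_gap u)\<^sup>2 \<le> 4 * gauss_gap u - gauss_gap (2 * u)"
    unfolding eq unfolding hq using mult_left_mono[of 3 "q\<^sup>2 + 2 * q + 3" "(1 - q)\<^sup>2"] q by simp
  have "q\<^sup>2 \<le> 1" using q by (simp add: abs_square_le_1)
  then show "4 * gauss_gap u - gauss_gap (2 * u) \<le> 6 * (gauss_gap u)\<^sup>2"
    unfolding eq unfolding hq using mult_left_mono[of "q\<^sup>2 + 2 * q + 3" 6 "(1 - q)\<^sup>2"] q by simp
qed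

lemma cube_le_gauss_gap: "\<bar>u\<bar> \<le> 1 \<Longrightarrow> \<bar>u\<bar> ^ 3 \<le> 4 * (\<bar>u\<bar> * gauss_gap u)"
  using mult_left_mono[OF gauss_gap_ge_quarter_square[of u], of "\<bar>u\<bar>"]
  by (simp add: power3_eq_cube power2_eq_square abs_mult_self_eq)

lemma abs_le_gauss_gap: "1 \<le> \<bar>u\<bar> \<Longrightarrow> \<bar>u\<bar> \<le> 4 * (\<bar>u\<bar> * gauss_gap u)"
  using mult_left_mono[OF gauss_gap_ge_quarter[of u], of "\<bar>u\<bar>"] by simp

lemma exp_second_order_bound:
  fixes w r :: real
  assumes "\<bar>w\<bar> \<le> r"
  shows "\<bar>exp w - 1 - w - w\<^sup>2 / 2\<bar> \<le> exp r * \<bar>w\<bar> ^ 3"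
proof -
  obtain t where t: "\<bar>t\<bar> \<le> \<bar>w\<bar>" "exp w = (\<Sum>m<3. w ^ m / fact m) + exp t / fact 3 * w ^ 3"
    using Maclaurin_exp_le by blast
  have "exp w - 1 - w - w\<^sup>2 / 2 = exp t / 6 * w ^ 3"
    using t(2) by (simp add: numeral_3_eq_3 power2_eq_square fact_numeral)
  then have "\<bar>exp w - 1 - w - w\<^sup>2 / 2\<bar> = exp t / 6 * \<bar>w\<bar> ^ 3"
    by (simp only: abs_mult power_abs) simp
  also have "\<dots> \<le> exp r * \<bar>w\<bar> ^ 3"
  proof (intro mult_right_mono)
    have "exp t \<le> exp r" using t assms by simp
    moreover have "exp t / 6 \<le> exp t" by simp
    ultimately show "exp t / 6 \<le> exp r" by linarith
  qed simp
  finally show ?thesis .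
qed

text \<open>The expansion behind all moment computations. Near \<open>0\<close> it is a second-order Taylor expansion
  with an error of order \<open>\<bar>u\<bar> ^ 3\<close>; away from \<open>0\<close> the damping \<open>- A * u\<^sup>2\<close> keeps the exponential bounded,
  while \<open>\<bar>u\<bar> * gauss_gap u\<close> is comparable to \<open>\<bar>u\<bar>\<close> and absorbs the linear term.\<close>

lemma damped_exp_expansion:
  fixes l A :: real
  assumes A: "0 < A"
  obtains K where "0 \<le> K"
    "\<And>u. \<bar>exp (l * u - A * u\<^sup>2) - 1 - l * u - (l\<^sup>2 - 2 * A) * gauss_gap u\<bar> \<le> K * (\<bar>u\<bar> * gauss_gap u)"
proof -
  define B where "B = \<bar>l\<bar> + A"
  define K1 where "K1 = exp B * B ^ 3 + \<bar>l\<bar> * A + A\<^sup>2 / 2 + \<bar>l\<^sup>2 - 2 * A\<bar> / 2"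
  define K2 where "K2 = exp (l\<^sup>2 / (4 * A)) + 1 + \<bar>l\<bar> + \<bar>l\<^sup>2 - 2 * A\<bar>"
  have B0: "0 \<le> B" using A by (simp add: B_def)
  have K1: "0 \<le> K1" using A B0 by (simp add: K1_def)
  have K2: "0 \<le> K2" by (simp add: K2_def)
  show thesis
  proof (rule that[of "4 * K1 + 4 * K2"])
    show "0 \<le> 4 * K1 + 4 * K2" using K1 K2 by simp
    fix u :: real
    let ?R = "exp (l * u - A * u\<^sup>2) - 1 - l * u - (l\<^sup>2 - 2 * A) * gauss_gap u"
    show "\<bar>?R\<bar> \<le> (4 * K1 + 4 * K2) * (\<bar>u\<bar> * gauss_gap u)"
    proof (cases "\<bar>u\<bar> \<le> 1")
      case True
      define w where "w = l * u - A * u\<^sup>2"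
      have u3: "u\<^sup>2 * \<bar>u\<bar> = \<bar>u\<bar> ^ 3" by (simp add: power3_eq_cube power2_eq_square)
      have uu: "u\<^sup>2 \<le> \<bar>u\<bar>"
        using mult_left_le[OF True, of "\<bar>u\<bar>"] by (simp add: power2_eq_square)
      have u4: "u ^ 4 \<le> \<bar>u\<bar> ^ 3"
        using power_decreasing[of 3 4 "\<bar>u\<bar>"] True by simp
      have "\<bar>w\<bar> \<le> \<bar>l * u\<bar> + \<bar>A * u\<^sup>2\<bar>" unfolding w_def by (rule abs_triangle_ineq4)
      also have "\<dots> \<le> \<bar>l\<bar> * \<bar>u\<bar> + A * \<bar>u\<bar>" using A uu by (simp add: abs_mult)
      finally have wB: "\<bar>w\<bar> \<le> B * \<bar>u\<bar>" by (simp add: B_def algebra_simps)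
      then have wB': "\<bar>w\<bar> \<le> B" using mult_left_mono[OF True B0] by simp
      have "\<bar>w\<bar> ^ 3 \<le> (B * \<bar>u\<bar>) ^ 3" using wB by (intro power_mono) auto
      then have e1: "\<bar>exp w - 1 - w - w\<^sup>2 / 2\<bar> \<le> exp B * B ^ 3 * \<bar>u\<bar> ^ 3"
        using order_trans[OF exp_second_order_bound[OF wB'] mult_left_mono[of "\<bar>w\<bar> ^ 3" "(B * \<bar>u\<bar>) ^ 3" "exp B"]]
        by (simp only: power_mult_distrib mult.assoc) simp
      have e2: "\<bar>l * A * u ^ 3\<bar> \<le> \<bar>l\<bar> * A * \<bar>u\<bar> ^ 3" using A by (simp add: abs_mult power_abs)
      have e3: "\<bar>A\<^sup>2 / 2 * u ^ 4\<bar> \<le> A\<^sup>2 / 2 * \<bar>u\<bar> ^ 3" using u4 by (simp add: abs_mult mult_left_mono)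
      have "\<bar>u\<^sup>2 / 2 - gauss_gap u\<bar> \<le> \<bar>u\<bar> ^ 3 / 2"
        using gauss_gap_le_square[of u] gauss_gap_ge_cubic[of u] by linarith
      then have e4: "\<bar>(l\<^sup>2 - 2 * A) * (u\<^sup>2 / 2 - gauss_gap u)\<bar> \<le> \<bar>l\<^sup>2 - 2 * A\<bar> / 2 * \<bar>u\<bar> ^ 3"
        using mult_left_mono[of "\<bar>u\<^sup>2 / 2 - gauss_gap u\<bar>" "\<bar>u\<bar> ^ 3 / 2" "\<bar>l\<^sup>2 - 2 * A\<bar>"]
        by (simp add: abs_mult)
      have "?R = (exp w - 1 - w - w\<^sup>2 / 2) - l * A * u ^ 3 + A\<^sup>2 / 2 * u ^ 4
          + (l\<^sup>2 - 2 * A) * (u\<^sup>2 / 2 - gauss_gap u)"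
        unfolding w_def by (simp add: power2_eq_square power3_eq_cube power4_eq_xxxx field_simps)
      then have "\<bar>?R\<bar> \<le> exp B * B ^ 3 * \<bar>u\<bar> ^ 3 + \<bar>l\<bar> * A * \<bar>u\<bar> ^ 3 + A\<^sup>2 / 2 * \<bar>u\<bar> ^ 3
          + \<bar>l\<^sup>2 - 2 * A\<bar> / 2 * \<bar>u\<bar> ^ 3"
        using e1 e2 e3 e4 by linarith
      also have "\<dots> = K1 * \<bar>u\<bar> ^ 3" by (simp add: K1_def algebra_simps)
      also have "\<dots> \<le> K1 * (4 * (\<bar>u\<bar> * gauss_gap u))"
        using cube_le_gauss_gap[OF True] K1 by (rule mult_left_mono)
      also have "\<dots> \<le> (4 * K1 + 4 * K2) * (\<bar>u\<bar> * gauss_gap u)"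
        using K2 by (simp add: algebra_simps)
      finally show ?thesis .
    next
      case False
      have "l * u - A * u\<^sup>2 = l\<^sup>2 / (4 * A) - A * (u - l / (2 * A))\<^sup>2"
        using A by (simp add: power2_eq_square field_simps)
      also have "\<dots> \<le> l\<^sup>2 / (4 * A)" using A by simp
      finally have e1: "exp (l * u - A * u\<^sup>2) \<le> exp (l\<^sup>2 / (4 * A))" by simp
      have e2: "\<bar>(l\<^sup>2 - 2 * A) * gauss_gap u\<bar> \<le> \<bar>l\<^sup>2 - 2 * A\<bar>"
        using mult_left_le[OF gauss_gap_le_1[of u], of "\<bar>l\<^sup>2 - 2 * A\<bar>"] by (simp add: abs_mult)
      have "\<bar>?R\<bar> \<le> exp (l\<^sup>2 / (4 * A)) + 1 + \<bar>l\<bar> * \<bar>u\<bar> + \<bar>l\<^sup>2 - 2 * A\<bar>"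
        using e1 e2 abs_mult[of l u] exp_gt_zero[of "l * u - A * u\<^sup>2"] by linarith
      also have "\<dots> \<le> K2 * \<bar>u\<bar>"
      proof -
        have "1 * (exp (l\<^sup>2 / (4 * A)) + 1 + \<bar>l\<^sup>2 - 2 * A\<bar>) \<le> \<bar>u\<bar> * (exp (l\<^sup>2 / (4 * A)) + 1 + \<bar>l\<^sup>2 - 2 * A\<bar>)"
          using False by (intro mult_right_mono) auto
        then show ?thesis by (simp add: K2_def algebra_simps)
      qed
      also have "\<dots> \<le> K2 * (4 * (\<bar>u\<bar> * gauss_gap u))"
        using abs_le_gauss_gap[of u] False K2 by (intro mult_left_mono) auto
      also have "\<dots> \<le> (4 * K1 + 4 * K2) * (\<bar>u\<bar> * gauss_gap u)"
        using K1 by (simp add: algebra_simps)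
      finally show ?thesis .
    qed
  qed
qed

text \<open>The analogue of the preceding expansion when large values are truncated instead of damped;
  here an upper bound suffices.\<close>

lemma truncated_exp_bound:
  fixes l m :: real
  assumes l: "0 \<le> l"
  obtains K where "0 \<le> K"
    "\<And>u. (if \<bar>u\<bar> \<le> 1 then exp (l * u) else exp m) \<le> 1 + l * u + K * (gauss_gap u + \<bar>u\<bar> * gauss_gap u)"
proof -
  define K1 where "K1 = 4 * (l\<^sup>2 / 2 + exp l * l ^ 3)"
  define K2 where "K2 = 4 * (exp m + l)"
  have K: "0 \<le> K1" "0 \<le> K2" using l by (simp_all add: K1_def K2_def)
  show thesis
  proof (rule that[of "K1 + K2"])
    show "0 \<le> K1 + K2" using K by simp
    fix u :: real
    have *: "Ki * x \<le> (K1 + K2) * (gauss_gap u + \<bar>u\<bar> * gauss_gap u)"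
      if "Ki = K1 \<or> Ki = K2" "0 \<le> x" "x \<le> gauss_gap u + \<bar>u\<bar> * gauss_gap u" for Ki x
      using that K by (intro mult_mono) auto
    show "(if \<bar>u\<bar> \<le> 1 then exp (l * u) else exp m) \<le> 1 + l * u + (K1 + K2) * (gauss_gap u + \<bar>u\<bar> * gauss_gap u)"
    proof (cases "\<bar>u\<bar> \<le> 1")
      case True
      have lu: "\<bar>l * u\<bar> \<le> l" using mult_left_mono[OF True l] l by (simp add: abs_mult)
      have "\<bar>l * u\<bar> ^ 3 = l ^ 3 * \<bar>u\<bar> ^ 3" using l by (simp add: abs_mult power_mult_distrib)
      also have "\<dots> \<le> l ^ 3 * u\<^sup>2"
        using power_decreasing[of 2 3 "\<bar>u\<bar>"] True l by (intro mult_left_mono) auto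
      finally have "exp l * \<bar>l * u\<bar> ^ 3 \<le> exp l * (l ^ 3 * u\<^sup>2)" by (rule mult_left_mono) simp
      note cubic = this
      have "exp (l * u) \<le> 1 + l * u + ((l * u)\<^sup>2 / 2 + exp l * (l ^ 3 * u\<^sup>2))"
        using exp_second_order_bound[OF lu] cubic by linarith
      also have "(l * u)\<^sup>2 / 2 + exp l * (l ^ 3 * u\<^sup>2) = K1 * (u\<^sup>2 / 4)"
        by (simp add: K1_def power_mult_distrib distrib_right)
      finally have "exp (l * u) \<le> 1 + l * u + K1 * (u\<^sup>2 / 4)" .
      also have "K1 * (u\<^sup>2 / 4) \<le> (K1 + K2) * (gauss_gap u + \<bar>u\<bar> * gauss_gap u)"
        by (rule *) (use gauss_gap_ge_quarter_square[OF True] in \<open>auto simp: add_increasing2\<close>)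
      finally show ?thesis using True by simp
    next
      case False
      have "exp m + l * \<bar>u\<bar> \<le> (exp m + l) * \<bar>u\<bar>"
        using mult_left_mono[of 1 "\<bar>u\<bar>" "exp m"] False by (simp add: algebra_simps)
      also have "\<dots> = K2 * (\<bar>u\<bar> / 4)" by (simp add: K2_def)
      also have "\<dots> \<le> (K1 + K2) * (gauss_gap u + \<bar>u\<bar> * gauss_gap u)"
        by (rule *) (use abs_le_gauss_gap[of u] False in \<open>auto simp: add_increasing\<close>)
      moreover have "- (l * u) \<le> l * \<bar>u\<bar>" using l by (simp add: minus_le_iff abs_if mult_nonneg_nonpos2 mult_left_mono)
      ultimately show ?thesis using False by simp
    qed
  qed
qed

text \<open>For small \<open>\<bar>u\<bar>\<close> the factor \<open>\<bar>u\<bar>\<close> is itself small; for large \<open>\<bar>u\<bar>\<close> both values of the function are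
  exponentially close to \<open>1\<close>, so that the left-hand side stays bounded while \<open>(gauss_gap u)\<^sup>2\<close> is
  bounded below.\<close>

lemma gauss_gap_halving_increment:
  fixes e :: real
  assumes e: "0 < e"
  obtains K where "0 \<le> K"
    "\<And>u. \<bar>u\<bar> * (gauss_gap u - gauss_gap (u / 2)) \<le> e * gauss_gap u + K * (gauss_gap u)\<^sup>2"
\<comment> \<open>The constant \<open>8\<close> bounds the left-hand side for all \<open>u\<close> outside \<open>[- e, e]\<close>.\<close>
proof (rule that[of "8 / (gauss_gap e)\<^sup>2"])
  show "0 \<le> 8 / (gauss_gap e)\<^sup>2" by simp
  fix u :: real
  have diff: "0 \<le> gauss_gap u - gauss_gap (u / 2)" by (simp add: gauss_gap_mono)
  show "\<bar>u\<bar> * (gauss_gap u - gauss_gap (u / 2)) \<le> e * gauss_gap u + 8 / (gauss_gap e)\<^sup>2 * (gauss_gap u)\<^sup>2"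
  proof (cases "\<bar>u\<bar> \<le> e")
    case True
    have "\<bar>u\<bar> * (gauss_gap u - gauss_gap (u / 2)) \<le> e * gauss_gap u"
      using True e diff by (intro mult_mono) auto
    then show ?thesis by (simp add: add_increasing2)
  next
    case False
    have "gauss_gap u - gauss_gap (u / 2) \<le> exp (- ((u / 2)\<^sup>2 / 2))" by (simp add: gauss_gap_def)
    also have "\<dots> \<le> 1 / (1 + u\<^sup>2 / 8)"
    proof -
      have "1 + u\<^sup>2 / 8 \<le> exp (u\<^sup>2 / 8)" by (rule exp_ge_add_one_self)
      then show ?thesis
        by (simp add: exp_minus inverse_eq_divide power_divide frac_le add_pos_nonneg)
    qed
    also have "\<dots> \<le> 8 / \<bar>u\<bar>"
    proof -
      have "\<bar>u\<bar> \<le> 8 + u\<^sup>2"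
      proof (cases "1 \<le> \<bar>u\<bar>")
        case True
        then show ?thesis using self_le_power[of "\<bar>u\<bar>" 2] by simp
      next
        case False
        then show ?thesis using zero_le_power2[of u] by linarith
      qed
      then show ?thesis using False e by (simp add: field_simps add_pos_nonneg)
    qed
    finally have "\<bar>u\<bar> * (gauss_gap u - gauss_gap (u / 2)) \<le> 8"
      using False e by (simp add: field_simps)
    also have "8 \<le> 8 / (gauss_gap e)\<^sup>2 * (gauss_gap u)\<^sup>2"
    proof -
      have "gauss_gap e \<le> gauss_gap u" using False e by (intro gauss_gap_mono) auto
      then have "(gauss_gap e)\<^sup>2 \<le> (gauss_gap u)\<^sup>2" by (intro power_mono) auto
      then show ?thesis using gauss_gap_pos[of e] e by (simp add: field_simps)
    qed
    finally show ?thesis using e by (simp add: add_increasing)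
  qed
qed

section \<open>Laws with mean zero and their scale functions\<close>

text \<open>\<open>gap P c\<close> plays the part of a truncated variance divided by \<open>2 * c\<^sup>2\<close>, and \<open>cubic_gap P c\<close> that
  of a truncated third absolute moment divided by \<open>2 * c ^ 3\<close>. A law behaves like a Gaussian one at
  scale \<open>c\<close> if the second quantity is negligible against the first.\<close>

definition gap :: "real measure \<Rightarrow> real \<Rightarrow> real" where
  "gap P c = (\<integral>x. gauss_gap (x / c) \<partial>P)"

definition cubic_gap :: "real measure \<Rightarrow> real \<Rightarrow> real" where
  "cubic_gap P c = (\<integral>x. \<bar>x / c\<bar> * gauss_gap (x / c) \<partial>P)"

lemmas integrable_linear =
  Bochner_Integration.integrable_add Bochner_Integration.integrable_diff integrable_mult_right

locale centred_law = real_distribution P for P :: "real measure" +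
  assumes integrable_id: "integrable P (\<lambda>x. x)"
    and mean_zero: "(\<integral>x. x \<partial>P) = 0"
begin

lemma integrable_scaled: "integrable P (\<lambda>x. a * x)" "integrable P (\<lambda>x. x / c)"
  "(\<integral>x. a * x \<partial>P) = 0" "(\<integral>x. x / c \<partial>P) = 0"
  using integrable_id mean_zero by auto

lemma integrable_gauss_gap: "integrable P (\<lambda>x. gauss_gap (g x))" if "g \<in> borel_measurable borel"
  using that by (intro integrable_const_bound[where B=1]) auto

lemma integrable_gauss_gap_square: "integrable P (\<lambda>x. (gauss_gap (g x))\<^sup>2)" if "g \<in> borel_measurable borel"
  using that by (intro integrable_const_bound[where B=1]) (auto simp: abs_square_le_1)

lemma integrable_abs_gauss_gap: "integrable P (\<lambda>x. \<bar>x / c\<bar> * gauss_gap (x / d))"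
proof (rule Bochner_Integration.integrable_bound[OF integrable_abs[OF integrable_scaled(2)[of c]]])
  show "AE x in P. norm (\<bar>x / c\<bar> * gauss_gap (x / d)) \<le> norm \<bar>x / c\<bar>"
    by (intro AE_I2) (simp add: abs_mult mult_left_le del: abs_divide)
qed simp

lemma gap_nonneg: "0 \<le> gap P c"
  unfolding gap_def by (intro integral_nonneg_AE AE_I2) simp

lemma gap_le_1: "gap P c \<le> 1"
  unfolding gap_def using integral_mono[OF integrable_gauss_gap[of "\<lambda>x. x / c"], of "\<lambda>_. 1"]
  by (simp add: prob_space[simplified])

lemma cubic_gap_nonneg: "0 \<le> cubic_gap P c"
  unfolding cubic_gap_def by (intro integral_nonneg_AE AE_I2) simp

lemma gap_antimono: "0 < c \<Longrightarrow> c \<le> d \<Longrightarrow> gap P d \<le> gap P c"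
  unfolding gap_def
  by (intro integral_mono integrable_gauss_gap gauss_gap_mono) (auto simp: abs_divide frac_le)

lemma gap_continuous_on: "continuous_on {0<..} (gap P)"
  unfolding continuous_on_sequentially
proof (intro allI ballI impI, elim conjE)
  fix x :: "nat \<Rightarrow> real" and c assume c: "c \<in> {0<..}" and "\<forall>n. x n \<in> {0<..}" and x: "x \<longlonglongrightarrow> c"
  have "(\<lambda>n. gauss_gap (y / x n)) \<longlonglongrightarrow> gauss_gap (y / c)" for y
    unfolding gauss_gap_def using c x by (auto intro!: tendsto_intros)
  then show "(gap P \<circ> x) \<longlonglongrightarrow> gap P c"
    unfolding comp_def gap_def
    by (intro integral_dominated_convergence[where w="\<lambda>_. 1"]) auto
qed

lemma gap_tendsto_0: "(gap P \<longlongrightarrow> 0) at_top"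
proof -
  have "((\<lambda>c. gauss_gap (x / c)) \<longlongrightarrow> 0) at_top" for x :: real
  proof -
    have "((\<lambda>c. x / c) \<longlongrightarrow> 0) at_top"
      by (rule real_tendsto_divide_at_top[OF tendsto_const filterlim_ident])
    then have "((\<lambda>c. 1 - exp (- ((x / c)\<^sup>2 / 2))) \<longlongrightarrow> 1 - exp (- (0\<^sup>2 / 2))) at_top"
      by (intro tendsto_intros) auto
    then show ?thesis by (simp add: gauss_gap_def)
  qed
  then have "((\<lambda>c. \<integral>x. gauss_gap (x / c) \<partial>P) \<longlongrightarrow> (\<integral>x. 0 \<partial>P)) at_top"
    by (intro integral_dominated_convergence_at_top[where w="\<lambda>_. 1"]) auto
  then show ?thesis by (simp add: gap_def[abs_def])
qed

lemma exists_gap_scale: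
  assumes "0 < c0" "0 < y" "y \<le> gap P c0"
  obtains a where "c0 \<le> a" "gap P a = y"
proof -
  have "\<forall>\<^sub>F c in at_top. gap P c < y"
    using gap_tendsto_0 assms(2) by (rule order_tendstoD)
  then obtain d where "c0 \<le> d" "gap P d < y"
    unfolding eventually_at_top_linorder by (meson nle_le order_refl)
  moreover have "continuous_on {c0..d} (gap P)"
    using gap_continuous_on by (rule continuous_on_subset) (use assms in auto)
  ultimately obtain a where "c0 \<le> a" "a \<le> d" "gap P a = y"
    using IVT2'[of "gap P" d y c0] assms by auto
  then show thesis using that by blast
qed

text \<open>The pointwise doubling defect is of the order of \<open>(gauss_gap u)\<^sup>2\<close>, which is at most
  \<open>\<bar>u\<bar> * gauss_gap u\<close>.\<close>

lemma gap_double: "4 * gap P (2 * c) - gap P c \<le> 6 * cubic_gap P (2 * c)"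
proof -
  have "4 * gauss_gap (x / (2 * c)) - gauss_gap (x / c) \<le> 6 * (\<bar>x / (2 * c)\<bar> * gauss_gap (x / (2 * c)))" for x
  proof -
    have "4 * gauss_gap (x / (2 * c)) - gauss_gap (2 * (x / (2 * c))) \<le> 6 * (gauss_gap (x / (2 * c)))\<^sup>2"
      by (rule gauss_gap_double_upper)
    also have "(gauss_gap (x / (2 * c)))\<^sup>2 \<le> \<bar>x / (2 * c)\<bar> * gauss_gap (x / (2 * c))"
      unfolding power2_eq_square by (intro mult_right_mono gauss_gap_le_abs gauss_gap_nonneg)
    finally show ?thesis by simp
  qed
  then have "(\<integral>x. 4 * gauss_gap (x / (2 * c)) - gauss_gap (x / c) \<partial>P)
      \<le> (\<integral>x. 6 * (\<bar>x / (2 * c)\<bar> * gauss_gap (x / (2 * c))) \<partial>P)"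
    by (intro integral_mono integrable_linear(2) integrable_mult_right
        integrable_gauss_gap integrable_abs_gauss_gap) auto
  then show ?thesis
    by (simp add: gap_def cubic_gap_def integrable_gauss_gap integrable_abs_gauss_gap)
qed

text \<open>The mean is zero, so the linear term of the expansion disappears.\<close>

lemma damped_exp_integral:
  assumes "\<And>u. \<bar>exp (l * u - A * u\<^sup>2) - 1 - l * u - (l\<^sup>2 - 2 * A) * gauss_gap u\<bar> \<le> K * (\<bar>u\<bar> * gauss_gap u)"
  shows "integrable P (\<lambda>x. exp (l * (x / c) - A * (x / c)\<^sup>2))"
    and "\<bar>(\<integral>x. exp (l * (x / c) - A * (x / c)\<^sup>2) \<partial>P) - (1 + (l\<^sup>2 - 2 * A) * gap P c)\<bar> \<le> K * cubic_gap P c"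
proof -
  define R where "R u = exp (l * u - A * u\<^sup>2) - 1 - l * u - (l\<^sup>2 - 2 * A) * gauss_gap u" for u
  have [measurable]: "R \<in> borel_measurable borel" unfolding R_def by measurable
  have intK: "integrable P (\<lambda>x. K * (\<bar>x / c\<bar> * gauss_gap (x / c)))"
    by (intro integrable_mult_right integrable_abs_gauss_gap)
  have intR: "integrable P (\<lambda>x. R (x / c))"
    using intK
    by (rule Bochner_Integration.integrable_bound)
      (auto intro!: AE_I2 order_trans[OF assms[folded R_def] abs_ge_self] simp del: abs_divide)
  have intM: "integrable P (\<lambda>x. 1 + l * (x / c) + (l\<^sup>2 - 2 * A) * gauss_gap (x / c))"
    by (intro integrable_linear integrable_scaled integrable_gauss_gap integrable_const) simp
  have eq: "exp (l * (x / c) - A * (x / c)\<^sup>2) = (1 + l * (x / c) + (l\<^sup>2 - 2 * A) * gauss_gap (x / c)) + R (x / c)" for x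
    by (simp add: R_def)
  show "integrable P (\<lambda>x. exp (l * (x / c) - A * (x / c)\<^sup>2))"
    unfolding eq by (rule integrable_linear(1)[OF intM intR])
  have "(\<integral>x. 1 + l * (x / c) + (l\<^sup>2 - 2 * A) * gauss_gap (x / c) \<partial>P) = 1 + (l\<^sup>2 - 2 * A) * gap P c"
    by (simp add: gap_def integrable_gauss_gap integrable_scaled prob_space[simplified] integrable_id mean_zero)
  then have "(\<integral>x. exp (l * (x / c) - A * (x / c)\<^sup>2) \<partial>P) - (1 + (l\<^sup>2 - 2 * A) * gap P c) = (\<integral>x. R (x / c) \<partial>P)"
    unfolding eq using Bochner_Integration.integral_add[OF intM intR] by simp
  also have "\<bar>\<dots>\<bar> \<le> (\<integral>x. \<bar>R (x / c)\<bar> \<partial>P)" by (rule integral_abs_bound)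
  also have "\<dots> \<le> (\<integral>x. K * (\<bar>x / c\<bar> * gauss_gap (x / c)) \<partial>P)"
    using assms[folded R_def] intR by (intro integral_mono intK integrable_abs)
  finally show "\<bar>(\<integral>x. exp (l * (x / c) - A * (x / c)\<^sup>2) \<partial>P) - (1 + (l\<^sup>2 - 2 * A) * gap P c)\<bar> \<le> K * cubic_gap P c"
    by (simp add: cubic_gap_def)
qed

lemma truncated_exp_integral:
  assumes "\<And>u. (if \<bar>u\<bar> \<le> 1 then exp (l * u) else exp m) \<le> 1 + l * u + K * (gauss_gap u + \<bar>u\<bar> * gauss_gap u)"
  shows "integrable P (\<lambda>x. if \<bar>x / c\<bar> \<le> 1 then exp (l * (x / c)) else exp m)"
    and "(\<integral>x. (if \<bar>x / c\<bar> \<le> 1 then exp (l * (x / c)) else exp m) \<partial>P) \<le> 1 + K * (gap P c + cubic_gap P c)"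
proof -
  let ?g = "\<lambda>u::real. if \<bar>u\<bar> \<le> 1 then exp (l * u) else exp m"
  have "?g u \<le> exp \<bar>l\<bar> + exp m" for u
  proof -
    have "l * u \<le> \<bar>l\<bar>" if "\<bar>u\<bar> \<le> 1"
      using mult_left_mono[OF that, of "\<bar>l\<bar>"] abs_ge_self[of "l * u"] by (simp add: abs_mult)
    then show ?thesis by (simp add: add_increasing add_increasing2)
  qed
  then have bound: "norm (?g u) \<le> exp \<bar>l\<bar> + exp m" for u
    by (smt (verit, ccfv_SIG) exp_gt_zero real_norm_def)
  show int: "integrable P (\<lambda>x. ?g (x / c))"
    by (rule integrable_const_bound[OF AE_I2[OF bound]]) simp
  have "(\<integral>x. ?g (x / c) \<partial>P) \<le> (\<integral>x. 1 + l * (x / c) + K * (gauss_gap (x / c) + \<bar>x / c\<bar> * gauss_gap (x / c)) \<partial>P)"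
    by (intro integral_mono int assms integrable_linear
        integrable_scaled integrable_gauss_gap integrable_abs_gauss_gap integrable_const) auto
  also have "\<dots> = 1 + K * (gap P c + cubic_gap P c)"
    by (simp add: gap_def cubic_gap_def integrable_gauss_gap integrable_abs_gauss_gap integrable_scaled integrable_id
        mean_zero prob_space[simplified] del: abs_divide)
  finally show "(\<integral>x. ?g (x / c) \<partial>P) \<le> 1 + K * (gap P c + cubic_gap P c)" .
qed

end

lemma iid_expectation_prod:
  fixes g :: "real \<Rightarrow> real"
  assumes iid: "iid_with_law M X P" and [measurable]: "g \<in> borel_measurable borel"
    and int: "integrable P g"
  shows "integrable M (\<lambda>\<omega>. \<Prod>i<n. g (X i \<omega>))"
    and "(\<integral>\<omega>. (\<Prod>i<n. g (X i \<omega>)) \<partial>M) = (\<integral>x. g x \<partial>P) ^ n"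
proof -
  interpret M: prob_space M using iid by (simp add: iid_with_law_def)
  have ind: "M.indep_vars (\<lambda>_. borel) X UNIV" and law: "\<And>i. distr M borel (X i) = P"
    using iid by (auto simp: iid_with_law_def)
  have [measurable]: "X i \<in> borel_measurable M" for i
    using ind by (auto simp: M.indep_vars_def)
  have ind_g: "M.indep_vars (\<lambda>_. borel) (\<lambda>i \<omega>. g (X i \<omega>)) {..<n}"
    by (rule M.indep_vars_subset[OF M.indep_vars_compose2[OF ind, where Y="\<lambda>_. g" and N="\<lambda>_. borel"]]) auto
  have ig: "integrable M (\<lambda>\<omega>. g (X i \<omega>))" for i
  proof -
    have "integrable (distr M borel (X i)) g" unfolding law by (rule int)
    then show ?thesis by (subst (asm) integrable_distr_eq) auto
  qed
  have eg: "(\<integral>\<omega>. g (X i \<omega>) \<partial>M) = (\<integral>x. g x \<partial>P)" for i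
    using integral_distr[of "X i" M borel g] by (simp add: law)
  show "integrable M (\<lambda>\<omega>. \<Prod>i<n. g (X i \<omega>))"
    by (rule M.indep_vars_integrable[OF _ ind_g ig]) auto
  show "(\<integral>\<omega>. (\<Prod>i<n. g (X i \<omega>)) \<partial>M) = (\<integral>x. g x \<partial>P) ^ n"
    using M.indep_vars_lebesgue_integral[OF _ ind_g ig] by (simp add: eg)
qed

lemma
  assumes [measurable]: "\<And>i. X i \<in> borel_measurable M"
  shows S_stat_measurable [measurable]: "S_stat X \<theta> n \<in> borel_measurable M"
    and V_stat_measurable [measurable]: "V_stat X \<theta> n \<in> borel_measurable M"
  unfolding S_stat_def[abs_def] V_stat_def[abs_def] by measurable

lemma V_stat_nonneg: "0 \<le> V_stat X \<theta> n \<omega>"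
  by (simp add: V_stat_def sum_nonneg)

lemma V_stat_square: "(V_stat X \<theta> n \<omega>)\<^sup>2 = (\<Sum>i<n. (X i \<omega> - \<theta>)\<^sup>2)"
  by (simp add: V_stat_def sum_nonneg)

lemma abs_increment_le_V_stat: "i < n \<Longrightarrow> \<bar>X i \<omega> - \<theta>\<bar> \<le> V_stat X \<theta> n \<omega>"
  unfolding V_stat_def using member_le_sum[of i "{..<n}" "\<lambda>i. (X i \<omega> - \<theta>)\<^sup>2"]
  by (intro real_le_rsqrt) simp

lemma self_normalised_le_sqrt: "\<bar>S_stat X \<theta> n \<omega> / V_stat X \<theta> n \<omega>\<bar> \<le> sqrt n"
proof (cases "V_stat X \<theta> n \<omega> = 0")
  case False
  have "(S_stat X \<theta> n \<omega>)\<^sup>2 \<le> n * (V_stat X \<theta> n \<omega>)\<^sup>2"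
    using sum_squared_le_sum_of_squares[of "\<lambda>i. X i \<omega> - \<theta>" "{..<n}"]
    by (simp add: S_stat_def V_stat_square mult.commute)
  then have "\<bar>S_stat X \<theta> n \<omega>\<bar> \<le> sqrt n * V_stat X \<theta> n \<omega>"
    using V_stat_nonneg[of X \<theta> n \<omega>] by (simp add: real_le_rsqrt flip: real_sqrt_abs) (metis V_stat_nonneg abs_of_nonneg real_sqrt_abs real_sqrt_le_mono real_sqrt_mult)
  then show ?thesis
    using False V_stat_nonneg[of X \<theta> n \<omega>] by (simp add: abs_divide divide_le_eq)
qed simp

section \<open>Exponential moments of self-normalised sums\<close>

text \<open>Since \<open>\<bar>x i\<bar> \<le> V\<close>, each term larger than \<open>a\<close> contributes at most \<open>1\<close> to the quotient. The sum of
  the remaining terms, if positive, only grows when it is divided by \<open>a \<le> V\<close> instead of \<open>V\<close>; if it is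
  negative it is dropped, which gives the second sum.\<close>

lemma self_normalised_le_truncated_sums:
  fixes x :: "nat \<Rightarrow> real"
  assumes a: "0 < a" "a \<le> V" and xV: "\<And>i. i < n \<Longrightarrow> \<bar>x i\<bar> \<le> V"
  shows "(\<Sum>i<n. x i) / V \<le> max (\<Sum>i<n. if \<bar>x i / a\<bar> \<le> 1 then x i / a else 1)
                                 (\<Sum>i<n. if \<bar>x i / a\<bar> \<le> 1 then 0 else 1)"
proof -
  let ?t = "\<lambda>i. if \<bar>x i / a\<bar> \<le> 1 then x i / a else 0"
  let ?N = "\<Sum>i<n. if \<bar>x i / a\<bar> \<le> 1 then 0 else (1::real)"
  have V: "0 < V" using a by simp
  have "x i / V \<le> a / V * ?t i + (if \<bar>x i / a\<bar> \<le> 1 then 0 else 1)" if "i < n" for i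
    using xV[OF that] a V by (auto simp: divide_le_eq)
  then have "(\<Sum>i<n. x i / V) \<le> (\<Sum>i<n. a / V * ?t i + (if \<bar>x i / a\<bar> \<le> 1 then 0 else 1))"
    by (intro sum_mono) auto
  then have *: "(\<Sum>i<n. x i) / V \<le> a / V * (\<Sum>i<n. ?t i) + ?N"
    unfolding sum.distrib sum_distrib_left[symmetric] by (simp add: sum_divide_distrib)
  have N: "(\<Sum>i<n. ?t i) + ?N = (\<Sum>i<n. if \<bar>x i / a\<bar> \<le> 1 then x i / a else 1)"
    unfolding sum.distrib[symmetric] by (intro sum.cong) auto
  show ?thesis
  proof (cases "0 \<le> (\<Sum>i<n. ?t i)")
    case True
    have "a / V * (\<Sum>i<n. ?t i) \<le> 1 * (\<Sum>i<n. ?t i)"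
      using True a V by (intro mult_right_mono) auto
    then show ?thesis using * N by linarith
  next
    case False
    then have "a / V * (\<Sum>i<n. ?t i) \<le> 0" using a V by (intro mult_nonneg_nonpos) auto
    then show ?thesis using * by linarith
  qed
qed

locale iid_sample = centred_law P for P +
  fixes M :: "'a measure" and X :: "nat \<Rightarrow> 'a \<Rightarrow> real"
  assumes iid: "iid_with_law M X P"
begin

sublocale M: prob_space M
  using iid by (simp add: iid_with_law_def)

lemma X_measurable [measurable]: "X i \<in> borel_measurable M"
  using iid by (auto simp: iid_with_law_def M.indep_vars_def)

abbreviation S where "S \<equiv> S_stat X 0"
abbreviation V where "V \<equiv> V_stat X 0"

lemma V_nonneg: "0 \<le> V n \<omega>"
  by (rule V_stat_nonneg)

lemma damped_exp_eq_prod: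
  "exp (l * (S n \<omega> / c) - A * (V n \<omega> / c)\<^sup>2)
    = (\<Prod>i<n. exp (l * (X i \<omega> / c) - A * (X i \<omega> / c)\<^sup>2))"
  unfolding power_divide V_stat_square
  by (simp add: exp_sum[symmetric] S_stat_def sum_subtractf sum_distrib_left sum_divide_distrib)

lemma damped_mgf:
  assumes "0 < A"
  shows "integrable M (\<lambda>\<omega>. exp (l * (S n \<omega> / c) - A * (V n \<omega> / c)\<^sup>2))"
    and "(\<integral>\<omega>. exp (l * (S n \<omega> / c) - A * (V n \<omega> / c)\<^sup>2) \<partial>M)
      = (\<integral>x. exp (l * (x / c) - A * (x / c)\<^sup>2) \<partial>P) ^ n"
proof -
  obtain K where "\<And>u. \<bar>exp (l * u - A * u\<^sup>2) - 1 - l * u - (l\<^sup>2 - 2 * A) * gauss_gap u\<bar> \<le> K * (\<bar>u\<bar> * gauss_gap u)"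
    using damped_exp_expansion[OF assms] by metis
  from damped_exp_integral(1)[OF this]
  have "integrable P (\<lambda>x. exp (l * (x / c) - A * (x / c)\<^sup>2))" .
  from iid_expectation_prod[OF iid _ this]
  show "integrable M (\<lambda>\<omega>. exp (l * (S n \<omega> / c) - A * (V n \<omega> / c)\<^sup>2))"
    "(\<integral>\<omega>. exp (l * (S n \<omega> / c) - A * (V n \<omega> / c)\<^sup>2) \<partial>M)
      = (\<integral>x. exp (l * (x / c) - A * (x / c)\<^sup>2) \<partial>P) ^ n"
    unfolding damped_exp_eq_prod by auto
qed

lemma gaussian_damping_le:
  assumes "1 / 2 \<le> A"
  shows "(\<integral>\<omega>. exp (- (A * (V n \<omega> / c)\<^sup>2)) \<partial>M) \<le> exp (- (n * gap P c))"
proof -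
  have "(\<integral>\<omega>. exp (- (A * (V n \<omega> / c)\<^sup>2)) \<partial>M) \<le> (\<integral>\<omega>. exp (- (1 / 2 * (V n \<omega> / c)\<^sup>2)) \<partial>M)"
  proof (rule integral_mono)
    show "exp (- (A * (V n \<omega> / c)\<^sup>2)) \<le> exp (- (1 / 2 * (V n \<omega> / c)\<^sup>2))" for \<omega>
      using mult_right_mono[OF assms, of "(V n \<omega> / c)\<^sup>2"] by simp
  qed (use damped_mgf(1)[of A 0 n c] damped_mgf(1)[of "1/2" 0 n c] assms in auto)
  also have "\<dots> = (\<integral>x. exp (- (1 / 2 * (x / c)\<^sup>2)) \<partial>P) ^ n"
    using damped_mgf(2)[of "1/2" 0 n c] by simp
  also have "(\<integral>x. exp (- (1 / 2 * (x / c)\<^sup>2)) \<partial>P) = 1 - gap P c"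
  proof -
    have "exp (- (1 / 2 * (x / c)\<^sup>2)) = 1 - gauss_gap (x / c)" for x by (simp add: gauss_gap_def)
    then show ?thesis by (simp add: gap_def integrable_gauss_gap prob_space[simplified])
  qed
  also have "(1 - gap P c) ^ n \<le> exp (- gap P c) ^ n"
    using gap_le_1[of c] exp_ge_add_one_self[of "- gap P c"] by (intro power_mono) auto
  finally show ?thesis by (simp add: exp_of_nat_mult[symmetric])
qed

lemma exp_self_normalised_integrable:
  "integrable M (\<lambda>\<omega>. exp (l * (S n \<omega> / V n \<omega>)))"
proof (rule M.integrable_const_bound[where B="exp (\<bar>l\<bar> * sqrt n)"])
  have "l * (S n \<omega> / V n \<omega>) \<le> \<bar>l\<bar> * sqrt n" for \<omega>
  proof -
    have "l * (S n \<omega> / V n \<omega>) \<le> \<bar>l\<bar> * \<bar>S n \<omega> / V n \<omega>\<bar>"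
      using abs_ge_self[of "l * (S n \<omega> / V n \<omega>)"] by (simp only: abs_mult)
    also have "\<dots> \<le> \<bar>l\<bar> * sqrt n" by (intro mult_left_mono self_normalised_le_sqrt) simp
    finally show ?thesis .
  qed
  then show "AE \<omega> in M. norm (exp (l * (S n \<omega> / V n \<omega>))) \<le> exp (\<bar>l\<bar> * sqrt n)"
    by simp
qed simp

lemma exp_indicator_integrable:
  assumes [measurable]: "B \<in> sets borel"
  shows "integrable M (\<lambda>\<omega>. exp (l * (S n \<omega> / V n \<omega>)) * indicator B (V n \<omega>))"
  using exp_self_normalised_integrable[of l n]
  by (rule Bochner_Integration.integrable_bound) (auto intro!: AE_I2 simp: indicator_def)

text \<open>On \<open>a \<le> V\<close> the truncated sums replace the random normalisation by the fixed scale \<open>a\<close>; their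
  exponentials are products of independent factors, each with mean at most
  \<open>1 + 2 * K * gap P a\<close>.\<close>

lemma exp_self_normalised_large_V:
  assumes l: "0 \<le> l" and a: "0 < a" "cubic_gap P a \<le> gap P a"
    and K: "0 \<le> K"
      "\<And>u. (if \<bar>u\<bar> \<le> 1 then exp (0 * u) else exp l) \<le> 1 + 0 * u + K * (gauss_gap u + \<bar>u\<bar> * gauss_gap u)"
      "\<And>u. (if \<bar>u\<bar> \<le> 1 then exp (l * u) else exp l) \<le> 1 + l * u + K * (gauss_gap u + \<bar>u\<bar> * gauss_gap u)"
  shows "(\<integral>\<omega>. exp (l * (S n \<omega> / V n \<omega>)) * indicator {a..} (V n \<omega>) \<partial>M) \<le> 2 * exp (2 * K * (n * gap P a))"
proof -
  let ?g = "\<lambda>l' u. if \<bar>u\<bar> \<le> 1 then exp (l' * u) else exp l"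
  have bound: "(\<integral>\<omega>. (\<Prod>i<n. ?g l' (X i \<omega> / a)) \<partial>M) \<le> exp (2 * K * (n * gap P a))
      \<and> integrable M (\<lambda>\<omega>. \<Prod>i<n. ?g l' (X i \<omega> / a))"
    if l': "\<And>u. ?g l' u \<le> 1 + l' * u + K * (gauss_gap u + \<bar>u\<bar> * gauss_gap u)" for l'
  proof -
    define I where "I = (\<integral>x. ?g l' (x / a) \<partial>P)"
    have "0 \<le> I" unfolding I_def by (intro integral_nonneg_AE AE_I2) simp
    moreover have "I \<le> 1 + 2 * K * gap P a"
      using truncated_exp_integral(2)[OF l', of a, folded I_def] mult_left_mono[OF a(2) K(1)]
      by (simp add: algebra_simps)
    moreover have "1 + 2 * K * gap P a \<le> exp (2 * K * gap P a)" by (rule exp_ge_add_one_self)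
    ultimately have "I ^ n \<le> exp (2 * K * gap P a) ^ n"
      by (intro power_mono) linarith+
    also have "\<dots> = exp (2 * K * (n * gap P a))"
      by (simp add: exp_of_nat_mult[symmetric] algebra_simps)
    finally show ?thesis
      using iid_expectation_prod[OF iid _ truncated_exp_integral(1)[OF l'], of a n, folded I_def] by simp
  qed
  note b0 = bound[of 0, OF K(2)] and bl = bound[of l, OF K(3)]
  have pointwise: "exp (l * (S n \<omega> / V n \<omega>)) * indicator {a..} (V n \<omega>)
      \<le> (\<Prod>i<n. ?g 0 (X i \<omega> / a)) + (\<Prod>i<n. ?g l (X i \<omega> / a))" for \<omega>
  proof (cases "a \<le> V n \<omega>")
    case True
    let ?m1 = "\<Sum>i<n. if \<bar>X i \<omega> / a\<bar> \<le> 1 then X i \<omega> / a else 1"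
    let ?m0 = "\<Sum>i<n. if \<bar>X i \<omega> / a\<bar> \<le> 1 then 0 else (1::real)"
    have "S n \<omega> / V n \<omega> \<le> max ?m1 ?m0"
      using self_normalised_le_truncated_sums[OF a(1) True, of n "\<lambda>i. X i \<omega>"]
        abs_increment_le_V_stat[of _ n X \<omega> 0]
      by (simp add: S_stat_def)
    then have "l * (S n \<omega> / V n \<omega>) \<le> l * max ?m1 ?m0" using l by (rule mult_left_mono)
    then have "exp (l * (S n \<omega> / V n \<omega>)) \<le> exp (l * max ?m1 ?m0)" by simp
    also have "\<dots> \<le> exp (l * ?m0) + exp (l * ?m1)" by (simp add: max_def)
    also have "exp (l * ?m0) = (\<Prod>i<n. ?g 0 (X i \<omega> / a))"
      unfolding sum_distrib_left exp_sum[OF finite_lessThan] by (intro prod.cong) auto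
    also have "exp (l * ?m1) = (\<Prod>i<n. ?g l (X i \<omega> / a))"
      unfolding sum_distrib_left exp_sum[OF finite_lessThan] by (intro prod.cong) auto
    finally show ?thesis using True by simp
  next
    case False
    then show ?thesis by (simp add: prod_nonneg add_nonneg_nonneg del: abs_divide)
  qed
  have "(\<integral>\<omega>. exp (l * (S n \<omega> / V n \<omega>)) * indicator {a..} (V n \<omega>) \<partial>M)
      \<le> (\<integral>\<omega>. (\<Prod>i<n. ?g 0 (X i \<omega> / a)) + (\<Prod>i<n. ?g l (X i \<omega> / a)) \<partial>M)"
    by (intro integral_mono pointwise integrable_linear(1)
        exp_indicator_integrable conjunct2[OF b0] conjunct2[OF bl]) simp
  also have "\<dots> = (\<integral>\<omega>. (\<Prod>i<n. ?g 0 (X i \<omega> / a)) \<partial>M) + (\<integral>\<omega>. (\<Prod>i<n. ?g l (X i \<omega> / a)) \<partial>M)"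
    using b0 bl by (intro Bochner_Integration.integral_add) auto
  finally show ?thesis using b0 bl by linarith
qed

text \<open>On \<open>c \<le> V \<le> 2 * c\<close> the factor \<open>exp (4 * A - A * (V / c)\<^sup>2)\<close> is at least \<open>1\<close>, so it may be inserted
  for free. For \<open>2 * A = l\<^sup>2 + 1\<close> the expansion of the damped exponential has leading coefficient
  \<open>l\<^sup>2 - 2 * A = - 1\<close>, and the mean of the product decays exponentially in \<open>n * gap P c\<close>: it is very
  unlikely that \<open>V\<close> is as small as \<open>c\<close>.\<close>

lemma exp_self_normalised_dyadic_step:
  fixes l :: real
  defines "A \<equiv> (l\<^sup>2 + 1) / 2"
  assumes l: "0 \<le> l" and c: "0 < c" and K: "K * cubic_gap P c \<le> gap P c / 2"
      "\<And>u. \<bar>exp (l * u - A * u\<^sup>2) - 1 - l * u - (l\<^sup>2 - 2 * A) * gauss_gap u\<bar> \<le> K * (\<bar>u\<bar> * gauss_gap u)"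
  shows "(\<integral>\<omega>. exp (l * (S n \<omega> / V n \<omega>)) * indicator {c..} (V n \<omega>) \<partial>M)
    \<le> (\<integral>\<omega>. exp (l * (S n \<omega> / V n \<omega>)) * indicator {2 * c..} (V n \<omega>) \<partial>M)
      + 2 * exp (4 * A) * exp (- (n * gap P c / 2))"
proof -
  have A: "1 / 2 \<le> A" "0 < A" by (auto simp: A_def add_pos_nonneg add_nonneg_pos)
  let ?D0 = "\<lambda>\<omega>. exp (- (A * (V n \<omega> / c)\<^sup>2))"
  let ?Dl = "\<lambda>\<omega>. exp (l * (S n \<omega> / c) - A * (V n \<omega> / c)\<^sup>2)"
  let ?E = "\<lambda>d \<omega>. exp (l * (S n \<omega> / V n \<omega>)) * indicator {d..} (V n \<omega>)"
  have int0: "integrable M ?D0" using damped_mgf(1)[OF A(2), of 0 n c] by simp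
  have intl: "integrable M ?Dl" using damped_mgf(1)[OF A(2), of l n c] .
  have intE: "integrable M (?E d)" for d
    by (intro exp_indicator_integrable) simp
  have pointwise: "?E c \<omega> \<le> ?E (2 * c) \<omega> + exp (4 * A) * (?D0 \<omega> + ?Dl \<omega>)" for \<omega>
  proof (cases "c \<le> V n \<omega> \<and> V n \<omega> < 2 * c")
    case True
    let ?s = "S n \<omega>" and ?v = "V n \<omega>"
    have v: "0 < ?v" using True c by simp
    have "l * (?s / ?v) \<le> max 0 (l * (?s / c))"
    proof (cases "0 \<le> ?s")
      case s: True
      have "?s / ?v \<le> ?s / c" using s True c by (intro divide_left_mono) auto
      then show ?thesis using mult_left_mono[of "?s / ?v" "?s / c" l] l by simp
    next
      case False
      then have "l * (?s / ?v) \<le> 0" using l v by (simp add: mult_nonneg_nonpos divide_nonpos_pos)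
      then show ?thesis by simp
    qed
    then have "exp (l * (?s / ?v)) \<le> exp (max 0 (l * (?s / c)))" by simp
    also have "\<dots> \<le> 1 + exp (l * (?s / c))" by (simp add: max_def)
    also have "\<dots> \<le> (1 + exp (l * (?s / c))) * exp (4 * A - A * (?v / c)\<^sup>2)"
    proof -
      have "\<bar>?v / c\<bar> \<le> \<bar>2\<bar>" using True c v by (simp add: divide_le_eq)
      then have "(?v / c)\<^sup>2 \<le> 2\<^sup>2" by (simp only: abs_le_square_iff)
      then have "A * (?v / c)\<^sup>2 \<le> A * 4" using A by (intro mult_left_mono) auto
      then have "1 \<le> exp (4 * A - A * (?v / c)\<^sup>2)" by simp
      then show ?thesis using mult_left_mono[of 1 _ "1 + exp (l * (?s / c))"] by (simp add: add_nonneg_nonneg)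
    qed
    also have "\<dots> = exp (4 * A) * (?D0 \<omega> + ?Dl \<omega>)"
      by (simp add: algebra_simps exp_diff exp_minus exp_add field_simps)
    finally show ?thesis using True by simp
  next
    case False
    then show ?thesis using c by (auto simp: indicator_def add_nonneg_nonneg)
  qed
  have g: "0 \<le> gap P c" by (rule gap_nonneg)
  have "(\<integral>\<omega>. ?D0 \<omega> \<partial>M) \<le> exp (- (n * gap P c))" using A by (intro gaussian_damping_le)
  also have "\<dots> \<le> exp (- (n * gap P c / 2))" using g by simp
  finally have D0: "(\<integral>\<omega>. ?D0 \<omega> \<partial>M) \<le> exp (- (n * gap P c / 2))" .
  have "(\<integral>x. exp (l * (x / c) - A * (x / c)\<^sup>2) \<partial>P) \<le> 1 + (l\<^sup>2 - 2 * A) * gap P c + K * cubic_gap P c"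
    using damped_exp_integral(2)[OF K(2), of c] by linarith
  also have "l\<^sup>2 - 2 * A = - 1" by (simp add: A_def field_simps)
  also have "1 + - 1 * gap P c + K * cubic_gap P c \<le> 1 - gap P c / 2" using K(1) by simp
  also have "\<dots> \<le> exp (- (gap P c / 2))" using exp_ge_add_one_self[of "- (gap P c / 2)"] by simp
  finally have "(\<integral>x. exp (l * (x / c) - A * (x / c)\<^sup>2) \<partial>P) ^ n \<le> exp (- (gap P c / 2)) ^ n"
    by (intro power_mono integral_nonneg_AE AE_I2) simp_all
  then have Dl: "(\<integral>\<omega>. ?Dl \<omega> \<partial>M) \<le> exp (- (n * gap P c / 2))"
    unfolding damped_mgf(2)[OF A(2)] by (simp add: exp_of_nat_mult[symmetric])
  have "(\<integral>\<omega>. ?E c \<omega> \<partial>M) \<le> (\<integral>\<omega>. ?E (2 * c) \<omega> + exp (4 * A) * (?D0 \<omega> + ?Dl \<omega>) \<partial>M)"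
    by (intro integral_mono pointwise integrable_linear intE int0 intl)
  also have "\<dots> = (\<integral>\<omega>. ?E (2 * c) \<omega> \<partial>M) + exp (4 * A) * ((\<integral>\<omega>. ?D0 \<omega> \<partial>M) + (\<integral>\<omega>. ?Dl \<omega> \<partial>M))"
    unfolding Bochner_Integration.integral_add[OF int0 intl, symmetric]
    by (subst Bochner_Integration.integral_add[OF intE integrable_mult_right[OF integrable_linear(1)[OF int0 intl]]])
      (simp only: integral_mult_right_zero)
  also have "\<dots> \<le> (\<integral>\<omega>. ?E (2 * c) \<omega> \<partial>M) + exp (4 * A) * (2 * exp (- (n * gap P c / 2)))"
    using D0 Dl by (intro add_left_mono mult_left_mono) auto
  finally show ?thesis by (simp add: algebra_simps)
qed

text \<open>At a fixed scale \<open>c\<close> the crude bound \<open>\<bar>S / V\<bar> \<le> sqrt n\<close> is good enough, because \<open>V < 2 * c\<close> has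
  a probability that is exponentially small in \<open>n\<close>.\<close>

lemma exp_self_normalised_small_V:
  assumes l: "0 \<le> l" and c: "0 < c" and k: "0 < k" "k \<le> gap P c"
  shows "(\<integral>\<omega>. exp (l * (S n \<omega> / V n \<omega>)) * indicator {..<2 * c} (V n \<omega>) \<partial>M) \<le> exp (2 + l\<^sup>2 / (4 * k))"
proof -
  have pointwise: "exp (l * (S n \<omega> / V n \<omega>)) * indicator {..<2 * c} (V n \<omega>)
      \<le> exp (l * sqrt n + 2) * exp (- (1 / 2 * (V n \<omega> / c)\<^sup>2))" for \<omega>
  proof (cases "V n \<omega> < 2 * c")
    case True
    have "(V n \<omega> / c)\<^sup>2 \<le> 2\<^sup>2"
      using True c V_nonneg[of n \<omega>] by (intro power_mono) (auto simp: divide_le_eq)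
    moreover have "l * (S n \<omega> / V n \<omega>) \<le> l * sqrt n"
      using self_normalised_le_sqrt[of X 0 n \<omega>] l by (intro mult_left_mono) linarith+
    ultimately have "l * (S n \<omega> / V n \<omega>) \<le> (l * sqrt n + 2) + - (1 / 2 * (V n \<omega> / c)\<^sup>2)" by simp
    then have "exp (l * (S n \<omega> / V n \<omega>)) \<le> exp (l * sqrt n + 2) * exp (- (1 / 2 * (V n \<omega> / c)\<^sup>2))"
      unfolding exp_add[symmetric] by simp
    then show ?thesis using True by simp
  qed simp
  have "(\<integral>\<omega>. exp (l * (S n \<omega> / V n \<omega>)) * indicator {..<2 * c} (V n \<omega>) \<partial>M)
      \<le> (\<integral>\<omega>. exp (l * sqrt n + 2) * exp (- (1 / 2 * (V n \<omega> / c)\<^sup>2)) \<partial>M)"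
    using damped_mgf(1)[of "1/2" 0 n c]
    by (intro integral_mono pointwise integrable_mult_right
         exp_indicator_integrable) auto
  also have "\<dots> = exp (l * sqrt n + 2) * (\<integral>\<omega>. exp (- (1 / 2 * (V n \<omega> / c)\<^sup>2)) \<partial>M)" by simp
  also have "\<dots> \<le> exp (l * sqrt n + 2) * exp (- (n * gap P c))"
    by (intro mult_left_mono gaussian_damping_le) auto
  also have "\<dots> \<le> exp (2 + l\<^sup>2 / (4 * k))"
  proof -
    have sq: "k * (w - l / (2 * k))\<^sup>2 = k * w\<^sup>2 - l * w + l\<^sup>2 / (4 * k)" for w
      using k by (simp add: power2_eq_square field_simps)
    have "0 \<le> k * (sqrt n - l / (2 * k))\<^sup>2" using k by simp
    also have "\<dots> = k * n - l * sqrt n + l\<^sup>2 / (4 * k)"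
      unfolding sq by simp
    finally have "l * sqrt n - n * k \<le> l\<^sup>2 / (4 * k)" by (simp add: algebra_simps)
    moreover have "n * k \<le> n * gap P c" using k by (intro mult_left_mono) auto
    ultimately show ?thesis by (simp add: exp_add[symmetric])
  qed
  finally show ?thesis .
qed

lemma gap_grows_below_scale:
  assumes c0: "0 < c0" "\<And>c. c0 \<le> c \<Longrightarrow> 6 * cubic_gap P c \<le> gap P c"
    and k: "c0 \<le> a / 2 ^ k"
  shows "3 ^ k * gap P a \<le> gap P (a / 2 ^ k)"
  using k
proof (induction k)
  case (Suc k)
  have h: "a / 2 ^ k = 2 * (a / 2 ^ Suc k)" by simp
  have c: "c0 \<le> a / 2 ^ k" unfolding h using Suc.prems c0(1) by linarith
  have "4 * gap P (a / 2 ^ k) - gap P (a / 2 ^ Suc k) \<le> 6 * cubic_gap P (a / 2 ^ k)"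
    using gap_double[of "a / 2 ^ Suc k"] unfolding h[symmetric] .
  then have "3 * gap P (a / 2 ^ k) \<le> gap P (a / 2 ^ Suc k)" using c0(2)[OF c] by linarith
  then show ?case using Suc.IH[OF c] by simp
qed simp

text \<open>The exponential moment is split according to the size of \<open>V\<close>. Above the scale \<open>a\<close> with
  \<open>n * gap P a = 1 / 2\<close> it is bounded. Going down from \<open>a\<close> by halving, \<open>gap P\<close> grows at least by the
  factor \<open>3\<close> per step, so the contributions of the dyadic pieces are summable. Below
  \<open>2 * c0\<close> the crude bound for small \<open>V\<close> applies. The bound depends on \<open>P\<close> only through \<open>c0\<close> and \<open>k\<close>.\<close>

lemma exp_self_normalised_bound:
  fixes l :: real
  defines "A \<equiv> (l\<^sup>2 + 1) / 2"
  assumes l: "0 \<le> l"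
    and K1: "\<And>u. \<bar>exp (l * u - A * u\<^sup>2) - 1 - l * u - (l\<^sup>2 - 2 * A) * gauss_gap u\<bar> \<le> K1 * (\<bar>u\<bar> * gauss_gap u)"
    and K2: "0 \<le> K2"
      "\<And>u. (if \<bar>u\<bar> \<le> 1 then exp (0 * u) else exp l) \<le> 1 + 0 * u + K2 * (gauss_gap u + \<bar>u\<bar> * gauss_gap u)"
      "\<And>u. (if \<bar>u\<bar> \<le> 1 then exp (l * u) else exp l) \<le> 1 + l * u + K2 * (gauss_gap u + \<bar>u\<bar> * gauss_gap u)"
    and c0: "0 < c0" "\<And>c. c0 \<le> c \<Longrightarrow> 6 * cubic_gap P c \<le> gap P c"
      "\<And>c. c0 \<le> c \<Longrightarrow> K1 * cubic_gap P c \<le> gap P c / 2"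
    and k: "0 < k" "k \<le> gap P c0" and n: "1 / 2 \<le> n * k"
  shows "(\<integral>\<omega>. exp (l * (S n \<omega> / V n \<omega>)) \<partial>M) \<le> 2 * exp K2 + 4 * exp (4 * A) + exp (2 + l\<^sup>2 / (4 * k))"
proof -
  have n0: "0 < n" using n by (cases n) auto
  have "1 / (2 * n) \<le> gap P c0"
  proof -
    have "n * k \<le> n * gap P c0" using k by (intro mult_left_mono) auto
    with n have "1 / 2 \<le> n * gap P c0" by linarith
    then have "1 \<le> gap P c0 * (2 * n)" by (simp add: algebra_simps)
    then show ?thesis using n0 by (simp add: divide_le_eq)
  qed
  then obtain a where a: "c0 \<le> a" "gap P a = 1 / (2 * n)"
    using exists_gap_scale[OF c0(1), of "1 / (2 * n)"] n0 by auto
  have na: "n * gap P a = 1 / 2" using a n0 by simp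
  have a0: "0 < a" using a c0 by simp
  let ?F = "\<lambda>\<omega>. exp (l * (S n \<omega> / V n \<omega>))"
  define b where "b c = (\<integral>\<omega>. ?F \<omega> * indicator {c..} (V n \<omega>) \<partial>M)" for c
  have ba: "b a \<le> 2 * exp K2"
    using exp_self_normalised_large_V[OF l a0 _ K2, of n] c0(2)[OF a(1)] cubic_gap_nonneg[of a] na
    by (simp add: b_def)
  \<comment> \<open>The increments \<open>8 * exp (4 * A) / 3 ^ Suc j\<close> add up to the stated closed form.\<close>
  have iter: "b (a / 2 ^ j) \<le> b a + 4 * exp (4 * A) * (1 - 1 / 3 ^ j)" if "c0 \<le> a / 2 ^ j" for j
    using that
  proof (induction j)
    case (Suc j)
    let ?c = "a / 2 ^ Suc j"
    have h: "2 * ?c = a / 2 ^ j" by simp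
    have c: "c0 \<le> a / 2 ^ j" unfolding h[symmetric] using Suc.prems c0(1) by linarith
    have "b ?c \<le> b (2 * ?c) + 2 * exp (4 * A) * exp (- (n * gap P ?c / 2))"
      unfolding b_def A_def
      by (rule exp_self_normalised_dyadic_step[OF l _ c0(3)[OF Suc.prems] K1[unfolded A_def]]) (use a0 in simp)
    also have "exp (- (n * gap P ?c / 2)) \<le> 4 / 3 ^ Suc j"
    proof -
      have "n * (3 ^ Suc j * gap P a) \<le> n * gap P ?c"
        by (intro mult_left_mono gap_grows_below_scale[OF c0(1,2) Suc.prems]) auto
      moreover have "n * (3 ^ Suc j * gap P a) = 3 ^ Suc j * (n * gap P a)" by simp
      ultimately have "3 ^ Suc j / 4 \<le> n * gap P ?c / 2" unfolding na by linarith
      moreover have "n * gap P ?c / 2 < exp (n * gap P ?c / 2)"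
        using exp_ge_add_one_self[of "n * gap P ?c / 2"] by linarith
      ultimately have "exp (- (n * gap P ?c / 2)) \<le> 1 / (3 ^ Suc j / 4)"
        by (intro exp_minus_le_inverse) auto
      then show ?thesis by simp
    qed
    finally have "b ?c \<le> b (a / 2 ^ j) + 2 * exp (4 * A) * (4 / 3 ^ Suc j)"
      unfolding h by simp
    with Suc.IH[OF c] show ?case by (simp add: algebra_simps)
  qed simp
  obtain j where j: "c0 \<le> a / 2 ^ j" "a / 2 ^ j < 2 * c0"
  proof -
    define m where "m = (LEAST m. a / c0 < 2 ^ m)"
    have 1: "a / c0 < 2 ^ m"
      unfolding m_def by (rule LeastI_ex) (rule real_arch_pow, simp)
    have "1 \<le> a / c0" using a c0 by simp
    then have "m \<noteq> 0" using 1 by (intro notI) simp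
    then obtain j where j: "m = Suc j" by (cases m) auto
    then have "\<not> a / c0 < 2 ^ j" using not_less_Least[of j "\<lambda>m. a / c0 < 2 ^ m"] by (auto simp: m_def)
    with 1 j c0 show thesis by (intro that[of j]) (auto simp: field_simps)
  qed
  have bj: "b (a / 2 ^ j) \<le> 2 * exp K2 + 4 * exp (4 * A)"
  proof -
    have "4 * exp (4 * A) * (1 - 1 / 3 ^ j) \<le> 4 * exp (4 * A) * 1" by (intro mult_left_mono) auto
    then show ?thesis using iter[OF j(1)] ba by linarith
  qed
  have intF: "integrable M ?F" by (rule exp_self_normalised_integrable)
  have intI: "integrable M (\<lambda>\<omega>. ?F \<omega> * indicator B (V n \<omega>))" if "B \<in> sets borel" for B
    using that by (rule exp_indicator_integrable)
  have "(\<integral>\<omega>. ?F \<omega> \<partial>M) \<le> (\<integral>\<omega>. ?F \<omega> * indicator {a / 2 ^ j..} (V n \<omega>) + ?F \<omega> * indicator {..<2 * c0} (V n \<omega>) \<partial>M)"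
    using j by (intro integral_mono intF integrable_linear(1) intI) (auto simp: indicator_def)
  also have "\<dots> = b (a / 2 ^ j) + (\<integral>\<omega>. ?F \<omega> * indicator {..<2 * c0} (V n \<omega>) \<partial>M)"
    unfolding b_def by (intro Bochner_Integration.integral_add intI) auto
  finally show ?thesis
    using bj exp_self_normalised_small_V[OF l c0(1) k, of n] by linarith
qed

end

section \<open>Limits at the natural scale\<close>

lemma tendsto_one_plus_power:
  fixes y :: "nat \<Rightarrow> real"
  assumes ny: "(\<lambda>n. n * y n) \<longlonglongrightarrow> x"
  shows "(\<lambda>n. (1 + y n) ^ n) \<longlonglongrightarrow> exp x"
proof -
  have "(\<lambda>n. (n * y n) * (1 / real n)) \<longlonglongrightarrow> x * 0"
    by (intro tendsto_mult ny lim_1_over_n)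
  then have y0: "y \<longlonglongrightarrow> 0"
    unfolding mult_zero_right
  proof (rule Lim_transform_eventually)
    show "\<forall>\<^sub>F n in sequentially. n * y n * (1 / real n) = y n"
      using eventually_gt_at_top[of 0] by eventually_elim simp
  qed
  have small: "\<forall>\<^sub>F n in sequentially. \<bar>y n\<bar> < 1 / 2"
    using tendstoD[OF y0, of "1 / 2"] by simp
  have "(\<lambda>n. n * (ln (1 + y n) - y n)) \<longlonglongrightarrow> 0"
  proof (rule Lim_null_comparison)
    show "\<forall>\<^sub>F n in sequentially. norm (n * (ln (1 + y n) - y n)) \<le> 2 * (\<bar>n * y n\<bar> * \<bar>y n\<bar>)"
      using small
    proof eventually_elim
      case (elim n)
      have "n * \<bar>ln (1 + y n) - y n\<bar> \<le> n * (2 * (y n)\<^sup>2)"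
        using elim by (intro mult_left_mono abs_ln_one_plus_x_minus_x_bound) auto
      then show ?case by (simp add: abs_mult power2_eq_square)
    qed
    have "(\<lambda>n. 2 * (\<bar>n * y n\<bar> * \<bar>y n\<bar>)) \<longlonglongrightarrow> 2 * (\<bar>x\<bar> * \<bar>0\<bar>)"
      by (intro tendsto_intros ny y0)
    then show "(\<lambda>n. 2 * (\<bar>n * y n\<bar> * \<bar>y n\<bar>)) \<longlonglongrightarrow> 0" by simp
  qed
  from tendsto_add[OF this ny] have "(\<lambda>n. n * ln (1 + y n)) \<longlonglongrightarrow> x"
    by (simp add: algebra_simps)
  then have "(\<lambda>n. exp (n * ln (1 + y n))) \<longlonglongrightarrow> exp x" by (rule tendsto_exp)
  then show ?thesis
    by (rule Lim_transform_eventually) (use small in \<open>auto elim!: eventually_mono simp: exp_of_nat_mult\<close>)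
qed

text \<open>A bound on second moments makes the sequence uniformly integrable. Quantitatively,
  \<open>\<bar>w\<bar> \<le> k * w\<^sup>2 + 1 / (4 * k)\<close> is applied on the unlikely set where \<open>\<bar>w\<bar>\<close> is not small, with \<open>k\<close>
  chosen small before \<open>n\<close> is chosen large. The spaces may vary with \<open>n\<close>.\<close>

lemma tendsto_L1_if_bounded_L2:
  fixes W :: "nat \<Rightarrow> 'a \<Rightarrow> real"
  assumes M: "\<And>n. prob_space (M n)" and meas: "\<And>n. W n \<in> borel_measurable (M n)"
    and L2: "\<forall>\<^sub>F n in sequentially. integrable (M n) (\<lambda>\<omega>. (W n \<omega>)\<^sup>2) \<and> (\<integral>\<omega>. (W n \<omega>)\<^sup>2 \<partial>M n) \<le> B"
    and prob: "\<And>\<eta>. 0 < \<eta> \<Longrightarrow> (\<lambda>n. measure (M n) {\<omega>\<in>space (M n). \<eta> < \<bar>W n \<omega>\<bar>}) \<longlonglongrightarrow> 0"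
  shows "(\<lambda>n. \<integral>\<omega>. \<bar>W n \<omega>\<bar> \<partial>M n) \<longlonglongrightarrow> 0"
proof (rule tendstoI)
  fix e :: real assume e: "0 < e"
  define b where "b = \<bar>B\<bar> + 1"
  have b: "0 < b" "B \<le> b" by (auto simp: b_def)
  define k where "k = e / (4 * b)"
  have k: "0 < k" using e b by (simp add: k_def)
  have kB: "k * B \<le> e / 4"
  proof -
    have "k * B \<le> k * b" using k b by (intro mult_left_mono) auto
    also have "k * b = e / 4" using b by (simp add: k_def)
    finally show ?thesis .
  qed
  have "\<forall>\<^sub>F n in sequentially. measure (M n) {\<omega>\<in>space (M n). e / 4 < \<bar>W n \<omega>\<bar>} < k * e"
    using order_tendstoD(2)[OF prob[of "e / 4"], of "k * e"] e k by simp
  with L2 show "\<forall>\<^sub>F n in sequentially. dist (\<integral>\<omega>. \<bar>W n \<omega>\<bar> \<partial>M n) 0 < e"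
  proof eventually_elim
    case (elim n)
    interpret prob_space "M n" by (rule M)
    note [measurable] = meas[of n]
    let ?B = "{\<omega>\<in>space (M n). e / 4 < \<bar>W n \<omega>\<bar>}"
    have "\<bar>w\<bar> \<le> k * w\<^sup>2 + 1 / (4 * k)" for w :: real
    proof -
      have "0 \<le> k * (\<bar>w\<bar> - 1 / (2 * k))\<^sup>2" using k by simp
      also have "\<dots> = k * w\<^sup>2 + 1 / (4 * k) - \<bar>w\<bar>"
        using k by (simp add: power2_diff field_simps power2_eq_square)
      finally show ?thesis by simp
    qed
    note young = this
    have pointwise: "\<bar>W n \<omega>\<bar> \<le> e / 4 + k * (W n \<omega>)\<^sup>2 + 1 / (4 * k) * indicator ?B \<omega>" if "\<omega> \<in> space (M n)" for \<omega>
    proof (cases "\<omega> \<in> ?B")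
      case True
      then show ?thesis using young[of "W n \<omega>"] e by simp
    next
      case False
      have "0 \<le> k * (W n \<omega>)\<^sup>2" using k by simp
      then show ?thesis using False that by simp
    qed
    have "(\<integral>\<omega>. \<bar>W n \<omega>\<bar> \<partial>M n) \<le> (\<integral>\<omega>. e / 4 + k * (W n \<omega>)\<^sup>2 + 1 / (4 * k) * indicator ?B \<omega> \<partial>M n)"
    proof (rule integral_mono_AE')
      show "integrable (M n) (\<lambda>\<omega>. e / 4 + k * (W n \<omega>)\<^sup>2 + 1 / (4 * k) * indicator ?B \<omega>)"
        using elim by (intro integrable_linear) (auto simp: emeasure_eq_measure)
      show "AE \<omega> in M n. \<bar>W n \<omega>\<bar> \<le> e / 4 + k * (W n \<omega>)\<^sup>2 + 1 / (4 * k) * indicator ?B \<omega>"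
        using pointwise by (rule AE_I2)
      show "AE \<omega> in M n. 0 \<le> e / 4 + k * (W n \<omega>)\<^sup>2 + 1 / (4 * k) * indicator ?B \<omega>"
        using e k by (intro AE_I2 add_nonneg_nonneg mult_nonneg_nonneg) auto
    qed
    also have "\<dots> = e / 4 + k * (\<integral>\<omega>. (W n \<omega>)\<^sup>2 \<partial>M n) + 1 / (4 * k) * measure (M n) ?B"
      using elim by (simp add: prob_space emeasure_eq_measure)
    also have "\<dots> < e / 4 + e / 4 + e / 4"
    proof -
      have "k * (\<integral>\<omega>. (W n \<omega>)\<^sup>2 \<partial>M n) \<le> k * B" using elim k by (intro mult_left_mono) auto
      moreover have "1 / (4 * k) * measure (M n) ?B < 1 / (4 * k) * (k * e)"
        using elim k by (intro mult_strict_left_mono) auto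
      moreover have "1 / (4 * k) * (k * e) = e / 4" using k by simp
      ultimately show ?thesis using kB by linarith
    qed
    finally have "(\<integral>\<omega>. \<bar>W n \<omega>\<bar> \<partial>M n) < e" using e by simp
    moreover have "0 \<le> (\<integral>\<omega>. \<bar>W n \<omega>\<bar> \<partial>M n)" by (intro integral_nonneg_AE AE_I2) simp
    ultimately show ?case by simp
  qed
qed

text \<open>Classes of laws along which the limit theorem below holds even when the law changes with the
  sample size. The second condition is uniform approximate normality at large scales, the third
  one excludes sequences of laws that degenerate to a point mass.\<close>

definition uniformly_gaussian :: "real measure set \<Rightarrow> bool" where
  "uniformly_gaussian Q \<longleftrightarrow>
     (\<forall>P\<in>Q. centred_law P) \<and>
     (\<forall>d>0. \<exists>c0>0. \<forall>P\<in>Q. \<forall>c\<ge>c0. cubic_gap P c \<le> d * gap P c) \<and>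
     (\<forall>c>0. \<exists>k>0. \<forall>P\<in>Q. k \<le> gap P c)"

text \<open>The scale \<open>a n\<close> is the one at which the truncated variance of the sum of \<open>n\<close> terms is \<open>(a n)\<^sup>2\<close>.
  It exists by continuity and tends to infinity because \<open>gap\<close> is bounded below at each fixed scale;
  hence \<open>cubic_gap\<close> is eventually negligible at that scale.\<close>

lemma exists_scaling:
  assumes Q: "uniformly_gaussian Q" and P: "\<And>n. P n \<in> Q"
  obtains a :: "nat \<Rightarrow> real" where
    "\<forall>\<^sub>F n in sequentially. 0 < a n \<and> n * gap (P n) (a n) = 1 / 2"
    "(\<lambda>n. n * cubic_gap (P n) (a n)) \<longlonglongrightarrow> 0"
proof -
  have centred: "centred_law (P n)" for n using Q P by (auto simp: uniformly_gaussian_def)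
  have large: "\<forall>\<^sub>F n in sequentially. 1 / (2 * real n) < gap (P n) c0" if c0: "0 < c0" for c0
  proof -
    obtain k where k: "0 < k" "\<And>n. k \<le> gap (P n) c0"
      using Q P c0 unfolding uniformly_gaussian_def by meson
    have "(\<lambda>n. 1 / 2 * (1 / real n)) \<longlonglongrightarrow> 1 / 2 * 0" by (intro tendsto_intros lim_1_over_n)
    then have "\<forall>\<^sub>F n in sequentially. 1 / 2 * (1 / real n) < k"
      using k(1) by (intro order_tendstoD(2)) auto
    then show ?thesis by eventually_elim (use k(2) order_less_le_trans in fastforce)
  qed
  have "\<exists>a. 1 / (2 * real n) < gap (P n) 1 \<longrightarrow> 0 < n \<longrightarrow> 0 < a \<and> n * gap (P n) a = 1 / 2" for n
  proof (cases "1 / (2 * real n) < gap (P n) 1 \<and> 0 < n")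
    case True
    then obtain a where "1 \<le> a" "gap (P n) a = 1 / (2 * real n)"
      using centred_law.exists_gap_scale[OF centred, of 1 "1 / (2 * real n)" n] by auto
    then show ?thesis using True by (intro exI[of _ a]) auto
  qed auto
  then obtain a where a: "\<And>n. 1 / (2 * real n) < gap (P n) 1 \<Longrightarrow> 0 < n \<Longrightarrow> 0 < a n \<and> n * gap (P n) (a n) = 1 / 2"
    by metis
  have scale: "\<forall>\<^sub>F n in sequentially. 0 < a n \<and> n * gap (P n) (a n) = 1 / 2"
    using large[of 1, OF zero_less_one] eventually_gt_at_top[of 0] by eventually_elim (rule a)
  have a_ge: "\<forall>\<^sub>F n in sequentially. c0 \<le> a n" if c0: "0 < c0" for c0
    using large[OF c0] scale eventually_gt_at_top[of 0]
  proof eventually_elim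
    case (elim n)
    show ?case
    proof (rule ccontr)
      assume "\<not> c0 \<le> a n"
      then have "gap (P n) c0 \<le> gap (P n) (a n)"
        using elim by (intro centred_law.gap_antimono[OF centred]) auto
      moreover have "gap (P n) (a n) = 1 / (2 * real n)" using elim by (simp add: field_simps)
      ultimately show False using elim by simp
    qed
  qed
  have "(\<lambda>n. n * cubic_gap (P n) (a n)) \<longlonglongrightarrow> 0"
  proof (rule tendstoI)
    fix e :: real assume e: "0 < e"
    then obtain c0 where c0: "0 < c0" "\<And>n c. c0 \<le> c \<Longrightarrow> cubic_gap (P n) c \<le> e * gap (P n) c"
      using Q P unfolding uniformly_gaussian_def by meson
    show "\<forall>\<^sub>F n in sequentially. dist (n * cubic_gap (P n) (a n)) 0 < e"
      using a_ge[OF c0(1)] scale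
    proof eventually_elim
      case (elim n)
      have "n * cubic_gap (P n) (a n) \<le> n * (e * gap (P n) (a n))"
        using c0(2)[OF elim(1)] by (intro mult_left_mono) auto
      also have "\<dots> = e * (n * gap (P n) (a n))" by simp
      also have "\<dots> < e" using elim e by simp
      finally show ?case
        using centred_law.cubic_gap_nonneg[OF centred, of n "a n"] by simp
    qed
  qed
  with scale show thesis by (rule that)
qed

locale scaled_iid_rows =
  fixes P :: "nat \<Rightarrow> real measure" and M :: "nat \<Rightarrow> 'a measure"
    and X :: "nat \<Rightarrow> nat \<Rightarrow> 'a \<Rightarrow> real" and a :: "nat \<Rightarrow> real"
  assumes row: "\<And>n. iid_sample (P n) (M n) (X n)"
    and scale: "\<forall>\<^sub>F n in sequentially. 0 < a n \<and> n * gap (P n) (a n) = 1 / 2"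
    and negligible: "(\<lambda>n. n * cubic_gap (P n) (a n)) \<longlonglongrightarrow> 0"
begin

definition s :: "nat \<Rightarrow> 'a \<Rightarrow> real" where "s n \<omega> = S_stat (X n) 0 n \<omega> / a n"
definition v :: "nat \<Rightarrow> 'a \<Rightarrow> real" where "v n \<omega> = V_stat (X n) 0 n \<omega> / a n"

lemma prob_space_row: "prob_space (M n)"
proof -
  interpret iid_sample "P n" "M n" "X n" by (rule row)
  show ?thesis by unfold_locales
qed

lemma X_row_measurable [measurable]: "X n i \<in> borel_measurable (M n)"
  by (rule iid_sample.X_measurable[OF row])

lemma s_measurable [measurable]: "s n \<in> borel_measurable (M n)"
  unfolding s_def[abs_def] by measurable

lemma v_measurable [measurable]: "v n \<in> borel_measurable (M n)"
  unfolding v_def[abs_def] by measurable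

lemma damped_integrable: "0 < A \<Longrightarrow> integrable (M n) (\<lambda>\<omega>. exp (l * s n \<omega> - A * (v n \<omega>)\<^sup>2))"
  unfolding s_def v_def by (rule iid_sample.damped_mgf(1)[OF row])

text \<open>By independence the expectation is the \<open>n\<close>-th power of
  \<open>1 + (l\<^sup>2 - 2 * A) * gap (P n) (a n) + O (cubic_gap (P n) (a n))\<close>, whose increment over \<open>1\<close> is
  \<open>(l\<^sup>2 / 2 - A) / n\<close> up to lower order. This replaces the central limit theorem.\<close>

lemma damped_limit:
  assumes A: "0 < A"
  shows "(\<lambda>n. \<integral>\<omega>. exp (l * s n \<omega> - A * (v n \<omega>)\<^sup>2) \<partial>M n) \<longlonglongrightarrow> exp (l\<^sup>2 / 2 - A)"
proof -
  obtain K where K: "0 \<le> K"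
    "\<And>u. \<bar>exp (l * u - A * u\<^sup>2) - 1 - l * u - (l\<^sup>2 - 2 * A) * gauss_gap u\<bar> \<le> K * (\<bar>u\<bar> * gauss_gap u)"
    using damped_exp_expansion[OF A] by metis
  define y where "y n = (\<integral>x. exp (l * (x / a n) - A * (x / a n)\<^sup>2) \<partial>P n) - 1" for n
  have eq: "(\<integral>\<omega>. exp (l * s n \<omega> - A * (v n \<omega>)\<^sup>2) \<partial>M n) = (1 + y n) ^ n" for n
    unfolding s_def v_def y_def iid_sample.damped_mgf(2)[OF row A] by simp
  have "(\<lambda>n. n * y n - (l\<^sup>2 - 2 * A) / 2) \<longlonglongrightarrow> 0"
  proof (rule Lim_null_comparison)
    show "\<forall>\<^sub>F n in sequentially. norm (n * y n - (l\<^sup>2 - 2 * A) / 2) \<le> K * (n * cubic_gap (P n) (a n))"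
      using scale
    proof eventually_elim
      case (elim n)
      interpret iid_sample "P n" "M n" "X n" by (rule row)
      have "(l\<^sup>2 - 2 * A) / 2 = (l\<^sup>2 - 2 * A) * (n * gap (P n) (a n))" using elim by simp
      then have "n * y n - (l\<^sup>2 - 2 * A) / 2 = n * (y n - (l\<^sup>2 - 2 * A) * gap (P n) (a n))"
        by (simp add: algebra_simps)
      also have "\<bar>\<dots>\<bar> = n * \<bar>y n - (l\<^sup>2 - 2 * A) * gap (P n) (a n)\<bar>" by (simp add: abs_mult)
      also have "\<dots> \<le> n * (K * cubic_gap (P n) (a n))"
        using damped_exp_integral(2)[OF K(2), of "a n"] by (intro mult_left_mono) (auto simp: y_def algebra_simps)
      finally show ?case by (simp add: mult.left_commute)
    qed
    show "(\<lambda>n. K * (n * cubic_gap (P n) (a n))) \<longlonglongrightarrow> 0"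
      using tendsto_mult_right_zero[OF negligible] .
  qed
  from tendsto_add[OF this tendsto_const[of "(l\<^sup>2 - 2 * A) / 2"]]
  have "(\<lambda>n. n * y n) \<longlonglongrightarrow> (l\<^sup>2 - 2 * A) / 2" by simp
  from tendsto_one_plus_power[OF this] show ?thesis unfolding eq by (simp add: diff_divide_distrib)
qed

text \<open>For \<open>l = 0\<close> the damped limits at \<open>A = 1\<close> and \<open>A = 2\<close> say that \<open>exp (- v\<^sup>2)\<close> has mean tending to
  \<open>exp (- 1)\<close> and variance tending to \<open>0\<close>.\<close>

lemma v_square_tendsto_1:
  assumes d: "0 < d"
  shows "(\<lambda>n. measure (M n) {\<omega>\<in>space (M n). d < \<bar>(v n \<omega>)\<^sup>2 - 1\<bar>}) \<longlonglongrightarrow> 0"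
proof -
  define m where "m = min (exp (- 1) - exp (- 1 - d)) (exp (- 1 + d) - exp (- 1 :: real))"
  have m: "0 < m" using d by (simp add: m_def)
  let ?W = "\<lambda>n \<omega>. (exp (- (v n \<omega>)\<^sup>2) - exp (- 1))\<^sup>2"
  have int: "integrable (M n) (\<lambda>\<omega>. exp (- (v n \<omega>)\<^sup>2))" "integrable (M n) (\<lambda>\<omega>. exp (- (2 * (v n \<omega>)\<^sup>2)))" for n
    using damped_integrable[of 1 n 0] damped_integrable[of 2 n 0] by simp_all
  have W: "?W n \<omega> = exp (- (2 * (v n \<omega>)\<^sup>2)) - 2 * exp (- 1) * exp (- (v n \<omega>)\<^sup>2) + exp (- 2)" for n \<omega>
    by (simp add: power2_diff exp_double[symmetric])
  have intW: "integrable (M n) (?W n)" for n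
  proof -
    interpret prob_space "M n" by (rule prob_space_row)
    show ?thesis unfolding W using int[of n] by (intro integrable_linear) auto
  qed
  have EW: "(\<integral>\<omega>. ?W n \<omega> \<partial>M n) = (\<integral>\<omega>. exp (- (2 * (v n \<omega>)\<^sup>2)) \<partial>M n)
      - 2 * exp (- 1) * (\<integral>\<omega>. exp (- (v n \<omega>)\<^sup>2) \<partial>M n) + exp (- 2)" for n
  proof -
    interpret prob_space "M n" by (rule prob_space_row)
    show ?thesis unfolding W using int[of n] by (simp add: prob_space)
  qed
  have "(\<lambda>n. \<integral>\<omega>. ?W n \<omega> \<partial>M n) \<longlonglongrightarrow> exp (- 2) - 2 * exp (- 1) * exp (- 1) + exp (- 2)"
    unfolding EW
    using damped_limit[of 2 0] damped_limit[of 1 0] by (intro tendsto_intros) simp_all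
  moreover have "exp (- 2) - 2 * exp (- 1) * exp (- 1) + exp (- 2) = (0 :: real)"
    unfolding mult.assoc exp_add[symmetric] by simp
  ultimately have lim: "(\<lambda>n. (\<integral>\<omega>. ?W n \<omega> \<partial>M n) / m\<^sup>2) \<longlonglongrightarrow> 0"
    by (intro tendsto_divide_zero) simp
  show ?thesis
  proof (rule tendsto_sandwich[OF _ _ tendsto_const lim])
    show "\<forall>\<^sub>F n in sequentially. measure (M n) {\<omega>\<in>space (M n). d < \<bar>(v n \<omega>)\<^sup>2 - 1\<bar>} \<le> (\<integral>\<omega>. ?W n \<omega> \<partial>M n) / m\<^sup>2"
    proof (intro always_eventually allI)
      fix n
      interpret prob_space "M n" by (rule prob_space_row)
      have "m\<^sup>2 \<le> ?W n \<omega>" if far: "d < \<bar>(v n \<omega>)\<^sup>2 - 1\<bar>" for \<omega>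
      proof -
        have mle: "m \<le> exp (- 1) - exp (- 1 - d)" "m \<le> exp (- 1 + d) - exp (- 1)"
          by (auto simp: m_def)
        consider "(v n \<omega>)\<^sup>2 > 1 + d" | "(v n \<omega>)\<^sup>2 < 1 - d"
          using far by (cases "1 \<le> (v n \<omega>)\<^sup>2") auto
        then have "m \<le> \<bar>exp (- (v n \<omega>)\<^sup>2) - exp (- 1)\<bar>"
        proof cases
          case 1
          then have "exp (- (v n \<omega>)\<^sup>2) \<le> exp (- 1 - d)" by simp
          then show ?thesis using mle by linarith
        next
          case 2
          then have "exp (- 1 + d) \<le> exp (- (v n \<omega>)\<^sup>2)" by simp
          then show ?thesis using mle by linarith
        qed
        then show ?thesis using m by (simp add: abs_le_square_iff[symmetric])
      qed
      then have "measure (M n) {\<omega>\<in>space (M n). d < \<bar>(v n \<omega>)\<^sup>2 - 1\<bar>} \<le> measure (M n) {\<omega>\<in>space (M n). m\<^sup>2 \<le> ?W n \<omega>}"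
        by (intro finite_measure_mono) auto
      also have "\<dots> \<le> (\<integral>\<omega>. ?W n \<omega> \<partial>M n) / m\<^sup>2"
        using m by (intro integral_Markov_inequality_measure[OF intW sets.top]) auto
      finally show "measure (M n) {\<omega>\<in>space (M n). d < \<bar>(v n \<omega>)\<^sup>2 - 1\<bar>} \<le> (\<integral>\<omega>. ?W n \<omega> \<partial>M n) / m\<^sup>2" .
    qed
  qed simp
qed

text \<open>Where \<open>v\<^sup>2 \<le> 2\<close> and \<open>K < \<bar>s\<bar>\<close>, one of the two damped exponentials with \<open>l = 1\<close> and \<open>l = - 1\<close>
  exceeds \<open>exp (K - 2)\<close>, while their means stay bounded.\<close>

lemma s_tight:
  assumes d: "0 < d"
  obtains K where "0 < K" "\<forall>\<^sub>F n in sequentially. measure (M n) {\<omega>\<in>space (M n). K < \<bar>s n \<omega>\<bar>} < d"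
proof -
  define K where "K = 2 + \<bar>ln (8 / d)\<bar>"
  have K: "0 < K" by (simp add: K_def)
  have expK: "exp (2 - K) \<le> d / 8"
  proof -
    have "exp (2 - K) \<le> exp (- ln (8 / d))" by (simp add: K_def)
    also have "\<dots> = d / 8" using d by (simp add: exp_minus)
    finally show ?thesis .
  qed
  have "\<forall>\<^sub>F n in sequentially. measure (M n) {\<omega>\<in>space (M n). 1 < \<bar>(v n \<omega>)\<^sup>2 - 1\<bar>} < d / 4"
    using d by (intro order_tendstoD(2)[OF v_square_tendsto_1]) auto
  moreover have "\<forall>\<^sub>F n in sequentially. (\<integral>\<omega>. exp (1 * s n \<omega> - 1 * (v n \<omega>)\<^sup>2) \<partial>M n) < 2"
    by (intro order_tendstoD(2)[OF damped_limit]) (auto intro: less_le_trans[of _ 1])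
  moreover have "\<forall>\<^sub>F n in sequentially. (\<integral>\<omega>. exp ((- 1) * s n \<omega> - 1 * (v n \<omega>)\<^sup>2) \<partial>M n) < 2"
    by (intro order_tendstoD(2)[OF damped_limit]) (auto intro: less_le_trans[of _ 1])
  ultimately have "\<forall>\<^sub>F n in sequentially. measure (M n) {\<omega>\<in>space (M n). K < \<bar>s n \<omega>\<bar>} < d"
  proof eventually_elim
    case (elim n)
    interpret prob_space "M n" by (rule prob_space_row)
    let ?B = "{\<omega>\<in>space (M n). 1 < \<bar>(v n \<omega>)\<^sup>2 - 1\<bar>}" and ?A = "{\<omega>\<in>space (M n). K < \<bar>s n \<omega>\<bar>}"
    let ?D = "\<lambda>l \<omega>. exp (l * s n \<omega> - 1 * (v n \<omega>)\<^sup>2)"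
    have intD: "integrable (M n) (?D l)" for l by (rule damped_integrable) simp
    have pointwise: "indicator ?A \<omega> \<le> indicator ?B \<omega> + exp (2 - K) * (?D 1 \<omega> + ?D (- 1) \<omega>)" for \<omega>
    proof (cases "\<omega> \<in> ?A \<and> \<omega> \<notin> ?B")
      case True
      then have h: "K < \<bar>s n \<omega>\<bar>" "(v n \<omega>)\<^sup>2 \<le> 2" by auto
      have "1 \<le> exp (2 - K) * exp (\<bar>s n \<omega>\<bar> - (v n \<omega>)\<^sup>2)"
        using h unfolding exp_add[symmetric] by simp
      also have "\<dots> \<le> exp (2 - K) * (?D 1 \<omega> + ?D (- 1) \<omega>)"
        by (intro mult_left_mono) (auto simp: abs_if add_increasing add_increasing2)
      finally show ?thesis using True by simp
    next
      case False
      then show ?thesis by (auto simp: indicator_def add_nonneg_nonneg)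
    qed
    have "measure (M n) ?A = (\<integral>\<omega>. indicator ?A \<omega> \<partial>M n)" by simp
    also have "\<dots> \<le> (\<integral>\<omega>. indicator ?B \<omega> + exp (2 - K) * (?D 1 \<omega> + ?D (- 1) \<omega>) \<partial>M n)"
      by (intro integral_mono pointwise integrable_linear intD)
         (auto simp: emeasure_eq_measure)
    also have "\<dots> = measure (M n) ?B + exp (2 - K) * ((\<integral>\<omega>. ?D 1 \<omega> \<partial>M n) + (\<integral>\<omega>. ?D (- 1) \<omega> \<partial>M n))"
      unfolding Bochner_Integration.integral_add[OF intD intD, symmetric]
      by (subst Bochner_Integration.integral_add
          [OF _ integrable_mult_right[OF integrable_linear(1)[OF intD intD]]])
        (simp_all only: integral_mult_right_zero, simp_all add: emeasure_eq_measure)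
    also have "\<dots> \<le> measure (M n) ?B + exp (2 - K) * 4"
      using elim by (intro add_left_mono mult_left_mono) auto
    also have "\<dots> < d" using elim expK d by linarith
    finally show ?case .
  qed
  with K show thesis by (rule that)
qed

end

section \<open>The limit of the expected e-variable\<close>

text \<open>The two exponentials agree at \<open>m = l\<close>, \<open>v = 1\<close>, and their difference is uniformly continuous on
  compact sets. The variable \<open>v\<^sup>2\<close> rather than \<open>v\<close> is used because its fluctuations are controlled.\<close>

lemma exp_IWR_near_damped:
  fixes l K \<eta> :: real
  assumes \<eta>: "0 < \<eta>"
  obtains d where "0 < d"
    "\<And>m s v. \<bar>m - l\<bar> \<le> d \<Longrightarrow> \<bar>s\<bar> \<le> K \<Longrightarrow> 0 \<le> v \<Longrightarrow> \<bar>v\<^sup>2 - 1\<bar> \<le> d \<Longrightarrow>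
      \<bar>exp (m * (s / v) - m\<^sup>2 / 2) - exp (l * s - v\<^sup>2 + (1 - l\<^sup>2 / 2))\<bar> \<le> \<eta>"
proof -
  define G where "G = (\<lambda>(m, s, q). exp (m * (s / sqrt q) - m\<^sup>2 / 2) - exp (l * s - q + (1 - l\<^sup>2 / 2)))"
  define C where "C = {l - 1..l + 1} \<times> {- K..K} \<times> {1 / 2..3 / 2 :: real}"
  have "continuous_on C G"
    unfolding G_def C_def case_prod_unfold
    by (intro continuous_intros) auto
  moreover have "compact C" unfolding C_def by (intro compact_Times compact_Icc)
  ultimately have "uniformly_continuous_on C G" by (rule compact_uniformly_continuous)
  then obtain r where r: "0 < r" "\<And>x y. x \<in> C \<Longrightarrow> y \<in> C \<Longrightarrow> dist y x < r \<Longrightarrow> dist (G y) (G x) < \<eta>"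
    using \<eta> unfolding uniformly_continuous_on_def by metis
  show thesis
  proof (rule that[of "min (1 / 2) (r / 3)"])
    show "0 < min (1 / 2) (r / 3)" using r by simp
    fix m s v :: real
    assume h: "\<bar>m - l\<bar> \<le> min (1 / 2) (r / 3)" "\<bar>s\<bar> \<le> K" "0 \<le> v" "\<bar>v\<^sup>2 - 1\<bar> \<le> min (1 / 2) (r / 3)"
    have "dist (m, s, v\<^sup>2) (l, s, 1) \<le> dist m l + dist (s, v\<^sup>2) (s, 1)"
      unfolding dist_Pair_Pair by (rule sqrt_add_le_add_sqrt[THEN order_trans]) auto
    also have "dist (s, v\<^sup>2) (s, 1) = \<bar>v\<^sup>2 - 1\<bar>" by (simp add: dist_Pair_Pair dist_real_def)
    finally have "dist (m, s, v\<^sup>2) (l, s, 1) < r" using h r by (auto simp: dist_real_def)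
    moreover have "(m, s, v\<^sup>2) \<in> C" "(l, s, 1) \<in> C"
    proof -
      have "\<bar>m - l\<bar> \<le> 1 / 2" "\<bar>v\<^sup>2 - 1\<bar> \<le> 1 / 2" using h by auto
      note abs_le_D1[OF this(1)] abs_le_D2[OF this(1)] abs_le_D1[OF this(2)] abs_le_D2[OF this(2)]
        abs_le_D1[OF h(2)] abs_le_D2[OF h(2)]
      then show "(m, s, v\<^sup>2) \<in> C" "(l, s, 1) \<in> C" by (auto simp: C_def)
    qed
    ultimately have "dist (G (m, s, v\<^sup>2)) (G (l, s, 1)) < \<eta>" by (intro r(2))
    moreover have "G (l, s, 1) = 0" by (simp add: G_def)
    ultimately show "\<bar>exp (m * (s / v) - m\<^sup>2 / 2) - exp (l * s - v\<^sup>2 + (1 - l\<^sup>2 / 2))\<bar> \<le> \<eta>"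
      using h(3) by (simp add: G_def dist_real_def)
  qed
qed

lemma eventually_exp_self_normalised_bounded:
  assumes Q: "uniformly_gaussian Q" and P: "\<And>n. P n \<in> Q"
    and row: "\<And>n. iid_sample (P n) (M n) (X n)" and l: "0 \<le> l"
  obtains B where "\<forall>\<^sub>F n in sequentially.
      (\<integral>\<omega>. exp (l * (S_stat (X n) 0 n \<omega> / V_stat (X n) 0 n \<omega>)) \<partial>M n) \<le> B"
proof -
  define A where "A = (l\<^sup>2 + 1) / 2"
  have A: "0 < A" by (simp add: A_def add_nonneg_pos)
  obtain K1 where K1: "0 \<le> K1"
    "\<And>u. \<bar>exp (l * u - A * u\<^sup>2) - 1 - l * u - (l\<^sup>2 - 2 * A) * gauss_gap u\<bar> \<le> K1 * (\<bar>u\<bar> * gauss_gap u)"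
    using damped_exp_expansion[OF A] by metis
  obtain L0 where L0: "0 \<le> L0"
      "\<And>u. (if \<bar>u\<bar> \<le> 1 then exp (0 * u) else exp l) \<le> 1 + 0 * u + L0 * (gauss_gap u + \<bar>u\<bar> * gauss_gap u)"
    using truncated_exp_bound[of 0 l] by (metis order_refl)
  obtain L1 where L1: "0 \<le> L1"
      "\<And>u. (if \<bar>u\<bar> \<le> 1 then exp (l * u) else exp l) \<le> 1 + l * u + L1 * (gauss_gap u + \<bar>u\<bar> * gauss_gap u)"
    using truncated_exp_bound[OF l, of l] by metis
  define K2 where "K2 = L0 + L1"
  have mono: "L0 * (gauss_gap u + \<bar>u\<bar> * gauss_gap u) \<le> K2 * (gauss_gap u + \<bar>u\<bar> * gauss_gap u)"
    "L1 * (gauss_gap u + \<bar>u\<bar> * gauss_gap u) \<le> K2 * (gauss_gap u + \<bar>u\<bar> * gauss_gap u)" for u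
    using L0 L1 by (auto simp: K2_def intro!: mult_right_mono add_nonneg_nonneg)
  have K2: "0 \<le> K2"
      "\<And>u. (if \<bar>u\<bar> \<le> 1 then exp (0 * u) else exp l) \<le> 1 + 0 * u + K2 * (gauss_gap u + \<bar>u\<bar> * gauss_gap u)"
      "\<And>u. (if \<bar>u\<bar> \<le> 1 then exp (l * u) else exp l) \<le> 1 + l * u + K2 * (gauss_gap u + \<bar>u\<bar> * gauss_gap u)"
    subgoal using L0 L1 by (simp add: K2_def)
    subgoal for u using L0(2)[of u] mono(1)[of u] by linarith
    subgoal for u using L1(2)[of u] mono(2)[of u] by linarith
    done
  define d where "d = 1 / (6 + 2 * K1)"
  have d: "0 < d" "6 * d \<le> 1" "K1 * d \<le> 1 / 2" using K1 by (auto simp: d_def field_simps)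
  obtain c0 where c0: "0 < c0" "\<And>P c. P \<in> Q \<Longrightarrow> c0 \<le> c \<Longrightarrow> cubic_gap P c \<le> d * gap P c"
    using Q d(1) unfolding uniformly_gaussian_def by meson
  obtain k where k: "0 < k" "\<And>P. P \<in> Q \<Longrightarrow> k \<le> gap P c0"
    using Q c0(1) unfolding uniformly_gaussian_def by meson
  have "\<forall>\<^sub>F n in sequentially. 1 / (2 * k) \<le> real n"
    using filterlim_real_sequentially by (simp add: filterlim_at_top)
  then have "\<forall>\<^sub>F n in sequentially.
      (\<integral>\<omega>. exp (l * (S_stat (X n) 0 n \<omega> / V_stat (X n) 0 n \<omega>)) \<partial>M n)
        \<le> 2 * exp K2 + 4 * exp (4 * A) + exp (2 + l\<^sup>2 / (4 * k))"
  proof eventually_elim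
    case (elim n)
    interpret iid_sample "P n" "M n" "X n" by (rule row)
    have "6 * cubic_gap (P n) c \<le> gap (P n) c" "K1 * cubic_gap (P n) c \<le> gap (P n) c / 2"
      if "c0 \<le> c" for c
    proof -
      have bound: "cubic_gap (P n) c \<le> d * gap (P n) c" using c0(2)[OF P that] .
      have g: "0 \<le> gap (P n) c" by (rule gap_nonneg)
      have "6 * cubic_gap (P n) c \<le> 6 * d * gap (P n) c" using bound by simp
      also have "\<dots> \<le> gap (P n) c" using mult_right_mono[OF d(2) g] by simp
      finally show "6 * cubic_gap (P n) c \<le> gap (P n) c" .
      have "K1 * cubic_gap (P n) c \<le> K1 * d * gap (P n) c" using mult_left_mono[OF bound K1(1)] by simp
      also have "\<dots> \<le> gap (P n) c / 2" using mult_right_mono[OF d(3) g] by simp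
      finally show "K1 * cubic_gap (P n) c \<le> gap (P n) c / 2" .
    qed
    moreover have "1 / 2 \<le> n * k" using elim k(1) by (simp add: field_simps)
    ultimately show ?case
      unfolding A_def
      by (intro exp_self_normalised_bound[OF l K1(2)[unfolded A_def] K2 c0(1) _ _ k(1) k(2)[OF P]])
  qed
  then show thesis by (rule that)
qed

text \<open>With \<open>s = S / a\<close> and \<open>v = V / a\<close>, the damped exponential \<open>Z = exp (l * s - v\<^sup>2 + 1 - l\<^sup>2 / 2)\<close> has mean
  tending to \<open>1\<close>. Since \<open>v\<close> tends to \<open>1\<close> in probability and \<open>s\<close> is tight, \<open>Z\<close> is close in probability to
  the e-variable \<open>Y\<close>. Both are bounded in \<open>L\<^sup>2\<close>: \<open>Z\<close> by its explicit limit, and \<open>Y\<close> because nonnegative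
  weights at most \<open>C\<close> give \<open>Y\<^sup>2 \<le> 1 + exp (2 * \<bar>C\<bar> * S / V)\<close>. Hence their means have the same limit.\<close>

theorem IWR_expectation_tendsto_1:
  fixes M :: "nat \<Rightarrow> 'a measure" and L :: "nat \<Rightarrow> 'a \<Rightarrow> real"
  assumes Q: "uniformly_gaussian Q" and P: "\<And>n. P n \<in> Q"
    and iid: "\<And>n. iid_with_law (M n) (X n) (P n)"
    and L_meas: "\<And>n. L n \<in> borel_measurable (M n)"
    and L_bounded: "\<And>n. AE \<omega> in M n. 0 \<le> L n \<omega> \<and> L n \<omega> \<le> C"
    and L_lim: "\<And>d. 0 < d \<Longrightarrow> (\<lambda>n. measure (M n) {\<omega>\<in>space (M n). d < \<bar>L n \<omega> - l\<bar>}) \<longlonglongrightarrow> 0"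
  shows "(\<lambda>n. \<integral>\<omega>. E_IWR (X n) n 0 (L n \<omega>) \<omega> \<partial>M n) \<longlonglongrightarrow> 1"
    and "integrable (M n) (\<lambda>\<omega>. E_IWR (X n) n 0 (L n \<omega>) \<omega>)"
proof -
  have centred: "centred_law (P n)" for n using Q P by (auto simp: uniformly_gaussian_def)
  have row: "iid_sample (P n) (M n) (X n)" for n
    using centred[of n] iid[of n] by (simp add: iid_sample_def iid_sample_axioms_def)
  obtain a where a: "\<forall>\<^sub>F n in sequentially. 0 < a n \<and> n * gap (P n) (a n) = 1 / 2"
    "(\<lambda>n. n * cubic_gap (P n) (a n)) \<longlonglongrightarrow> 0"
    by (rule exists_scaling[where P=P, OF Q P])
  interpret rows: scaled_iid_rows P M X a by (rule scaled_iid_rows.intro[OF row a])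
  note [measurable] = L_meas
  define T where "T n \<omega> = S_stat (X n) 0 n \<omega> / V_stat (X n) 0 n \<omega>" for n \<omega>
  define Y where "Y n \<omega> = E_IWR (X n) n 0 (L n \<omega>) \<omega>" for n \<omega>
  define Z where "Z n \<omega> = exp (l * rows.s n \<omega> - (rows.v n \<omega>)\<^sup>2 + (1 - l\<^sup>2 / 2))" for n \<omega>
  have T_meas [measurable]: "T n \<in> borel_measurable (M n)" for n
    unfolding T_def[abs_def] by measurable
  have Y_eq: "Y n \<omega> = exp (L n \<omega> * T n \<omega> - (L n \<omega>)\<^sup>2 / 2)" for n \<omega>
    by (simp add: Y_def E_IWR_def T_def)
  have [measurable]: "Y n \<in> borel_measurable (M n)" for n
    unfolding Y_eq[abs_def] by measurable
  have [measurable]: "Z n \<in> borel_measurable (M n)" for n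
    unfolding Z_def[abs_def] by measurable
  have T_exp: "integrable (M n) (\<lambda>\<omega>. exp (x * T n \<omega>))" for n x
    unfolding T_def by (rule iid_sample.exp_self_normalised_integrable[OF row])
  have prob_M: "prob_space (M n)" for n by (rule rows.prob_space_row)
  have exp_le: "exp (m * t - b) \<le> 1 + exp (\<bar>c\<bar> * t)" if "0 \<le> m" "m \<le> c" "0 \<le> b" for m c t b :: real
  proof (cases "0 \<le> t")
    case True
    have "m * t \<le> \<bar>c\<bar> * t" using that True by (intro mult_right_mono) auto
    then have "exp (m * t - b) \<le> exp (\<bar>c\<bar> * t)" using that by simp
    then show ?thesis by linarith
  next
    case False
    then have "m * t \<le> 0" using that by (simp add: mult_nonneg_nonpos)
    then have "exp (m * t - b) \<le> 1" using that by simp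
    then show ?thesis by (simp add: add_increasing2)
  qed
  have int1: "integrable (M n) (\<lambda>\<omega>. 1 + exp (x * T n \<omega>))" for n x
  proof -
    interpret prob_space "M n" by (rule prob_M)
    show ?thesis using T_exp by (intro integrable_linear(1)) auto
  qed
  have Y_int: "integrable (M n) (Y n)" for n
  proof (rule Bochner_Integration.integrable_bound[OF int1[of n "\<bar>C\<bar>"]])
    show "AE \<omega> in M n. norm (Y n \<omega>) \<le> norm (1 + exp (\<bar>C\<bar> * T n \<omega>))"
      using L_bounded[of n]
    proof eventually_elim
      case (elim \<omega>)
      then have "Y n \<omega> \<le> 1 + exp (\<bar>C\<bar> * T n \<omega>)" unfolding Y_eq by (intro exp_le) auto
      moreover have "0 \<le> Y n \<omega>" by (simp add: Y_eq)
      ultimately show ?case by simp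
    qed
  qed simp
  then show "integrable (M n) (\<lambda>\<omega>. E_IWR (X n) n 0 (L n \<omega>) \<omega>)" by (simp add: Y_def[abs_def])
  have Y2: "AE \<omega> in M n. (Y n \<omega>)\<^sup>2 \<le> 1 + exp (2 * \<bar>C\<bar> * T n \<omega>)" for n
    using L_bounded[of n]
  proof eventually_elim
    case (elim \<omega>)
    have "(Y n \<omega>)\<^sup>2 = exp (2 * L n \<omega> * T n \<omega> - (L n \<omega>)\<^sup>2)"
      unfolding Y_eq exp_double[symmetric] by (simp add: algebra_simps)
    also have "\<dots> \<le> 1 + exp (\<bar>2 * C\<bar> * T n \<omega>)" using elim by (intro exp_le) auto
    finally show ?case by (simp add: abs_mult)
  qed
  have Y2_int: "integrable (M n) (\<lambda>\<omega>. (Y n \<omega>)\<^sup>2)" for n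
    by (rule Bochner_Integration.integrable_bound[OF int1[of n "2 * \<bar>C\<bar>"]]) (use Y2[of n] in auto)
  have Z_eq: "Z n \<omega> = exp (1 - l\<^sup>2 / 2) * exp (l * rows.s n \<omega> - 1 * (rows.v n \<omega>)\<^sup>2)" for n \<omega>
    unfolding Z_def exp_add by simp
  have Z_int: "integrable (M n) (Z n)" for n
    unfolding Z_eq[abs_def] by (intro integrable_mult_right rows.damped_integrable) simp
  have Z_lim: "(\<lambda>n. \<integral>\<omega>. Z n \<omega> \<partial>M n) \<longlonglongrightarrow> 1"
  proof -
    have "(\<lambda>n. exp (1 - l\<^sup>2 / 2) * (\<integral>\<omega>. exp (l * rows.s n \<omega> - 1 * (rows.v n \<omega>)\<^sup>2) \<partial>M n))
        \<longlonglongrightarrow> exp (1 - l\<^sup>2 / 2) * exp (l\<^sup>2 / 2 - 1)"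
      by (intro tendsto_intros rows.damped_limit) simp
    moreover have "exp (1 - l\<^sup>2 / 2) * exp (l\<^sup>2 / 2 - 1) = 1" by (simp add: exp_add[symmetric])
    ultimately show ?thesis unfolding Z_eq by simp
  qed
  have Z2_eq: "(Z n \<omega>)\<^sup>2 = exp (2 - l\<^sup>2) * exp (2 * l * rows.s n \<omega> - 2 * (rows.v n \<omega>)\<^sup>2)" for n \<omega>
    unfolding Z_def exp_double[symmetric] exp_add[symmetric] by (simp add: algebra_simps)
  have Z2_int: "integrable (M n) (\<lambda>\<omega>. (Z n \<omega>)\<^sup>2)" for n
    unfolding Z2_eq by (intro integrable_mult_right rows.damped_integrable) simp
  have Z2_lim: "(\<lambda>n. \<integral>\<omega>. (Z n \<omega>)\<^sup>2 \<partial>M n) \<longlonglongrightarrow> exp (2 - l\<^sup>2) * exp ((2 * l)\<^sup>2 / 2 - 2)"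
  proof -
    have "(\<lambda>n. exp (2 - l\<^sup>2) * (\<integral>\<omega>. exp (2 * l * rows.s n \<omega> - 2 * (rows.v n \<omega>)\<^sup>2) \<partial>M n))
        \<longlonglongrightarrow> exp (2 - l\<^sup>2) * exp ((2 * l)\<^sup>2 / 2 - 2)"
      by (intro tendsto_intros rows.damped_limit) simp
    then show ?thesis unfolding Z2_eq by simp
  qed
  define Bz where "Bz = exp (2 - l\<^sup>2) * exp ((2 * l)\<^sup>2 / 2 - 2) + 1"
  have Z2_bounded: "\<forall>\<^sub>F n in sequentially. (\<integral>\<omega>. (Z n \<omega>)\<^sup>2 \<partial>M n) < Bz"
    using Z2_lim by (rule order_tendstoD(2)) (simp add: Bz_def)
  obtain By where By: "\<forall>\<^sub>F n in sequentially. (\<integral>\<omega>. exp (2 * \<bar>C\<bar> * T n \<omega>) \<partial>M n) \<le> By"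
    using eventually_exp_self_normalised_bounded[where P=P and M=M and X=X and l="2 * \<bar>C\<bar>", OF Q P row]
    unfolding T_def by auto
  define W where "W n \<omega> = Y n \<omega> - Z n \<omega>" for n \<omega>
  have W_lim: "(\<lambda>n. \<integral>\<omega>. \<bar>W n \<omega>\<bar> \<partial>M n) \<longlonglongrightarrow> 0"
  proof (rule tendsto_L1_if_bounded_L2)
    show "W n \<in> borel_measurable (M n)" for n unfolding W_def[abs_def] by measurable
    show "\<forall>\<^sub>F n in sequentially. integrable (M n) (\<lambda>\<omega>. (W n \<omega>)\<^sup>2)
        \<and> (\<integral>\<omega>. (W n \<omega>)\<^sup>2 \<partial>M n) \<le> 2 * (1 + By) + 2 * Bz"
      using By Z2_bounded
    proof eventually_elim
      case (elim n)
      interpret prob_space "M n" by (rule prob_M)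
      have W2: "(W n \<omega>)\<^sup>2 \<le> 2 * (Y n \<omega>)\<^sup>2 + 2 * (Z n \<omega>)\<^sup>2" for \<omega>
        using zero_le_power2[of "Y n \<omega> + Z n \<omega>"] by (simp add: W_def power2_sum power2_diff)
      have int: "integrable (M n) (\<lambda>\<omega>. 2 * (Y n \<omega>)\<^sup>2 + 2 * (Z n \<omega>)\<^sup>2)"
        by (intro integrable_linear Y2_int Z2_int)
      have W2_int: "integrable (M n) (\<lambda>\<omega>. (W n \<omega>)\<^sup>2)"
        using int by (rule Bochner_Integration.integrable_bound)
          (use W2 in \<open>auto simp: W_def[abs_def] intro!: AE_I2 order_trans[OF _ abs_ge_self]\<close>)
      have "(\<integral>\<omega>. (Y n \<omega>)\<^sup>2 \<partial>M n) \<le> (\<integral>\<omega>. 1 + exp (2 * \<bar>C\<bar> * T n \<omega>) \<partial>M n)"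
        by (intro integral_mono_AE Y2_int int1 Y2)
      also have "\<dots> = 1 + (\<integral>\<omega>. exp (2 * \<bar>C\<bar> * T n \<omega>) \<partial>M n)"
        using T_exp by (simp add: prob_space)
      finally have "(\<integral>\<omega>. (Y n \<omega>)\<^sup>2 \<partial>M n) \<le> 1 + By" using elim by simp
      moreover have "(\<integral>\<omega>. (W n \<omega>)\<^sup>2 \<partial>M n) \<le> (\<integral>\<omega>. 2 * (Y n \<omega>)\<^sup>2 + 2 * (Z n \<omega>)\<^sup>2 \<partial>M n)"
        by (intro integral_mono W2_int int W2)
      ultimately show ?case using elim W2_int Y2_int Z2_int by simp
    qed
    show "(\<lambda>n. measure (M n) {\<omega>\<in>space (M n). \<eta> < \<bar>W n \<omega>\<bar>}) \<longlonglongrightarrow> 0" if \<eta>: "0 < \<eta>" for \<eta>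
    proof (rule tendstoI)
      fix e :: real assume e: "0 < e"
      obtain K where K: "0 < K" "\<forall>\<^sub>F n in sequentially. measure (M n) {\<omega>\<in>space (M n). K < \<bar>rows.s n \<omega>\<bar>} < e / 3"
        using rows.s_tight[of "e / 3"] e by auto
      obtain d where d: "0 < d" "\<And>m s v. \<bar>m - l\<bar> \<le> d \<Longrightarrow> \<bar>s\<bar> \<le> K \<Longrightarrow> 0 \<le> v \<Longrightarrow> \<bar>v\<^sup>2 - 1\<bar> \<le> d \<Longrightarrow>
          \<bar>exp (m * (s / v) - m\<^sup>2 / 2) - exp (l * s - v\<^sup>2 + (1 - l\<^sup>2 / 2))\<bar> \<le> \<eta>"
        using exp_IWR_near_damped[OF \<eta>, of l K] by metis
      have e1: "\<forall>\<^sub>F n in sequentially. measure (M n) {\<omega>\<in>space (M n). d < \<bar>L n \<omega> - l\<bar>} < e / 3"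
        using e by (intro order_tendstoD(2)[OF L_lim[OF d(1)]]) simp
      have e2: "\<forall>\<^sub>F n in sequentially. measure (M n) {\<omega>\<in>space (M n). d < \<bar>(rows.v n \<omega>)\<^sup>2 - 1\<bar>} < e / 3"
        using e by (intro order_tendstoD(2)[OF rows.v_square_tendsto_1[OF d(1)]]) simp
      show "\<forall>\<^sub>F n in sequentially. dist (measure (M n) {\<omega>\<in>space (M n). \<eta> < \<bar>W n \<omega>\<bar>}) 0 < e"
        using e1 e2 K(2) rows.scale
      proof eventually_elim
        case (elim n)
        interpret prob_space "M n" by (rule prob_M)
        let ?A = "{\<omega>\<in>space (M n). d < \<bar>L n \<omega> - l\<bar>}"
        let ?B = "{\<omega>\<in>space (M n). d < \<bar>(rows.v n \<omega>)\<^sup>2 - 1\<bar>}"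
        let ?C = "{\<omega>\<in>space (M n). K < \<bar>rows.s n \<omega>\<bar>}"
        have T_sv: "T n \<omega> = rows.s n \<omega> / rows.v n \<omega>" for \<omega>
          using elim by (simp add: T_def rows.s_def rows.v_def)
        have v0: "0 \<le> rows.v n \<omega>" for \<omega>
          using elim V_stat_nonneg[of "X n" 0 n \<omega>] by (simp add: rows.v_def)
        have "\<bar>W n \<omega>\<bar> \<le> \<eta>" if "\<omega> \<in> space (M n)" "\<omega> \<notin> ?A" "\<omega> \<notin> ?B" "\<omega> \<notin> ?C" for \<omega>
          using d(2)[of "L n \<omega>" "rows.s n \<omega>" "rows.v n \<omega>"] that v0[of \<omega>]
          by (simp add: W_def Y_eq Z_def T_sv not_less)
        then have "measure (M n) {\<omega>\<in>space (M n). \<eta> < \<bar>W n \<omega>\<bar>} \<le> measure (M n) ((?A \<union> ?B) \<union> ?C)"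
          by (intro finite_measure_mono) (auto simp: not_less[symmetric])
        also have "\<dots> \<le> measure (M n) (?A \<union> ?B) + measure (M n) ?C"
          by (intro measure_Un_le) auto
        also have "measure (M n) (?A \<union> ?B) \<le> measure (M n) ?A + measure (M n) ?B"
          by (intro measure_Un_le) auto
        finally show ?case using elim by simp
      qed
    qed
  qed (rule prob_M)
  have W_int: "integrable (M n) (W n)" for n
    unfolding W_def[abs_def] by (intro integrable_linear(2) Y_int Z_int)
  have "(\<lambda>n. \<integral>\<omega>. W n \<omega> \<partial>M n) \<longlonglongrightarrow> 0"
    using W_lim by (rule Lim_null_comparison[rotated]) (auto intro!: always_eventually integral_abs_bound)
  from tendsto_add[OF this Z_lim] have "(\<lambda>n. \<integral>\<omega>. Y n \<omega> \<partial>M n) \<longlonglongrightarrow> 1"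
    unfolding Bochner_Integration.integral_add[OF W_int Z_int, symmetric] by (simp add: W_def)
  then show "(\<lambda>n. \<integral>\<omega>. E_IWR (X n) n 0 (L n \<omega>) \<omega> \<partial>M n) \<longlonglongrightarrow> 1" by (simp add: Y_def)
qed

section \<open>Characteristic functions of centred laws\<close>

text \<open>This is one minus the real part of the characteristic function.\<close>

definition cosgap :: "real measure \<Rightarrow> real \<Rightarrow> real" where
  "cosgap P t = (\<integral>x. 1 - cos (t * x) \<partial>P)"

lemma abs_sin_minus_self_le: "\<bar>sin y - y\<bar> \<le> y\<^sup>2 / 2" for y :: real
proof -
  have "\<bar>Im (iexp y - (\<Sum>k\<le>1. (\<i> * y) ^ k / fact k))\<bar> \<le> cmod (iexp y - (\<Sum>k\<le>1. (\<i> * y) ^ k / fact k))"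
    by (rule abs_Im_le_cmod)
  also have "\<dots> \<le> \<bar>y\<bar> ^ Suc 1 / fact (Suc 1)" by (rule iexp_approx1)
  finally show ?thesis by (simp add: Im_exp numeral_2_eq_2)
qed

lemma one_minus_cos_lower:
  fixes y :: real
  assumes "\<bar>y\<bar> \<le> 1"
  shows "y\<^sup>2 / 4 \<le> 1 - cos y"
proof -
  define z where "z = y / 2"
  have z: "\<bar>z\<bar> \<le> 1 / 2" using assms by (simp add: z_def)
  have "z\<^sup>2 \<le> \<bar>z\<bar> / 2" using mult_left_mono[OF z, of "\<bar>z\<bar>"] by (simp add: power2_eq_square)
  then have "3 / 4 * \<bar>z\<bar> \<le> \<bar>sin z\<bar>" using abs_sin_minus_self_le[of z] by linarith
  then have "(3 / 4 * \<bar>z\<bar>)\<^sup>2 \<le> (sin z)\<^sup>2" by (subst power2_abs[of "sin z", symmetric]) (intro power_mono, auto)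
  then have "9 / 16 * z\<^sup>2 \<le> (sin z)\<^sup>2" by (simp add: power_mult_distrib power_divide)
  moreover have "1 - cos y = 2 * (sin z)\<^sup>2" using cos_double_sin[of z] by (simp add: z_def)
  moreover have "y\<^sup>2 = 4 * z\<^sup>2" by (simp add: z_def power_divide)
  ultimately show ?thesis using zero_le_power2[of z] by linarith
qed

lemma abs_sin_multiple_le: "\<bar>sin (real k * x)\<bar> \<le> k * \<bar>sin x\<bar>"
proof (induction k)
  case (Suc k)
  have "\<bar>sin (real (Suc k) * x)\<bar> = \<bar>sin (k * x) * cos x + cos (k * x) * sin x\<bar>"
    by (simp add: algebra_simps sin_add)
  also have "\<dots> \<le> \<bar>sin (k * x)\<bar> * \<bar>cos x\<bar> + \<bar>cos (k * x)\<bar> * \<bar>sin x\<bar>"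
    unfolding abs_mult[symmetric] by (rule abs_triangle_ineq)
  also have "\<dots> \<le> \<bar>sin (k * x)\<bar> * 1 + 1 * \<bar>sin x\<bar>"
    by (intro add_mono mult_mono) auto
  finally show ?case using Suc.IH by (simp add: algebra_simps)
qed simp

lemma one_minus_cos_multiple_le: "1 - cos (real k * x) \<le> (real k)\<^sup>2 * (1 - cos x)"
proof -
  have *: "1 - cos y = 2 * \<bar>sin (y / 2)\<bar>\<^sup>2" for y :: real using cos_double_sin[of "y / 2"] by simp
  have "\<bar>sin (k * (x / 2))\<bar>\<^sup>2 \<le> (k * \<bar>sin (x / 2)\<bar>)\<^sup>2"
    by (intro power_mono abs_sin_multiple_le) auto
  then show ?thesis unfolding * by (simp add: power_mult_distrib)
qed

context centred_law
begin

lemma integrable_cos_sin: "integrable P (\<lambda>x. cos (t * x))" "integrable P (\<lambda>x. sin (t * x))"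
  "integrable P (\<lambda>x. 1 - cos (t * x))"
  by (auto intro!: integrable_const_bound[where B=1] integrable_linear(2))

lemma cosgap_nonneg: "0 \<le> cosgap P t"
  unfolding cosgap_def by (intro integral_nonneg_AE AE_I2) simp

lemma char_components: "Re (char P t) = 1 - cosgap P t" "Im (char P t) = (\<integral>x. sin (t * x) \<partial>P)"
proof -
  have int: "integrable P (\<lambda>x. iexp (t * x))" by (rule integrable_iexp) auto
  have "Re (char P t) = (\<integral>x. cos (t * x) \<partial>P)"
    unfolding char_def integral_Re[OF int, symmetric] by (simp add: Re_exp)
  then show "Re (char P t) = 1 - cosgap P t"
    by (simp add: cosgap_def integrable_cos_sin prob_space[simplified])
  show "Im (char P t) = (\<integral>x. sin (t * x) \<partial>P)"
    unfolding char_def integral_Im[OF int, symmetric] by (simp add: Im_exp)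
qed

lemma cmod_char_square:
  "(cmod (char P t))\<^sup>2 = (1 - cosgap P t)\<^sup>2 + (\<integral>x. sin (t * x) \<partial>P)\<^sup>2"
  by (simp add: cmod_power2 char_components)

text \<open>The imaginary part of the characteristic function is \<open>o (t)\<close>: its derivative at \<open>0\<close> is the mean,
  which vanishes.\<close>

lemma sin_integral_small:
  assumes e: "0 < e"
  obtains d where "0 < d" "\<And>t. \<bar>t\<bar> \<le> d \<Longrightarrow> \<bar>\<integral>x. sin (t * x) \<partial>P\<bar> \<le> e * \<bar>t\<bar>"
proof -
  have "((\<lambda>t. (\<integral>x. sin (t * x) \<partial>P) / t) \<longlongrightarrow> 0) (at 0)"
    unfolding tendsto_at_iff_sequentially comp_def
  proof (intro allI impI)
    fix \<tau> :: "nat \<Rightarrow> real" assume \<tau>0: "\<forall>i. \<tau> i \<in> UNIV - {0}" and \<tau>: "\<tau> \<longlonglongrightarrow> 0"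
    have "(\<lambda>n. \<integral>x. (sin (\<tau> n * x) - \<tau> n * x) / \<tau> n \<partial>P) \<longlonglongrightarrow> (\<integral>x. 0 \<partial>P)"
    proof (rule integral_dominated_convergence[where w="\<lambda>x. 2 * \<bar>x\<bar>"])
      show "integrable P (\<lambda>x. 2 * \<bar>x\<bar>)" using integrable_id by simp
      show "AE x in P. (\<lambda>n. (sin (\<tau> n * x) - \<tau> n * x) / \<tau> n) \<longlonglongrightarrow> 0"
      proof (intro AE_I2, rule Lim_null_comparison)
        fix x
        show "\<forall>\<^sub>F n in sequentially. norm ((sin (\<tau> n * x) - \<tau> n * x) / \<tau> n) \<le> \<bar>\<tau> n\<bar> * (x\<^sup>2 / 2)"
        proof (intro always_eventually allI)
          fix n
          have "\<bar>sin (\<tau> n * x) - \<tau> n * x\<bar> \<le> \<bar>\<tau> n\<bar> * \<bar>\<tau> n\<bar> * (x\<^sup>2 / 2)"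
            using abs_sin_minus_self_le[of "\<tau> n * x"] by (simp add: power2_eq_square mult_ac)
          then show "norm ((sin (\<tau> n * x) - \<tau> n * x) / \<tau> n) \<le> \<bar>\<tau> n\<bar> * (x\<^sup>2 / 2)"
            using \<tau>0 by (simp add: abs_divide divide_le_eq mult_ac)
        qed
        have "(\<lambda>n. \<bar>\<tau> n\<bar> * (x\<^sup>2 / 2)) \<longlonglongrightarrow> \<bar>0\<bar> * (x\<^sup>2 / 2)" by (intro tendsto_intros \<tau>)
        then show "(\<lambda>n. \<bar>\<tau> n\<bar> * (x\<^sup>2 / 2)) \<longlonglongrightarrow> 0" by simp
      qed
      show "AE x in P. norm ((sin (\<tau> n * x) - \<tau> n * x) / \<tau> n) \<le> 2 * \<bar>x\<bar>" for n
      proof (intro AE_I2)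
        fix x
        have "\<bar>sin (\<tau> n * x) - \<tau> n * x\<bar> \<le> \<bar>\<tau> n * x\<bar> + \<bar>\<tau> n * x\<bar>"
          using abs_sin_x_le_abs_x[of "\<tau> n * x"] by linarith
        then show "norm ((sin (\<tau> n * x) - \<tau> n * x) / \<tau> n) \<le> 2 * \<bar>x\<bar>"
          using \<tau>0 by (simp add: abs_divide divide_le_eq abs_mult mult_ac)
      qed
    qed auto
    note lim = this
    have eq: "(\<integral>x. (sin (\<tau> n * x) - \<tau> n * x) / \<tau> n \<partial>P) = (\<integral>x. sin (\<tau> n * x) \<partial>P) / \<tau> n" for n
      using integrable_cos_sin(2)[of "\<tau> n"] integrable_scaled(1,3)[of "\<tau> n"] by simp
    show "(\<lambda>n. (\<integral>x. sin (\<tau> n * x) \<partial>P) / \<tau> n) \<longlonglongrightarrow> 0"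
      using lim unfolding eq by simp
  qed
  from tendstoD[OF this e] obtain d where d: "0 < d"
    "\<And>t. t \<noteq> 0 \<Longrightarrow> dist t 0 < d \<Longrightarrow> dist ((\<integral>x. sin (t * x) \<partial>P) / t) 0 < e"
    unfolding eventually_at by auto
  show thesis
  proof (rule that[of "d / 2"])
    show "\<bar>\<integral>x. sin (t * x) \<partial>P\<bar> \<le> e * \<bar>t\<bar>" if "\<bar>t\<bar> \<le> d / 2" for t
    proof (cases "t = 0")
      case False
      then have "\<bar>(\<integral>x. sin (t * x) \<partial>P) / t\<bar> < e" using d(2)[of t] d(1) that by simp
      then show ?thesis using False by (simp add: abs_divide divide_less_eq)
    qed simp
  qed (use d in simp)
qed

lemma cosgap_small:
  assumes e: "0 < e"
  obtains d where "0 < d" "\<And>t. \<bar>t\<bar> \<le> d \<Longrightarrow> cosgap P t \<le> e"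
proof -
  have "((\<lambda>t. Re (char P t)) \<longlongrightarrow> 1) (at 0)"
    using tendsto_Re[OF isCont_char[of 0, unfolded isCont_def]] by (simp add: char_zero)
  from tendstoD[OF this e] obtain d where d: "0 < d"
    "\<And>t. t \<noteq> 0 \<Longrightarrow> dist t 0 < d \<Longrightarrow> dist (Re (char P t)) 1 < e"
    unfolding eventually_at by auto
  show thesis
  proof (rule that[of "d / 2"])
    show "cosgap P t \<le> e" if "\<bar>t\<bar> \<le> d / 2" for t
    proof (cases "t = 0")
      case False
      then show ?thesis using d(2)[of t] d(1) that by (simp add: char_components dist_real_def)
    qed (use e in \<open>simp add: cosgap_def\<close>)
  qed (use d in simp)
qed

lemma cosgap_multiple_le: "cosgap P (real k * t) \<le> (real k)\<^sup>2 * cosgap P t"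
proof -
  have "cosgap P (real k * t) \<le> (\<integral>x. (real k)\<^sup>2 * (1 - cos (t * x)) \<partial>P)"
    unfolding cosgap_def
    using one_minus_cos_multiple_le[of k] by (intro integral_mono integrable_mult_right integrable_cos_sin) (simp add: mult.assoc)
  then show ?thesis by (simp add: cosgap_def)
qed

lemma gauss_gap_eq_gaussian_average: "gauss_gap u = (\<integral>g. 1 - cos (g * u) \<partial>std_normal_distribution)"
proof -
  interpret N: real_distribution std_normal_distribution by (rule real_dist_normal_dist)
  have int: "integrable std_normal_distribution (\<lambda>g. iexp (u * g))" by (rule N.integrable_iexp) auto
  have "(\<integral>g. cos (u * g) \<partial>std_normal_distribution) = Re (char std_normal_distribution u)"
    unfolding char_def integral_Re[OF int, symmetric] by (simp add: Re_exp)
  also have "\<dots> = exp (- (u\<^sup>2 / 2))"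
    by (simp add: char_std_normal_distribution Re_exp)
  finally have *: "(\<integral>g. cos (g * u) \<partial>std_normal_distribution) = exp (- (u\<^sup>2 / 2))"
    by (simp add: mult.commute)
  have "integrable std_normal_distribution (\<lambda>g. cos (g * u))"
    by (intro N.integrable_const_bound[where B=1]) auto
  then show ?thesis using N.prob_space by (simp add: gauss_gap_def *)
qed

text \<open>The saturating function is the Gaussian average of \<open>1 - cos\<close>, so limits of characteristic
  functions along all frequencies turn into limits of \<open>gap\<close>, which unlike \<open>cosgap\<close> is monotone in
  the scale.\<close>

lemma gap_eq_gaussian_average:
  "(\<integral>x. gauss_gap (y * x) \<partial>P) = (\<integral>g. cosgap P (g * y) \<partial>std_normal_distribution)"
proof -
  interpret N: real_distribution std_normal_distribution by (rule real_dist_normal_dist)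
  interpret PN: pair_prob_space P std_normal_distribution by unfold_locales
  have meas: "(\<lambda>(x, g). 1 - cos (g * (y * x))) \<in> borel_measurable (P \<Otimes>\<^sub>M std_normal_distribution)"
    by measurable
  have int: "integrable (P \<Otimes>\<^sub>M std_normal_distribution) (\<lambda>(x, g). 1 - cos (g * (y * x)))"
  proof (rule PN.integrable_const_bound[where B=2])
    show "AE z in P \<Otimes>\<^sub>M std_normal_distribution. norm (case z of (x, g) \<Rightarrow> 1 - cos (g * (y * x))) \<le> 2"
      by (intro AE_I2) (auto simp: abs_le_iff split: prod.split intro: order_trans[OF cos_le_one])
  qed (rule meas)
  have "(\<integral>x. gauss_gap (y * x) \<partial>P) = (\<integral>x. (\<integral>g. 1 - cos (g * (y * x)) \<partial>std_normal_distribution) \<partial>P)"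
    by (simp add: gauss_gap_eq_gaussian_average)
  also have "\<dots> = (\<integral>g. (\<integral>x. 1 - cos (g * (y * x)) \<partial>P) \<partial>std_normal_distribution)"
    using PN.Fubini_integral[OF int] by simp
  finally show ?thesis by (simp add: cosgap_def mult.assoc)
qed

end

locale nondegenerate_law = centred_law +
  assumes nontrivial: "\<not> (AE x in P. x = 0)"
begin

lemma cosgap_quadratic_lower:
  obtains k d where "0 < k" "0 < d" "\<And>t. \<bar>t\<bar> \<le> d \<Longrightarrow> k * t\<^sup>2 \<le> cosgap P t"
proof -
  define m where "m R = (\<integral>x. x\<^sup>2 * indicator {- R..R} x \<partial>P)" for R :: real
  have int: "integrable P (\<lambda>x. x\<^sup>2 * indicator {- R..R} x)" for R
    by (intro integrable_const_bound[where B="R\<^sup>2"] AE_I2)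
       (auto simp: indicator_def abs_le_square_iff[symmetric])
  have "\<exists>n::nat. m (real n) \<noteq> 0"
  proof (rule ccontr)
    assume "\<nexists>n::nat. m (real n) \<noteq> 0"
    then have "AE x in P. x\<^sup>2 * indicator {- real n..real n} x = 0" for n
      using integral_nonneg_eq_0_iff_AE[OF int, of "real n"] by (simp add: m_def)
    then have "AE x in P. \<forall>n::nat. x\<^sup>2 * indicator {- real n..real n} x = 0" by (subst AE_all_countable) blast
    then have "AE x in P. x = 0"
    proof eventually_elim
      case (elim x)
      obtain n :: nat where "\<bar>x\<bar> \<le> n" using real_arch_simple by blast
      then have "x \<in> {- real n..real n}" by (auto simp: abs_le_iff)
      then show ?case using elim[rule_format, of n] by simp
    qed
    then show False using nontrivial by contradiction
  qed
  then obtain n :: nat where n: "m n \<noteq> 0" by blast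
  have "0 \<le> m n" unfolding m_def by (intro integral_nonneg_AE AE_I2) simp
  then have m0: "0 < m n" using n by simp
  show thesis
  proof (rule that[of "m n / 4" "1 / (real n + 1)"])
    show "m n / 4 * t\<^sup>2 \<le> cosgap P t" if t: "\<bar>t\<bar> \<le> 1 / (real n + 1)" for t
    proof -
      have "t\<^sup>2 / 4 * (x\<^sup>2 * indicator {- real n..real n} x) \<le> 1 - cos (t * x)" for x
      proof (cases "x \<in> {- real n..real n}")
        case True
        then have "\<bar>t\<bar> * \<bar>x\<bar> \<le> 1 / (real n + 1) * (real n + 1)"
          using t by (intro mult_mono) auto
        then have "\<bar>t * x\<bar> \<le> 1" by (simp add: abs_mult)
        from one_minus_cos_lower[OF this] show ?thesis using True by (simp add: power_mult_distrib)
      qed simp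
      then have "(\<integral>x. t\<^sup>2 / 4 * (x\<^sup>2 * indicator {- real n..real n} x) \<partial>P) \<le> cosgap P t"
        unfolding cosgap_def by (intro integral_mono integrable_mult_right int integrable_cos_sin)
      then show ?thesis by (simp add: m_def mult.commute)
    qed
  qed (use m0 in auto)
qed

text \<open>The modulus of the characteristic function determines its real part to leading order: the real
  part differs from \<open>1\<close> at least by a multiple of \<open>t\<^sup>2\<close>, whereas the imaginary part is \<open>o (t)\<close> and
  enters squared. Hence the real part can be recovered after the unknown centring constants, which
  affect only the phase, have been removed by taking moduli.\<close>

lemma char_modulus_expansion:
  assumes e: "0 < e"
  obtains d where "0 < d"
    "\<And>t. \<bar>t\<bar> \<le> d \<Longrightarrow> (2 - e) * cosgap P t \<le> 1 - (cmod (char P t))\<^sup>2"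
    "\<And>t. t \<noteq> 0 \<Longrightarrow> \<bar>t\<bar> \<le> d \<Longrightarrow> 0 < cosgap P t"
proof -
  obtain k d1 where k: "0 < k" "0 < d1" "\<And>t. \<bar>t\<bar> \<le> d1 \<Longrightarrow> k * t\<^sup>2 \<le> cosgap P t"
    using cosgap_quadratic_lower by metis
  obtain d2 where d2: "0 < d2" "\<And>t. \<bar>t\<bar> \<le> d2 \<Longrightarrow> cosgap P t \<le> e / 2"
    using cosgap_small[of "e / 2"] e by auto
  define e' where "e' = sqrt (e / 2 * k)"
  have e': "0 < e'" "e'\<^sup>2 = e / 2 * k" using e k by (auto simp: e'_def)
  obtain d3 where d3: "0 < d3" "\<And>t. \<bar>t\<bar> \<le> d3 \<Longrightarrow> \<bar>\<integral>x. sin (t * x) \<partial>P\<bar> \<le> e' * \<bar>t\<bar>"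
    using sin_integral_small[OF e'(1)] by metis
  show thesis
  proof (rule that[of "min d1 (min d2 d3)"])
    show "0 < min d1 (min d2 d3)" using k d2 d3 by simp
    fix t assume t: "\<bar>t\<bar> \<le> min d1 (min d2 d3)"
    let ?a = "cosgap P t" and ?b = "\<integral>x. sin (t * x) \<partial>P"
    have "?b\<^sup>2 \<le> (e' * \<bar>t\<bar>)\<^sup>2"
      using d3(2)[of t] t by (subst power2_abs[of ?b, symmetric]) (intro power_mono, auto)
    also have "\<dots> = e / 2 * (k * t\<^sup>2)" using e' by (simp add: power_mult_distrib)
    also have "\<dots> \<le> e / 2 * ?a" using k(3)[of t] t e by (intro mult_left_mono) auto
    finally have b: "?b\<^sup>2 \<le> e / 2 * ?a" .
    have a: "?a\<^sup>2 \<le> e / 2 * ?a"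
      unfolding power2_eq_square using d2(2)[of t] t cosgap_nonneg[of t] by (intro mult_right_mono) auto
    show "(2 - e) * ?a \<le> 1 - (cmod (char P t))\<^sup>2"
      using a b unfolding cmod_char_square by (simp add: power2_diff algebra_simps)
    assume "t \<noteq> 0"
    then have "0 < k * t\<^sup>2" using k by simp
    also have "\<dots> \<le> ?a" using k(3)[of t] t by simp
    finally show "0 < ?a" .
  qed
qed

lemma char_modulus_upper: "1 - (cmod (char P t))\<^sup>2 \<le> 2 * cosgap P t"
  unfolding cmod_char_square by (simp add: power2_diff add_nonneg_nonneg)

lemma gap_pos: "0 < c \<Longrightarrow> 0 < gap P c"
proof (rule ccontr)
  assume c: "0 < c" and "\<not> 0 < gap P c"
  then have "gap P c = 0" using gap_nonneg[of c] by simp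
  then have "AE x in P. gauss_gap (x / c) = 0"
    using integral_nonneg_eq_0_iff_AE[OF integrable_gauss_gap, of "\<lambda>x. x / c"] by (simp add: gap_def)
  then have "AE x in P. x = 0"
    by eventually_elim (use gauss_gap_pos c in \<open>metis divide_eq_0_iff less_irrefl\<close>)
  then show False using nontrivial by contradiction
qed

end

section \<open>Laws attracted to the Gaussian law\<close>

lemma rate_from_power_limit:
  fixes q :: "nat \<Rightarrow> real"
  assumes q: "\<And>n. 0 \<le> q n" "\<And>n. q n \<le> 1" and lim: "(\<lambda>n. q n ^ n) \<longlonglongrightarrow> exp (- x)"
  shows "(\<lambda>n. n * (1 - q n)) \<longlonglongrightarrow> x"
proof -
  have pos: "\<forall>\<^sub>F n in sequentially. 0 < q n ^ n" using lim by (rule order_tendstoD) simp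
  define z where "z n = - (n * ln (q n))" for n
  have "(\<lambda>n. - ln (q n ^ n)) \<longlonglongrightarrow> - ln (exp (- x))"
    by (intro tendsto_minus tendsto_ln lim) simp
  then have z: "z \<longlonglongrightarrow> x"
    by (simp add: z_def[abs_def] ln_realpow)
  have lower: "\<forall>\<^sub>F n in sequentially. z n - (z n)\<^sup>2 * (1 / real n) \<le> n * (1 - q n)"
    using pos eventually_gt_at_top[of 0]
  proof eventually_elim
    case (elim n)
    then have qn: "0 < q n" using q(1)[of n] by (cases "q n = 0") (auto simp: power_0_left)
    define w where "w = - ln (q n)"
    have w: "0 \<le> w" "q n = exp (- w)" using qn q(2)[of n] by (auto simp: w_def)
    have "exp (- w) \<le> 1 / (1 + w)"
      using w exp_ge_add_one_self[of w] by (intro exp_minus_le_inverse) auto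
    also have "\<dots> \<le> 1 - w + w\<^sup>2"
    proof -
      have "1 \<le> (1 - w + w\<^sup>2) * (1 + w)" using w by (simp add: power2_eq_square algebra_simps)
      then show ?thesis using w by (simp add: divide_le_eq)
    qed
    finally have "w - w\<^sup>2 \<le> 1 - q n" using w by simp
    then have "n * (w - w\<^sup>2) \<le> n * (1 - q n)" by (intro mult_left_mono) auto
    moreover have "z n = n * w" by (simp add: z_def w_def)
    ultimately show "z n - (z n)\<^sup>2 * (1 / real n) \<le> n * (1 - q n)"
      using elim by (simp add: power2_eq_square algebra_simps)
  qed
  have upper: "\<forall>\<^sub>F n in sequentially. n * (1 - q n) \<le> z n"
    using pos eventually_gt_at_top[of 0]
  proof eventually_elim
    case (elim n)
    then have qn: "0 < q n" using q(1)[of n] by (cases "q n = 0") (auto simp: power_0_left)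
    have "1 - q n \<le> - ln (q n)" using ln_le_minus_one[OF qn] by simp
    then show "n * (1 - q n) \<le> z n" unfolding z_def mult_minus_right[symmetric] by (intro mult_left_mono) auto
  qed
  have "(\<lambda>n. z n - (z n)\<^sup>2 * (1 / real n)) \<longlonglongrightarrow> x - x\<^sup>2 * 0"
    by (intro tendsto_intros z lim_1_over_n)
  then show ?thesis by (intro tendsto_sandwich[OF lower upper _ z]) simp
qed

text \<open>What remains of attraction to the Gaussian law once only the modulus of characteristic functions
  is retained; \<open>y n\<close> is the reciprocal of the norming constant, with value \<open>0\<close> where the norming
  constant is \<open>0\<close>. The second condition is a lower bound that is uniform over small
  frequencies.\<close>

locale attracted_law = centred_law +
  fixes y :: "nat \<Rightarrow> real"
  assumes power_limit: "\<And>t. (\<lambda>n. cmod (char P (t * y n)) ^ n) \<longlonglongrightarrow> exp (- (t\<^sup>2 / 2))"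
    and power_bound: "\<forall>\<^sub>F n in sequentially. \<forall>t. \<bar>t\<bar> \<le> 1 / 4 \<longrightarrow> 1 / 2 \<le> cmod (char P (t * y n)) ^ n"
begin

sublocale nondegenerate_law
proof
  show "\<not> (AE x in P. x = 0)"
  proof
    assume "AE x in P. x = 0"
    then have "char P t = (CLINT x|P. 1)" for t
      unfolding char_def by (intro integral_cong_AE) auto
    then have "char P t = 1" for t by (simp add: prob_space[simplified])
    then have "(\<lambda>n. 1 :: real) \<longlonglongrightarrow> exp (- (1\<^sup>2 / 2))" using power_limit[of 1] by simp
    then show False using LIMSEQ_unique[OF tendsto_const, of 1 "exp (- (1\<^sup>2 / 2)) :: real"] by simp
  qed
qed

definition defect :: "nat \<Rightarrow> real \<Rightarrow> real" where
  "defect n t = n * (1 - (cmod (char P (t * y n)))\<^sup>2)"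

lemma defect_limit: "(\<lambda>n. defect n t) \<longlonglongrightarrow> t\<^sup>2"
  unfolding defect_def
proof (rule rate_from_power_limit)
  have "(\<lambda>n. (cmod (char P (t * y n)) ^ n)\<^sup>2) \<longlonglongrightarrow> (exp (- (t\<^sup>2 / 2)))\<^sup>2"
    by (intro tendsto_intros power_limit)
  then show "(\<lambda>n. ((cmod (char P (t * y n)))\<^sup>2) ^ n) \<longlonglongrightarrow> exp (- t\<^sup>2)"
    by (simp add: exp_double[symmetric] power_mult[symmetric] mult.commute)
qed (use cmod_char_le_1 in \<open>auto simp: abs_square_le_1\<close>)

lemma defect_bounded: "\<forall>\<^sub>F n in sequentially. \<forall>t. \<bar>t\<bar> \<le> 1 / 4 \<longrightarrow> defect n t \<le> 2"
  using power_bound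
proof (rule eventually_mono, intro allI impI)
  fix n t assume n: "\<forall>t. \<bar>t\<bar> \<le> 1 / 4 \<longrightarrow> 1 / 2 \<le> cmod (char P (t * y n)) ^ n" and t: "\<bar>t\<bar> \<le> (1 / 4 :: real)"
  let ?q = "(cmod (char P (t * y n)))\<^sup>2"
  have "(1 / 2)\<^sup>2 \<le> (cmod (char P (t * y n)) ^ n)\<^sup>2" using n t by (intro power_mono) auto
  then have "1 / 4 \<le> ?q ^ n" by (simp add: power2_eq_square power_mult_distrib)
  also have "\<dots> \<le> exp (- (1 - ?q)) ^ n"
    using exp_ge_add_one_self[of "- (1 - ?q)"] by (intro power_mono) auto
  also have "\<dots> = exp (- defect n t)" by (simp add: defect_def exp_of_nat_mult[symmetric] algebra_simps)
  finally have "exp (defect n t) \<le> 4" by (simp add: exp_minus field_simps)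
  also have "(4 :: real) \<le> exp 2" using exp_lower_Taylor_quadratic[of 2] by simp
  finally show "defect n t \<le> 2" by simp
qed

text \<open>Otherwise a fixed small frequency \<open>\<tau>\<close> would be of the form \<open>t * y n\<close> with \<open>\<bar>t\<bar> \<le> 1 / 4\<close> for
  arbitrarily large \<open>n\<close>, and \<open>defect n t\<close> would equal \<open>n\<close> times a positive constant.\<close>

lemma scale_vanishes: "y \<longlonglongrightarrow> 0"
proof (rule tendstoI)
  fix r :: real assume r: "0 < r"
  obtain d where d: "0 < d"
    "\<And>t. \<bar>t\<bar> \<le> d \<Longrightarrow> (2 - 1) * cosgap P t \<le> 1 - (cmod (char P t))\<^sup>2"
    "\<And>t. t \<noteq> 0 \<Longrightarrow> \<bar>t\<bar> \<le> d \<Longrightarrow> 0 < cosgap P t"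
    using char_modulus_expansion[of 1] by auto
  define \<tau> where "\<tau> = min d (r / 4)"
  have \<tau>: "0 < \<tau>" "\<tau> \<le> d" "\<tau> \<le> r / 4" using d r by (auto simp: \<tau>_def)
  define \<delta> where "\<delta> = 1 - (cmod (char P \<tau>))\<^sup>2"
  have \<delta>: "0 < \<delta>" using d(2)[of \<tau>] d(3)[of \<tau>] \<tau> by (simp add: \<delta>_def)
  have "\<forall>\<^sub>F n in sequentially. 3 / \<delta> \<le> real n"
    using filterlim_real_sequentially by (simp add: filterlim_at_top)
  with defect_bounded show "\<forall>\<^sub>F n in sequentially. dist (y n) 0 < r"
  proof eventually_elim
    case (elim n)
    show ?case
    proof (rule ccontr)
      assume "\<not> dist (y n) 0 < r"
      then have yr: "r \<le> \<bar>y n\<bar>" by simp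
      have "\<bar>\<tau> / y n\<bar> \<le> 1 / 4" using yr r \<tau> by (simp add: abs_divide divide_le_eq)
      then have "defect n (\<tau> / y n) \<le> 2" using elim by blast
      moreover have "\<tau> / y n * y n = \<tau>" using yr r by auto
      ultimately have "n * \<delta> \<le> 2" by (simp add: defect_def \<delta>_def)
      moreover have "3 \<le> n * \<delta>" using elim(2) \<delta> by (simp add: divide_le_eq)
      ultimately show False by simp
    qed
  qed
qed

lemma cosgap_le_defect:
  obtains r where "0 < r" "\<And>n t. \<bar>t * y n\<bar> \<le> r \<Longrightarrow> n * cosgap P (t * y n) \<le> defect n t"
proof -
  obtain d where d: "0 < d"
    "\<And>t. \<bar>t\<bar> \<le> d \<Longrightarrow> (2 - 1) * cosgap P t \<le> 1 - (cmod (char P t))\<^sup>2"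
    by (rule char_modulus_expansion[OF zero_less_one]) (rule that)
  show thesis
    by (rule that[OF d(1)]) (use d(2) in \<open>auto simp: defect_def intro!: mult_left_mono\<close>)
qed

text \<open>By the expansion of the modulus, \<open>2 * cosgap P\<close> and \<open>1 - (cmod (char P t))\<^sup>2\<close> agree up to a factor
  close to \<open>1\<close> at the vanishing frequencies \<open>t * y n\<close>.\<close>

lemma cosgap_limit: "(\<lambda>n. n * cosgap P (t * y n)) \<longlonglongrightarrow> t\<^sup>2 / 2"
proof (rule tendstoI)
  fix \<eta> :: real assume \<eta>: "0 < \<eta>"
  define e where "e = min 1 (\<eta> / (t\<^sup>2 + 1))"
  have e: "0 < e" "e \<le> 1" "e * (t\<^sup>2 + 1) \<le> \<eta>"
  proof -
    have p: "0 < t\<^sup>2 + 1" by (simp add: add_nonneg_pos)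
    then show "0 < e" "e \<le> 1" using \<eta> by (auto simp: e_def)
    have "e * (t\<^sup>2 + 1) \<le> \<eta> / (t\<^sup>2 + 1) * (t\<^sup>2 + 1)" using p by (intro mult_right_mono) (auto simp: e_def)
    then show "e * (t\<^sup>2 + 1) \<le> \<eta>" using p by simp
  qed
  obtain d where d: "0 < d"
    "\<And>t. \<bar>t\<bar> \<le> d \<Longrightarrow> (2 - e) * cosgap P t \<le> 1 - (cmod (char P t))\<^sup>2"
    by (rule char_modulus_expansion[OF e(1)]) (rule that)
  have "(\<lambda>n. t * y n) \<longlonglongrightarrow> t * 0" by (intro tendsto_intros scale_vanishes)
  then have "\<forall>\<^sub>F n in sequentially. dist (t * y n) (t * 0) < d" using d(1) by (rule tendstoD)
  moreover have "\<forall>\<^sub>F n in sequentially. dist (defect n t) (t\<^sup>2) < min 1 \<eta>"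
    using \<eta> by (intro tendstoD[OF defect_limit]) auto
  ultimately show "\<forall>\<^sub>F n in sequentially. dist (n * cosgap P (t * y n)) (t\<^sup>2 / 2) < \<eta>"
  proof eventually_elim
    case (elim n)
    define a where "a = n * cosgap P (t * y n)"
    have near: "\<bar>defect n t - t\<^sup>2\<bar> < 1" "\<bar>defect n t - t\<^sup>2\<bar> < \<eta>"
      using elim(2) by (simp_all add: dist_real_def)
    have lower: "(2 - e) * a \<le> defect n t"
      using mult_left_mono[OF d(2)[of "t * y n"], of "real n"] elim
      by (simp add: a_def defect_def mult_ac)
    have upper: "defect n t \<le> 2 * a"
      using mult_left_mono[OF char_modulus_upper[of "t * y n"], of "real n"]
      by (simp add: a_def defect_def mult_ac)
    have a0: "0 \<le> a" by (simp add: a_def cosgap_nonneg)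
    have "1 * a \<le> (2 - e) * a" using e a0 by (intro mult_right_mono) auto
    then have "a \<le> t\<^sup>2 + 1" using lower near(1) by linarith
    then have "e * a \<le> e * (t\<^sup>2 + 1)" using e by (intro mult_left_mono) auto
    then have ea: "e * a \<le> \<eta>" using e(3) by (rule order_trans)
    have "2 * a - defect n t \<le> e * a" using lower by (simp add: algebra_simps)
    then have "\<bar>2 * a - t\<^sup>2\<bar> < 2 * \<eta>"
      using upper ea near(2) by linarith
    then show ?case by (simp add: a_def[symmetric] dist_real_def)
  qed
qed

text \<open>The bound holds for \<open>\<bar>t\<bar> \<le> 1 / 4\<close>; a general \<open>t\<close> is an integer multiple of such a frequency, and
  \<open>1 - cos (k * x) \<le> k\<^sup>2 * (1 - cos x)\<close>. The quadratic growth in \<open>t\<close> supplies the integrable majorant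
  for averaging over Gaussian frequencies.\<close>

lemma cosgap_growth: "\<forall>\<^sub>F n in sequentially. \<forall>t. n * cosgap P (t * y n) \<le> 4 * (16 * t\<^sup>2 + 1)"
proof -
  obtain r where r: "0 < r" "\<And>n t. \<bar>t * y n\<bar> \<le> r \<Longrightarrow> n * cosgap P (t * y n) \<le> defect n t"
    by (rule cosgap_le_defect) (rule that)
  have "\<forall>\<^sub>F n in sequentially. dist (y n) 0 < r"
    using scale_vanishes r(1) by (rule tendstoD)
  with defect_bounded show ?thesis
  proof eventually_elim
    case (elim n)
    show ?case
    proof
      fix t :: real
      define k where "k = nat \<lceil>4 * \<bar>t\<bar>\<rceil>"
      have k: "4 * \<bar>t\<bar> \<le> k" "k \<le> 4 * \<bar>t\<bar> + 1" by (auto simp: k_def)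
      show "n * cosgap P (t * y n) \<le> 4 * (16 * t\<^sup>2 + 1)"
      proof (cases "k = 0")
        case True
        then have "t = 0" using k by simp
        then show ?thesis by (simp add: cosgap_def)
      next
        case False
        define s where "s = t / k"
        have ts: "t = k * s" using False by (simp add: s_def)
        have s: "\<bar>s\<bar> \<le> 1 / 4" using k False by (simp add: s_def abs_divide divide_le_eq)
        have "\<bar>s * y n\<bar> \<le> 1 * r" unfolding abs_mult using s elim by (intro mult_mono) auto
        then have "n * cosgap P (s * y n) \<le> 2" using r(2)[of s n] elim(1) s by fastforce
        then have "(real k)\<^sup>2 * (n * cosgap P (s * y n)) \<le> (real k)\<^sup>2 * 2" by (intro mult_left_mono) auto
        moreover have "n * cosgap P (t * y n) \<le> n * ((real k)\<^sup>2 * cosgap P (s * y n))"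
          using cosgap_multiple_le[of k "s * y n"] unfolding ts by (intro mult_left_mono) (auto simp: mult.assoc)
        ultimately have "n * cosgap P (t * y n) \<le> 2 * (real k)\<^sup>2" by (simp add: mult_ac)
        also have "(real k)\<^sup>2 \<le> (4 * \<bar>t\<bar> + 1)\<^sup>2" using k by (intro power_mono) auto
        also have "(4 * \<bar>t\<bar> + 1)\<^sup>2 \<le> 2 * (16 * t\<^sup>2 + 1)"
          using zero_le_power2[of "4 * \<bar>t\<bar> - 1"] by (simp add: power2_sum power2_diff power_mult_distrib)
        finally show ?thesis by simp
      qed
    qed
  qed
qed

text \<open>\<open>gap P\<close> as a function of the reciprocal scale; in this form the scale \<open>y n = 0\<close> needs no separate
  treatment.\<close>

definition level :: "real \<Rightarrow> real" where "level z = (\<integral>x. gauss_gap (z * x) \<partial>P)"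

lemma level_limit: "(\<lambda>n. n * level (r * y n)) \<longlonglongrightarrow> r\<^sup>2 / 2"
proof -
  interpret N: real_distribution std_normal_distribution by (rule real_dist_normal_dist)
  obtain n0 where n0: "\<And>n t. n0 \<le> n \<Longrightarrow> n * cosgap P (t * y n) \<le> 4 * (16 * t\<^sup>2 + 1)"
    using cosgap_growth unfolding eventually_sequentially by blast
  have meas: "(\<lambda>g. cosgap P (g * z)) \<in> borel_measurable borel" for z
  proof -
    have "(\<lambda>t. 1 - Re (char P t)) \<in> borel_measurable borel" by measurable
    then have [measurable]: "cosgap P \<in> borel_measurable borel" by (simp add: char_components)
    show ?thesis by measurable
  qed
  have mom: "integrable std_normal_distribution (\<lambda>g. 4 * (16 * (g * r)\<^sup>2 + 1))"
    using integrable_std_normal_distribution_moment[of 2] by (simp add: power_mult_distrib)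
  have "(\<lambda>n. \<integral>g. real (n + n0) * cosgap P ((g * r) * y (n + n0)) \<partial>std_normal_distribution)
      \<longlonglongrightarrow> (\<integral>g. (g * r)\<^sup>2 / 2 \<partial>std_normal_distribution)"
  proof (rule integral_dominated_convergence[OF _ _ mom])
    show "AE g in std_normal_distribution.
        (\<lambda>n. real (n + n0) * cosgap P ((g * r) * y (n + n0))) \<longlonglongrightarrow> (g * r)\<^sup>2 / 2"
      by (intro AE_I2 LIMSEQ_ignore_initial_segment[OF cosgap_limit])
    show "AE g in std_normal_distribution.
        norm (real (n + n0) * cosgap P ((g * r) * y (n + n0))) \<le> 4 * (16 * (g * r)\<^sup>2 + 1)" for n
      using n0[of "n + n0"] by (intro AE_I2) (simp add: cosgap_nonneg)
    show "(\<lambda>g. real (n + n0) * cosgap P ((g * r) * y (n + n0))) \<in> borel_measurable std_normal_distribution" for n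
      using meas[of "r * y (n + n0)"] by (simp add: mult.assoc)
  qed simp
  moreover have "(\<integral>g. (g * r)\<^sup>2 / 2 \<partial>std_normal_distribution) = r\<^sup>2 / 2"
    using std_normal_distribution_even_moments[of 1] by (simp add: power_mult_distrib)
  moreover have "(\<integral>g. real (n + n0) * cosgap P ((g * r) * y (n + n0)) \<partial>std_normal_distribution)
      = real (n + n0) * level (r * y (n + n0))" for n
    unfolding level_def gap_eq_gaussian_average by (simp add: mult.assoc)
  ultimately have "(\<lambda>n. real (n + n0) * level (r * y (n + n0))) \<longlonglongrightarrow> r\<^sup>2 / 2" by (simp only:)
  then show ?thesis by (rule LIMSEQ_offset)
qed

lemma level_eq_gap: "level z = gap P (1 / z)"
  by (simp add: level_def gap_def mult.commute)

lemma level_mono: "\<bar>w\<bar> \<le> \<bar>z\<bar> \<Longrightarrow> level w \<le> level z"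
  unfolding level_def
  by (intro integral_mono integrable_gauss_gap gauss_gap_mono) (auto simp: abs_mult mult_right_mono)

text \<open>The limit of \<open>n * level (r * y n)\<close> is exactly quadratic in \<open>r\<close>, so the doubling defect
  \<open>4 * level z - level (2 * z)\<close> is negligible, and it dominates the mean of the square.\<close>

lemma square_level_limit: "(\<lambda>n. n * (\<integral>x. (gauss_gap (r * y n * x))\<^sup>2 \<partial>P)) \<longlonglongrightarrow> 0"
proof (rule Lim_null_comparison)
  have int2: "integrable P (\<lambda>x. (gauss_gap (z * x))\<^sup>2)" for z
    by (rule integrable_gauss_gap_square) simp
  have "(\<lambda>n. (4 * (n * level (r * y n)) - n * level (2 * r * y n)) / 3) \<longlonglongrightarrow> (4 * (r\<^sup>2 / 2) - (2 * r)\<^sup>2 / 2) / 3"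
    by (intro tendsto_intros level_limit) simp
  then show "(\<lambda>n. (4 * (n * level (r * y n)) - n * level (2 * r * y n)) / 3) \<longlonglongrightarrow> 0"
    by (simp add: power_mult_distrib)
  show "\<forall>\<^sub>F n in sequentially. norm (n * (\<integral>x. (gauss_gap (r * y n * x))\<^sup>2 \<partial>P))
      \<le> (4 * (n * level (r * y n)) - n * level (2 * r * y n)) / 3"
  proof (intro always_eventually allI)
    fix n
    let ?z = "r * y n"
    have "3 * (gauss_gap (?z * x))\<^sup>2 \<le> 4 * gauss_gap (?z * x) - gauss_gap (2 * ?z * x)" for x
      using gauss_gap_double_lower[of "?z * x"] by (simp add: mult.assoc)
    then have "(\<integral>x. 3 * (gauss_gap (?z * x))\<^sup>2 \<partial>P) \<le> (\<integral>x. 4 * gauss_gap (?z * x) - gauss_gap (2 * ?z * x) \<partial>P)"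
      by (intro integral_mono integrable_linear int2 integrable_gauss_gap) auto
    then have "3 * (\<integral>x. (gauss_gap (?z * x))\<^sup>2 \<partial>P) \<le> 4 * level ?z - level (2 * ?z)"
      by (simp add: level_def integrable_gauss_gap)
    from mult_left_mono[OF this, of "real n"]
    have "3 * (n * (\<integral>x. (gauss_gap (?z * x))\<^sup>2 \<partial>P)) \<le> 4 * (n * level ?z) - n * level (2 * ?z)"
      by (simp add: right_diff_distrib mult.left_commute)
    moreover have "0 \<le> (\<integral>x. (gauss_gap (?z * x))\<^sup>2 \<partial>P)" by (intro integral_nonneg_AE AE_I2) simp
    ultimately show "norm (n * (\<integral>x. (gauss_gap (?z * x))\<^sup>2 \<partial>P))
        \<le> (4 * (n * level ?z) - n * level (2 * r * y n)) / 3" by (simp add: mult.assoc)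
  qed
qed

text \<open>From the special scales \<open>1 / y n\<close> to all large scales: for a given \<open>c\<close> take \<open>n\<close> with
  \<open>n * gap P c\<close> between \<open>1 / 2\<close> and \<open>1\<close>. Since \<open>n * level (2 * y n)\<close> tends to \<open>2\<close>, monotonicity forces
  \<open>1 / c \<le> 2 * \<bar>y n\<bar>\<close>, and the mean of the square at scale \<open>c\<close> is at most the one at \<open>2 * y n\<close>, which is
  \<open>o (1 / n)\<close>.\<close>

lemma square_gap_negligible:
  assumes \<delta>: "0 < \<delta>"
  obtains c0 where "0 < c0" "\<And>c. c0 \<le> c \<Longrightarrow> (\<integral>x. (gauss_gap (x / c))\<^sup>2 \<partial>P) \<le> \<delta> * gap P c"
proof -
  have "\<forall>\<^sub>F n in sequentially. 1 < n * level (2 * y n)"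
    by (rule order_tendstoD(1)[OF level_limit]) simp
  moreover have "\<forall>\<^sub>F n in sequentially. n * (\<integral>x. (gauss_gap (2 * y n * x))\<^sup>2 \<partial>P) < \<delta> / 2"
    using \<delta> by (intro order_tendstoD(2)[OF square_level_limit]) simp
  ultimately have "\<forall>\<^sub>F n in sequentially. 1 < n * level (2 * y n)
      \<and> n * (\<integral>x. (gauss_gap (2 * y n * x))\<^sup>2 \<partial>P) < \<delta> / 2" by (rule eventually_conj)
  then obtain n0 where n0:
    "\<And>n. n0 \<le> n \<Longrightarrow> 1 < n * level (2 * y n) \<and> n * (\<integral>x. (gauss_gap (2 * y n * x))\<^sup>2 \<partial>P) < \<delta> / 2"
    unfolding eventually_sequentially by blast
  have "\<forall>\<^sub>F c in at_top. gap P c < 1 / (2 * (real n0 + 1))"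
    by (rule order_tendstoD(2)[OF gap_tendsto_0]) simp
  then obtain c1 where c1: "\<And>c. c1 \<le> c \<Longrightarrow> gap P c < 1 / (2 * (real n0 + 1))"
    unfolding eventually_at_top_linorder by blast
  show thesis
  proof (rule that[of "max 1 c1"])
    fix c assume c: "max 1 c1 \<le> c"
    define G where "G = gap P c"
    have G: "0 < G" "G < 1 / (2 * (real n0 + 1))" using gap_pos[of c] c1[of c] c by (auto simp: G_def)
    define n where "n = nat \<lceil>1 / (2 * G)\<rceil>"
    have n_lower: "1 / (2 * G) \<le> n" unfolding n_def by (rule real_nat_ceiling_ge)
    have n_upper: "n \<le> 1 / (2 * G) + 1" unfolding n_def using G by (simp add: of_nat_ceiling)
    have "real n0 + 1 < 1 / (2 * G)" using G by (simp add: field_simps)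
    then have nn0: "n0 \<le> n" using n_lower by linarith
    have nG1: "1 / 2 \<le> n * G" using n_lower G by (simp add: divide_le_eq mult_ac)
    have nG2: "n * G \<le> 1"
    proof -
      have "n * G \<le> (1 / (2 * G) + 1) * G" using n_upper G by (intro mult_right_mono) auto
      also have "\<dots> = 1 / 2 + G" using G by (simp add: field_simps)
      also have "G \<le> 1 / 2"
      proof -
        have "1 / (2 * (real n0 + 1)) \<le> 1 / 2" by (rule frac_le) auto
        then show ?thesis using G(2) by linarith
      qed
      finally show ?thesis by simp
    qed
    have "level (1 / c) < level (2 * y n)"
    proof -
      have "n * level (1 / c) < n * level (2 * y n)"
        using nG2 n0[OF nn0] by (simp add: level_eq_gap G_def)
      then show ?thesis by (simp add: mult_less_cancel_left)
    qed
    then have "\<not> \<bar>2 * y n\<bar> \<le> \<bar>1 / c\<bar>" using level_mono[of "2 * y n" "1 / c"] by linarith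
    then have le: "\<bar>1 / c\<bar> \<le> \<bar>2 * y n\<bar>" by linarith
    have int2: "integrable P (\<lambda>x. (gauss_gap (z * x))\<^sup>2)" for z
      by (rule integrable_gauss_gap_square) simp
    have "(gauss_gap (1 / c * x))\<^sup>2 \<le> (gauss_gap (2 * y n * x))\<^sup>2" for x
      unfolding abs_square_le_1
      by (intro power_mono gauss_gap_mono gauss_gap_nonneg) (unfold abs_mult[of _ x], intro mult_right_mono le, simp)
    then have "(\<integral>x. (gauss_gap (1 / c * x))\<^sup>2 \<partial>P) \<le> (\<integral>x. (gauss_gap (2 * y n * x))\<^sup>2 \<partial>P)"
      by (intro integral_mono int2)
    then have "n * (\<integral>x. (gauss_gap (x / c))\<^sup>2 \<partial>P) \<le> \<delta> / 2"
      using n0[OF nn0] mult_left_mono[of "\<integral>x. (gauss_gap (1 / c * x))\<^sup>2 \<partial>P" "\<integral>x. (gauss_gap (2 * y n * x))\<^sup>2 \<partial>P" "real n"]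
      by simp
    also have "\<dots> \<le> \<delta> * (n * G)" using mult_left_mono[OF nG1, of \<delta>] \<delta> by simp
    also have "\<dots> = n * (\<delta> * G)" by simp
    finally have "n * (\<integral>x. (gauss_gap (x / c))\<^sup>2 \<partial>P) \<le> n * (\<delta> * G)" .
    moreover have "0 < real n" using nG1 by (cases "n = 0") auto
    ultimately show "(\<integral>x. (gauss_gap (x / c))\<^sup>2 \<partial>P) \<le> \<delta> * gap P c" by (simp add: G_def)
  qed simp
qed

text \<open>Passing from scale \<open>c\<close> to \<open>2 * c\<close> gives \<open>cubic_gap P c \<le> 2 * cubic_gap P (2 * c) + o (gap P c)\<close>.
  Iterating, the error at step \<open>m\<close> carries the weight \<open>2 ^ m\<close>, but \<open>gap P\<close> has shrunk at least by \<open>3 ^ m\<close>, so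
  the errors form a convergent geometric series; the remainder \<open>2 ^ m * cubic_gap P (2 ^ m * c)\<close>
  vanishes because the first moment is finite.\<close>

lemma cubic_gap_negligible:
  assumes \<delta>: "0 < \<delta>"
  obtains c0 where "0 < c0" "\<And>c. c0 \<le> c \<Longrightarrow> cubic_gap P c \<le> \<delta> * gap P c"
proof -
  define e where "e = \<delta> / 6"
  have e: "0 < e" using \<delta> by (simp add: e_def)
  obtain K where K: "0 \<le> K"
    "\<And>u. \<bar>u\<bar> * (gauss_gap u - gauss_gap (u / 2)) \<le> e * gauss_gap u + K * (gauss_gap u)\<^sup>2"
    using gauss_gap_halving_increment[OF e] by metis
  define d where "d = min (1 / 12) (e / (K + 1))"
  have d: "0 < d" "12 * d \<le> 1" "K * d \<le> e"
  proof -
    show "0 < d" "12 * d \<le> 1" using e K by (auto simp: d_def)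
    have "K * d \<le> (K + 1) * (e / (K + 1))" using K e by (intro mult_mono) (auto simp: d_def)
    then show "K * d \<le> e" using K by simp
  qed
  obtain c0 where c0: "0 < c0" "\<And>c. c0 \<le> c \<Longrightarrow> (\<integral>x. (gauss_gap (x / c))\<^sup>2 \<partial>P) \<le> d * gap P c"
    using square_gap_negligible[OF d(1)] by metis
  have int2: "integrable P (\<lambda>x. (gauss_gap (x / c))\<^sup>2)" for c
    by (rule integrable_gauss_gap_square) simp
  have halve: "gap P (2 * c) \<le> gap P c / 3" if c: "c0 \<le> c" for c
  proof -
    have "4 * gauss_gap (x / (2 * c)) - gauss_gap (x / c) \<le> 6 * (gauss_gap (x / (2 * c)))\<^sup>2" for x
      using gauss_gap_double_upper[of "x / (2 * c)"] by simp
    then have "(\<integral>x. 4 * gauss_gap (x / (2 * c)) - gauss_gap (x / c) \<partial>P) \<le> (\<integral>x. 6 * (gauss_gap (x / (2 * c)))\<^sup>2 \<partial>P)"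
      by (intro integral_mono integrable_linear int2 integrable_gauss_gap) auto
    then have "4 * gap P (2 * c) - gap P c \<le> 6 * (\<integral>x. (gauss_gap (x / (2 * c)))\<^sup>2 \<partial>P)"
      by (simp add: gap_def integrable_gauss_gap)
    also have "\<dots> \<le> 6 * (d * gap P (2 * c))" using c0 c by (intro mult_left_mono c0(2)) auto
    also have "\<dots> \<le> gap P (2 * c)"
      using mult_right_mono[OF d(2) gap_nonneg[of "2 * c"]] gap_nonneg[of "2 * c"] by simp
    finally show ?thesis by simp
  qed
  have recur: "cubic_gap P c \<le> 2 * cubic_gap P (2 * c) + 2 * e * gap P c" if c: "c0 \<le> c" for c
  proof -
    have "\<bar>x / c\<bar> * gauss_gap (x / c) \<le> 2 * (\<bar>x / (2 * c)\<bar> * gauss_gap (x / (2 * c))) + (e * gauss_gap (x / c) + K * (gauss_gap (x / c))\<^sup>2)" for x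
      using K(2)[of "x / c"] by (simp add: abs_mult algebra_simps)
    then have "cubic_gap P c \<le> (\<integral>x. 2 * (\<bar>x / (2 * c)\<bar> * gauss_gap (x / (2 * c))) + (e * gauss_gap (x / c) + K * (gauss_gap (x / c))\<^sup>2) \<partial>P)"
      unfolding cubic_gap_def
      by (intro integral_mono integrable_abs_gauss_gap integrable_linear int2 integrable_gauss_gap) auto
    also have "\<dots> = 2 * cubic_gap P (2 * c) + (e * gap P c + K * (\<integral>x. (gauss_gap (x / c))\<^sup>2 \<partial>P))"
      by (simp add: cubic_gap_def gap_def integrable_abs_gauss_gap int2 integrable_gauss_gap del: abs_divide)
    also have "K * (\<integral>x. (gauss_gap (x / c))\<^sup>2 \<partial>P) \<le> K * (d * gap P c)" using c0(2)[OF c] K by (intro mult_left_mono) auto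
    also have "\<dots> \<le> e * gap P c" using mult_right_mono[OF d(3) gap_nonneg[of c]] by simp
    finally show ?thesis by simp
  qed
  have iter: "cubic_gap P c \<le> 2 ^ m * cubic_gap P (2 ^ m * c) + 6 * e * gap P c * (1 - (2 / 3) ^ m)
      \<and> gap P (2 ^ m * c) \<le> gap P c / 3 ^ m" if c: "c0 \<le> c" for c m
  proof (induction m)
    case (Suc m)
    have ge: "c0 \<le> 2 ^ m * c"
    proof -
      have "c0 * 1 \<le> c * 2 ^ m" using c c0 by (intro mult_mono) auto
      then show ?thesis by (simp add: mult.commute)
    qed
    have "gap P (2 ^ Suc m * c) \<le> gap P (2 ^ m * c) / 3" using halve[OF ge] by (simp add: mult.assoc)
    also have "\<dots> \<le> gap P c / 3 ^ m / 3" using Suc.IH by (intro divide_right_mono) auto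
    finally have g: "gap P (2 ^ Suc m * c) \<le> gap P c / 3 ^ Suc m" by (simp add: mult.commute)
    have "2 ^ m * cubic_gap P (2 ^ m * c) \<le> 2 ^ m * (2 * cubic_gap P (2 ^ Suc m * c) + 2 * e * gap P (2 ^ m * c))"
      using recur[OF ge] by (intro mult_left_mono) (auto simp: mult.assoc)
    also have "\<dots> \<le> 2 ^ m * (2 * cubic_gap P (2 ^ Suc m * c) + 2 * e * (gap P c / 3 ^ m))"
      using Suc.IH e by (intro mult_left_mono add_left_mono) auto
    also have "\<dots> = 2 ^ Suc m * cubic_gap P (2 ^ Suc m * c) + 2 * e * gap P c * (2 / 3) ^ m"
      by (simp add: power_divide algebra_simps)
    finally have "cubic_gap P c \<le> 2 ^ Suc m * cubic_gap P (2 ^ Suc m * c) + 2 * e * gap P c * (2 / 3) ^ m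
        + 6 * e * gap P c * (1 - (2 / 3) ^ m)" using Suc.IH by linarith
    also have "\<dots> = 2 ^ Suc m * cubic_gap P (2 ^ Suc m * c) + 6 * e * gap P c * (1 - (2 / 3) ^ Suc m)"
      by (simp add: algebra_simps)
    finally show ?case using g by blast
  qed simp
  have vanish: "(\<lambda>m. 2 ^ m * cubic_gap P (2 ^ m * c)) \<longlonglongrightarrow> 0" if c: "0 < c" for c
  proof -
    have eq: "2 ^ m * cubic_gap P (2 ^ m * c) = (\<integral>x. \<bar>x / c\<bar> * gauss_gap (x / (2 ^ m * c)) \<partial>P)" for m
    proof -
      have "2 ^ m * (\<bar>x / (2 ^ m * c)\<bar> * gauss_gap (x / (2 ^ m * c))) = \<bar>x / c\<bar> * gauss_gap (x / (2 ^ m * c))" for x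
        using c by (simp add: abs_mult)
      then show ?thesis
        unfolding cubic_gap_def integral_mult_right_zero[symmetric] by simp
    qed
    have "(\<lambda>m. \<integral>x. \<bar>x / c\<bar> * gauss_gap (x / (2 ^ m * c)) \<partial>P) \<longlonglongrightarrow> (\<integral>x. 0 \<partial>P)"
    proof (rule integral_dominated_convergence[where w="\<lambda>x. \<bar>x / c\<bar>"])
      show "integrable P (\<lambda>x. \<bar>x / c\<bar>)" by (intro integrable_abs integrable_scaled)
      show "AE x in P. (\<lambda>m. \<bar>x / c\<bar> * gauss_gap (x / (2 ^ m * c))) \<longlonglongrightarrow> 0"
      proof (intro AE_I2)
        fix x
        have "(\<lambda>m. x / c * (1 / 2) ^ m) \<longlonglongrightarrow> x / c * 0"
          by (intro tendsto_intros LIMSEQ_realpow_zero) auto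
        then have "(\<lambda>m. x / (2 ^ m * c)) \<longlonglongrightarrow> 0" by (simp add: power_divide mult.commute)
        then have "(\<lambda>m. \<bar>x / c\<bar> * (1 - exp (- ((x / (2 ^ m * c))\<^sup>2 / 2)))) \<longlonglongrightarrow> \<bar>x / c\<bar> * (1 - exp (- (0\<^sup>2 / 2)))"
          by (intro tendsto_intros) auto
        then show "(\<lambda>m. \<bar>x / c\<bar> * gauss_gap (x / (2 ^ m * c))) \<longlonglongrightarrow> 0" by (simp add: gauss_gap_def)
      qed
      show "AE x in P. norm (\<bar>x / c\<bar> * gauss_gap (x / (2 ^ m * c))) \<le> \<bar>x / c\<bar>" for m
        by (intro AE_I2) (simp add: abs_mult mult_left_le del: abs_divide)
    qed auto
    then show ?thesis unfolding eq by simp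
  qed
  show thesis
  proof (rule that[OF c0(1)])
    fix c assume c: "c0 \<le> c"
    have "cubic_gap P c \<le> 2 ^ m * cubic_gap P (2 ^ m * c) + 6 * e * gap P c" for m
    proof -
      have "6 * e * gap P c * (1 - (2 / 3) ^ m) \<le> 6 * e * gap P c * 1"
        using e gap_nonneg[of c] by (intro mult_left_mono) auto
      then show ?thesis using iter[OF c, of m] by linarith
    qed
    moreover have "(\<lambda>m. 2 ^ m * cubic_gap P (2 ^ m * c) + 6 * e * gap P c) \<longlonglongrightarrow> 0 + 6 * e * gap P c"
      using c c0 by (intro tendsto_intros vanish) auto
    ultimately have "cubic_gap P c \<le> 0 + 6 * e * gap P c"
      by (intro tendsto_lowerbound[of _ _ sequentially]) auto
    then show "cubic_gap P c \<le> \<delta> * gap P c" by (simp add: e_def)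
  qed
qed

lemma uniformly_gaussian_singleton: "uniformly_gaussian {P}"
  unfolding uniformly_gaussian_def
proof (intro conjI allI impI ballI)
  show "centred_law Q" if "Q \<in> {P}" for Q using that centred_law_axioms by simp
  show "\<exists>c0>0. \<forall>Q\<in>{P}. \<forall>c\<ge>c0. cubic_gap Q c \<le> d * gap Q c" if "0 < d" for d
    using cubic_gap_negligible[OF that] by (metis singletonD)
  show "\<exists>k>0. \<forall>Q\<in>{P}. k \<le> gap Q c" if "0 < c" for c
    using gap_pos[OF that] by auto
qed

end

section \<open>Domains of attraction and bounded skewness\<close>

lemma iid_with_law_affine:
  assumes iid: "iid_with_law M X P"
  shows "iid_with_law M (\<lambda>i \<omega>. (X i \<omega> - \<theta>) / \<sigma>) (distr P borel (\<lambda>x. (x - \<theta>) / \<sigma>))"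
proof -
  interpret prob_space M using iid by (simp add: iid_with_law_def)
  have ind: "indep_vars (\<lambda>_. borel) X UNIV" and law: "\<And>i. distr M borel (X i) = P"
    using iid by (auto simp: iid_with_law_def)
  have [measurable]: "X i \<in> borel_measurable M" for i using ind by (auto simp: indep_vars_def)
  have "indep_vars (\<lambda>_. borel) (\<lambda>i \<omega>. (X i \<omega> - \<theta>) / \<sigma>) UNIV"
    by (rule indep_vars_compose2[OF ind, where Y="\<lambda>_ x. (x - \<theta>) / \<sigma>"]) simp
  moreover have "distr M borel (\<lambda>\<omega>. (X i \<omega> - \<theta>) / \<sigma>) = distr P borel (\<lambda>x. (x - \<theta>) / \<sigma>)" for i
    unfolding law[of i, symmetric] by (subst distr_distr) (auto simp: comp_def)
  ultimately show ?thesis using prob_space_axioms by (simp add: iid_with_law_def)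
qed

lemma E_IWR_affine:
  assumes "0 < \<sigma>"
  shows "E_IWR (\<lambda>i \<omega>. (X i \<omega> - \<theta>) / \<sigma>) n 0 l \<omega> = E_IWR X n \<theta> l \<omega>"
proof -
  have "S_stat (\<lambda>i \<omega>. (X i \<omega> - \<theta>) / \<sigma>) 0 n \<omega> = S_stat X \<theta> n \<omega> / \<sigma>"
    by (simp add: S_stat_def sum_divide_distrib)
  moreover have "V_stat (\<lambda>i \<omega>. (X i \<omega> - \<theta>) / \<sigma>) 0 n \<omega> = V_stat X \<theta> n \<omega> / \<sigma>"
    using assms by (simp add: V_stat_def power_divide sum_divide_distrib[symmetric] real_sqrt_divide)
  ultimately show ?thesis using assms by (simp add: E_IWR_def)
qed

lemma iid_coordinates:
  assumes "real_distribution P"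
  shows "iid_with_law (\<Pi>\<^sub>M i\<in>(UNIV :: nat set). P) (\<lambda>i x. x i) P"
proof -
  interpret real_distribution P by fact
  interpret prod: product_prob_space "\<lambda>_ :: nat. P" UNIV by unfold_locales
  let ?M = "\<Pi>\<^sub>M i\<in>(UNIV :: nat set). P"
  have [measurable]: "(\<lambda>x. x i) \<in> borel_measurable ?M" for i :: nat
    using measurable_component_singleton[of i UNIV "\<lambda>_. P"]
      measurable_cong_sets[OF refl events_eq_borel, of ?M] by simp
  have law: "distr ?M borel (\<lambda>x. x i) = P" for i
  proof -
    have "distr ?M borel (\<lambda>x. x i) = distr ?M P (\<lambda>x. x i)" by (rule distr_cong) auto
    also have "\<dots> = P" using prod.PiM_component[of i] by simp
    finally show ?thesis .
  qed
  have "prod.indep_vars (\<lambda>_. borel) (\<lambda>i x. x i) UNIV"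
  proof (subst prod.indep_vars_iff_distr_eq_PiM)
    have "sets ?M = sets (\<Pi>\<^sub>M i\<in>(UNIV :: nat set). borel)" by (intro sets_PiM_cong) auto
    then have "distr ?M (\<Pi>\<^sub>M i\<in>(UNIV :: nat set). borel) (\<lambda>x. x) = ?M" by (simp add: distr_id2)
    then show "distr ?M (\<Pi>\<^sub>M i\<in>(UNIV :: nat set). borel) (\<lambda>x. \<lambda>i\<in>UNIV. x i)
        = (\<Pi>\<^sub>M i\<in>UNIV. distr ?M borel (\<lambda>x. x i))" by (simp add: law restrict_def)
  qed auto
  then show ?thesis using prod.prob_space_axioms law by (simp add: iid_with_law_def)
qed

lemma char_affine:
  assumes [measurable]: "f \<in> borel_measurable M"
  shows "cmod (char (distr M borel (\<lambda>\<omega>. (f \<omega> - b) / a)) t) = cmod (char (distr M borel f) (t / a))"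
proof -
  have "iexp (t * ((x - b) / a)) = iexp (- (t * b / a)) * iexp (t / a * x)" for x
    unfolding exp_add[symmetric] by (simp add: diff_divide_distrib algebra_simps)
  then have "char (distr M borel (\<lambda>\<omega>. (f \<omega> - b) / a)) t = iexp (- (t * b / a)) * char (distr M borel f) (t / a)"
    by (simp add: char_def integral_distr)
  then show ?thesis by (simp add: norm_mult del: of_real_minus)
qed

lemma cmod_char_normalised_sum:
  assumes "real_distribution P"
  shows "cmod (char (distr (\<Pi>\<^sub>M i\<in>(UNIV :: nat set). P) borel (\<lambda>x. ((\<Sum>i<n. x i) - b) / a)) t)
    = cmod (char P (t / a)) ^ n"
proof -
  let ?M = "\<Pi>\<^sub>M i\<in>(UNIV :: nat set). P"
  have iid: "iid_with_law ?M (\<lambda>i x. x i) P" by (rule iid_coordinates[OF assms])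
  interpret prob_space ?M using iid by (simp add: iid_with_law_def)
  have ind: "indep_vars (\<lambda>_. borel) (\<lambda>i x. x i) (UNIV :: nat set)"
    and law: "\<And>i. distr ?M borel (\<lambda>x. x i) = P"
    using iid by (auto simp: iid_with_law_def)
  have [measurable]: "(\<lambda>x. x i) \<in> borel_measurable ?M" for i :: nat using ind by (auto simp: indep_vars_def)
  have "char (distr ?M borel (\<lambda>x. \<Sum>i<n. x i)) s = char P s ^ n" for s
    using char_distr_sum[OF indep_vars_subset[OF ind subset_UNIV[of "{..<n}"]], of s] by (simp add: law)
  then show ?thesis by (subst char_affine) (auto simp: norm_power)
qed

text \<open>A bound that is uniform over small frequencies and involves only the integral of a bounded
  continuous function, which is stable under weak convergence.\<close>

lemma cmod_char_lower:
  assumes "real_distribution \<mu>" and t: "\<bar>t\<bar> \<le> 1 / 4"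
  shows "1 - (\<integral>x. min 2 (\<bar>x\<bar> / 4) \<partial>\<mu>) \<le> cmod (char \<mu> t)"
proof -
  interpret real_distribution \<mu> by fact
  have int: "integrable \<mu> (\<lambda>x. iexp (t * x))" by (rule integrable_iexp) auto
  have int1: "integrable \<mu> (\<lambda>x. 1 - iexp (t * x))" using int by simp
  have "1 - char \<mu> t = (\<integral>x. 1 - iexp (t * x) \<partial>\<mu>)"
    using int by (simp add: char_def prob_space[simplified])
  then have "cmod (1 - char \<mu> t) \<le> (\<integral>x. cmod (1 - iexp (t * x)) \<partial>\<mu>)" by simp
  also have "\<dots> \<le> (\<integral>x. min 2 (\<bar>x\<bar> / 4) \<partial>\<mu>)"
  proof (rule integral_mono)
    show "integrable \<mu> (\<lambda>x. cmod (1 - iexp (t * x)))" using int1 by (rule integrable_norm)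
    show "integrable \<mu> (\<lambda>x. min 2 (\<bar>x\<bar> / 4))" by (intro integrable_const_bound[where B=2]) auto
    fix x
    have "cmod (iexp (t * x) - 1) \<le> \<bar>t * x\<bar>" using iexp_approx1[of "t * x" 0] by simp
    also have "\<dots> \<le> 1 / 4 * \<bar>x\<bar>" unfolding abs_mult using t by (intro mult_right_mono) auto
    finally have "cmod (1 - iexp (t * x)) \<le> \<bar>x\<bar> / 4" by (simp add: norm_minus_commute)
    moreover have "cmod (1 - iexp (t * x)) \<le> 2" using norm_triangle_ineq4[of 1 "iexp (t * x)"] by simp
    ultimately show "cmod (1 - iexp (t * x)) \<le> min 2 (\<bar>x\<bar> / 4)" by simp
  qed
  finally have "cmod (1 - char \<mu> t) \<le> (\<integral>x. min 2 (\<bar>x\<bar> / 4) \<partial>\<mu>)" .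
  then show ?thesis using norm_triangle_ineq2[of 1 "1 - char \<mu> t"] by simp
qed

lemma centred_law_affine:
  assumes "real_distribution P" and int: "integrable P (\<lambda>x. x)" and mean: "(\<integral>x. x \<partial>P) = \<theta>"
  shows "centred_law (distr P borel (\<lambda>x. (x - \<theta>) / \<sigma>))"
proof -
  interpret real_distribution P by fact
  have int': "integrable P (\<lambda>x. (x - \<theta>) / \<sigma>)" using int by simp
  have "(\<integral>x. (x - \<theta>) / \<sigma> \<partial>P) = 0" using int mean by (simp add: prob_space[simplified])
  moreover have "(\<integral>x. x \<partial>distr P borel (\<lambda>x. (x - \<theta>) / \<sigma>)) = (\<integral>x. (x - \<theta>) / \<sigma> \<partial>P)"
    by (rule integral_distr) simp_all
  ultimately have mean0: "(\<integral>x. x \<partial>distr P borel (\<lambda>x. (x - \<theta>) / \<sigma>)) = 0" by (rule trans[rotated])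
  have int0: "integrable (distr P borel (\<lambda>x. (x - \<theta>) / \<sigma>)) (\<lambda>x. x)"
    using int' by (subst integrable_distr_eq) simp_all
  have "real_distribution (distr P borel (\<lambda>x. (x - \<theta>) / \<sigma>))"
    by (rule real_distribution_distr) simp
  then show ?thesis by (rule centred_law.intro[OF _ centred_law_axioms.intro[OF int0 mean0]])
qed

text \<open>Taking moduli removes the centring constants, and the characteristic function of the
  normalised sum becomes a power of that of a single term. For the standard normal law
  \<open>\<bar>x\<bar> / 4\<close> has mean at most \<open>1 / 4\<close>, which leaves room for the bound \<open>1 / 2\<close> near frequency \<open>0\<close>.\<close>

lemma DAN_attracted:
  assumes "P \<in> DAN \<theta>"
  obtains y where "attracted_law (distr P borel (\<lambda>x. x - \<theta>)) y"
proof -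
  have real: "real_distribution P" and int: "integrable P (\<lambda>x. x)" and mean: "(\<integral>x. x \<partial>P) = \<theta>"
    using assms by (auto simp: DAN_def)
  interpret real_distribution P by (rule real)
  let ?\<mu> = "\<lambda>a b n. distr (\<Pi>\<^sub>M i\<in>(UNIV :: nat set). P) borel (\<lambda>x. ((\<Sum>i<n. x i) - b n) / a n)"
  obtain a b :: "nat \<Rightarrow> real" where conv: "weak_conv_m (?\<mu> a b) std_normal_distribution"
    using assms by (auto simp: DAN_def)
  define \<mu> where "\<mu> = ?\<mu> a b"
  interpret N: real_distribution std_normal_distribution by (rule real_dist_normal_dist)
  have dist: "real_distribution (\<mu> n)" for n
  proof -
    have iid: "iid_with_law (\<Pi>\<^sub>M i\<in>(UNIV :: nat set). P) (\<lambda>i x. x i) P" by (rule iid_coordinates[OF real])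
    interpret prod: prob_space "\<Pi>\<^sub>M i\<in>(UNIV :: nat set). P" using iid by (simp add: iid_with_law_def)
    have [measurable]: "(\<lambda>x. x i) \<in> borel_measurable (\<Pi>\<^sub>M i\<in>(UNIV :: nat set). P)" for i :: nat
      using iid by (auto simp: iid_with_law_def prod.indep_vars_def)
    show ?thesis unfolding \<mu>_def by (intro prod.real_distribution_distr) measurable
  qed
  have cm: "cmod (char (\<mu> n) t) = cmod (char P (t / a n)) ^ n" for n t
    unfolding \<mu>_def by (rule cmod_char_normalised_sum[OF real])
  let ?Q = "distr P borel (\<lambda>x. x - \<theta>)"
  have cQ: "cmod (char ?Q t) = cmod (char P t)" for t
  proof -
    have "distr P borel (\<lambda>x. x) = P" by (rule distr_id2) simp
    then show ?thesis using char_affine[of "\<lambda>x. x" P \<theta> 1 t] by simp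
  qed
  have "attracted_law ?Q (\<lambda>n. 1 / a n)"
  proof -
    have "centred_law ?Q" using centred_law_affine[OF real int mean, of 1] by simp
    then interpret Q: centred_law ?Q .
    show ?thesis
    proof
      fix t
      have "(\<lambda>n. char (\<mu> n) t) \<longlonglongrightarrow> char std_normal_distribution t"
        using levy_continuity1[OF dist N.real_distribution_axioms conv[folded \<mu>_def]] .
      then have "(\<lambda>n. cmod (char (\<mu> n) t)) \<longlonglongrightarrow> cmod (char std_normal_distribution t)" by (rule tendsto_norm)
      then show "(\<lambda>n. cmod (char ?Q (t * (1 / a n))) ^ n) \<longlonglongrightarrow> exp (- (t\<^sup>2 / 2))"
        by (simp add: cm cQ char_std_normal_distribution)
    next
      have "(\<lambda>n. \<integral>x. min 2 (\<bar>x\<bar> / 4) \<partial>\<mu> n) \<longlonglongrightarrow> (\<integral>x. min 2 (\<bar>x\<bar> / 4) \<partial>std_normal_distribution)"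
        by (rule weak_conv_imp_integral_bdd_continuous_conv[where B=2, OF dist N.real_distribution_axioms conv[folded \<mu>_def]])
           (auto intro!: continuous_intros)
      moreover have "(\<integral>x. min 2 (\<bar>x\<bar> / 4) \<partial>std_normal_distribution) < 1 / 2"
      proof -
        have int2: "integrable std_normal_distribution (\<lambda>x. x\<^sup>2)" by (rule integrable_std_normal_distribution_moment)
        have "(\<integral>x. min 2 (\<bar>x\<bar> / 4) \<partial>std_normal_distribution) \<le> (\<integral>x. (1 + x\<^sup>2) / 8 \<partial>std_normal_distribution)"
        proof (rule integral_mono)
          show "integrable std_normal_distribution (\<lambda>x. min 2 (\<bar>x\<bar> / 4))"
            by (intro N.integrable_const_bound[where B=2]) auto
          show "integrable std_normal_distribution (\<lambda>x. (1 + x\<^sup>2) / 8)" using int2 by simp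
          fix x :: real
          have "2 * \<bar>x\<bar> \<le> 1 + x\<^sup>2" using zero_le_power2[of "\<bar>x\<bar> - 1"] by (simp add: power2_diff)
          then show "min 2 (\<bar>x\<bar> / 4) \<le> (1 + x\<^sup>2) / 8" by simp
        qed
        also have "\<dots> = 1 / 4"
          using int2 std_normal_distribution_even_moments[of 1] by (simp add: N.prob_space[simplified])
        finally show ?thesis by simp
      qed
      ultimately have "\<forall>\<^sub>F n in sequentially. (\<integral>x. min 2 (\<bar>x\<bar> / 4) \<partial>\<mu> n) < 1 / 2" by (rule order_tendstoD(2))
      then show "\<forall>\<^sub>F n in sequentially. \<forall>t. \<bar>t\<bar> \<le> 1 / 4 \<longrightarrow> 1 / 2 \<le> cmod (char ?Q (t * (1 / a n))) ^ n"
      proof (rule eventually_mono, intro allI impI)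
        fix n t assume "(\<integral>x. min 2 (\<bar>x\<bar> / 4) \<partial>\<mu> n) < 1 / 2" and "\<bar>t\<bar> \<le> (1 / 4 :: real)"
        then have "1 / 2 \<le> cmod (char (\<mu> n) t)" using cmod_char_lower[OF dist, of t n] by linarith
        then show "1 / 2 \<le> cmod (char ?Q (t * (1 / a n))) ^ n" by (simp add: cm cQ)
      qed
    qed
  qed
  then show thesis by (rule that)
qed

lemma (in centred_law) third_moment_bounds:
  assumes int3: "integrable P (\<lambda>x. \<bar>x\<bar> ^ 3)" and var: "(\<integral>x. x\<^sup>2 \<partial>P) = 1"
    and third: "(\<integral>x. \<bar>x\<bar> ^ 3 \<partial>P) \<le> \<rho>" and c: "0 < c"
  shows "cubic_gap P c \<le> \<rho> / (2 * c ^ 3)" and "1 / (2 * c\<^sup>2) - \<rho> / (2 * c ^ 3) \<le> gap P c"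
proof -
  have int2: "integrable P (\<lambda>x. x\<^sup>2)" using var not_integrable_integral_eq by fastforce
  have "cubic_gap P c \<le> (\<integral>x. \<bar>x\<bar> ^ 3 / (2 * c ^ 3) \<partial>P)"
    unfolding cubic_gap_def
  proof (intro integral_mono integrable_abs_gauss_gap)
    show "integrable P (\<lambda>x. \<bar>x\<bar> ^ 3 / (2 * c ^ 3))" using int3 by simp
    fix x
    have "\<bar>x / c\<bar> * gauss_gap (x / c) \<le> \<bar>x / c\<bar> * ((x / c)\<^sup>2 / 2)" by (intro mult_left_mono gauss_gap_le_square) simp
    also have "\<dots> = \<bar>x\<bar> ^ 3 / (2 * c ^ 3)"
      using c by (simp add: abs_divide power_divide power3_eq_cube power2_eq_square abs_mult_self_eq)
    finally show "\<bar>x / c\<bar> * gauss_gap (x / c) \<le> \<bar>x\<bar> ^ 3 / (2 * c ^ 3)" .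
  qed
  also have "\<dots> \<le> \<rho> / (2 * c ^ 3)" using third c by (simp add: divide_right_mono)
  finally show "cubic_gap P c \<le> \<rho> / (2 * c ^ 3)" .
  have "(\<integral>x. \<bar>x\<bar> ^ 3 \<partial>P) / (2 * c ^ 3) \<le> \<rho> / (2 * c ^ 3)" using third c by (simp add: divide_right_mono)
  then have "1 / (2 * c\<^sup>2) - \<rho> / (2 * c ^ 3) \<le> (\<integral>x. x\<^sup>2 / (2 * c\<^sup>2) - \<bar>x\<bar> ^ 3 / (2 * c ^ 3) \<partial>P)"
    using int2 int3 var by simp
  also have "\<dots> \<le> gap P c"
    unfolding gap_def
  proof (rule integral_mono)
    show "integrable P (\<lambda>x. x\<^sup>2 / (2 * c\<^sup>2) - \<bar>x\<bar> ^ 3 / (2 * c ^ 3))" using int2 int3 by simp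
    show "integrable P (\<lambda>x. gauss_gap (x / c))" by (rule integrable_gauss_gap) simp
    fix x show "x\<^sup>2 / (2 * c\<^sup>2) - \<bar>x\<bar> ^ 3 / (2 * c ^ 3) \<le> gauss_gap (x / c)"
      using gauss_gap_ge_cubic[of "x / c"] c by (simp add: power_divide abs_divide mult.commute)
  qed
  finally show "1 / (2 * c\<^sup>2) - \<rho> / (2 * c ^ 3) \<le> gap P c" .
qed

text \<open>At unit variance, \<open>cubic_gap\<close> is of order \<open>\<rho> / c ^ 3\<close> whereas \<open>gap\<close> is at least of order
  \<open>1 / c\<^sup>2\<close>, with constants that depend on the law only through \<open>\<rho>\<close>.\<close>

lemma uniformly_gaussian_if_bounded_skew:
  assumes Q: "\<And>P. P \<in> Q \<Longrightarrow> centred_law P \<and> integrable P (\<lambda>x. \<bar>x\<bar> ^ 3) \<and> (\<integral>x. x\<^sup>2 \<partial>P) = 1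
      \<and> (\<integral>x. \<bar>x\<bar> ^ 3 \<partial>P) \<le> \<rho>"
  shows "uniformly_gaussian Q"
proof -
  define r where "r = max \<rho> 1"
  have r: "0 < r" by (simp add: r_def)
  have bounds: "cubic_gap P c \<le> r / (2 * c ^ 3)" "1 / (2 * c\<^sup>2) - r / (2 * c ^ 3) \<le> gap P c"
    if "P \<in> Q" "0 < c" for P c
  proof -
    have "(\<integral>x. \<bar>x\<bar> ^ 3 \<partial>P) \<le> r" using Q[OF that(1)] unfolding r_def by linarith
    then show "cubic_gap P c \<le> r / (2 * c ^ 3)" "1 / (2 * c\<^sup>2) - r / (2 * c ^ 3) \<le> gap P c"
      using centred_law.third_moment_bounds[of P r c] Q[OF that(1)] that(2) by auto
  qed
  have gap_lower: "1 / (4 * c\<^sup>2) \<le> gap P c" if "P \<in> Q" "2 * r \<le> c" for P c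
  proof -
    have c: "0 < c" using that r by simp
    have "r / (2 * c ^ 3) \<le> 1 / (4 * c\<^sup>2)"
      using that c by (simp add: power3_eq_cube power2_eq_square field_simps)
    then show ?thesis using bounds(2)[OF that(1) c] by (simp add: field_simps)
  qed
  show ?thesis
    unfolding uniformly_gaussian_def
  proof (intro conjI allI impI ballI)
    show "centred_law P" if "P \<in> Q" for P using Q[OF that] by simp
    show "\<exists>c0>0. \<forall>P\<in>Q. \<forall>c\<ge>c0. cubic_gap P c \<le> d * gap P c" if d: "0 < d" for d
    proof (intro exI[of _ "max (2 * r) (2 * r / d)"] conjI ballI allI impI)
      show "0 < max (2 * r) (2 * r / d)" using r by simp
      fix P c assume P: "P \<in> Q" and c: "max (2 * r) (2 * r / d) \<le> c"
      have c0: "0 < c" using c r by simp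
      have "2 * r \<le> d * c" using c d by (simp add: divide_le_eq mult.commute)
      then have "r / (2 * c ^ 3) \<le> d * (1 / (4 * c\<^sup>2))"
        using c0 by (simp add: power3_eq_cube power2_eq_square field_simps)
      also have "\<dots> \<le> d * gap P c" using gap_lower[OF P] c d by (intro mult_left_mono) auto
      finally show "cubic_gap P c \<le> d * gap P c" using bounds(1)[OF P c0] by simp
    qed
    show "\<exists>k>0. \<forall>P\<in>Q. k \<le> gap P c" if c: "0 < c" for c
    proof (intro exI[of _ "1 / (4 * (max c (2 * r))\<^sup>2)"] conjI ballI)
      show "0 < 1 / (4 * (max c (2 * r))\<^sup>2)" using c by simp
      fix P assume P: "P \<in> Q"
      have "gap P (max c (2 * r)) \<le> gap P c"
        using Q[OF P] c by (intro centred_law.gap_antimono) auto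
      then show "1 / (4 * (max c (2 * r))\<^sup>2) \<le> gap P c" using gap_lower[OF P, of "max c (2 * r)"] by simp
    qed
  qed
qed

text \<open>The standard deviation is positive because a law attracted to the Gaussian is not a point mass.\<close>

lemma DAN_standardised:
  assumes P: "P \<in> DAN \<theta>" and int3: "integrable P (\<lambda>x. \<bar>x - mean P\<bar> ^ 3)"
  defines "Q \<equiv> distr P borel (\<lambda>x. (x - \<theta>) / stddev P)"
  shows "0 < stddev P" and "centred_law Q" and "integrable Q (\<lambda>x. \<bar>x\<bar> ^ 3)" and "(\<integral>x. x\<^sup>2 \<partial>Q) = 1"
    and "(\<integral>x. \<bar>x\<bar> ^ 3 \<partial>Q) = (\<integral>x. \<bar>x - mean P\<bar> ^ 3 \<partial>P) / stddev P ^ 3"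
proof -
  have real: "real_distribution P" and int: "integrable P (\<lambda>x. x)" and mean: "mean P = \<theta>"
    using P by (auto simp: DAN_def mean_def)
  interpret real_distribution P by (rule real)
  have int3: "integrable P (\<lambda>x. \<bar>x - \<theta>\<bar> ^ 3)" using int3 by (simp add: mean)
  have int2: "integrable P (\<lambda>x. (x - \<theta>)\<^sup>2)"
  proof (rule Bochner_Integration.integrable_bound)
    show "integrable P (\<lambda>x. 1 + \<bar>x - \<theta>\<bar> ^ 3)" using int3 by simp
    have "w\<^sup>2 \<le> 1 + \<bar>w\<bar> ^ 3" for w :: real
    proof (cases "\<bar>w\<bar> \<le> 1")
      case True
      then have "w\<^sup>2 \<le> 1" by (simp add: abs_square_le_1)
      then show ?thesis by (simp add: add_increasing2)
    next
      case False
      then have "\<bar>w\<bar>\<^sup>2 \<le> \<bar>w\<bar> ^ 3" by (intro power_increasing) auto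
      then show ?thesis by simp
    qed
    then show "AE x in P. norm ((x - \<theta>)\<^sup>2) \<le> norm (1 + \<bar>x - \<theta>\<bar> ^ 3)"
      by (intro AE_I2) (simp add: add_nonneg_nonneg)
  qed simp
  define v where "v = (\<integral>x. (x - \<theta>)\<^sup>2 \<partial>P)"
  have v0: "0 \<le> v" unfolding v_def by (intro integral_nonneg_AE AE_I2) simp
  have "v \<noteq> 0"
  proof
    assume "v = 0"
    then have "AE x in P. (x - \<theta>)\<^sup>2 = 0"
      using integral_nonneg_eq_0_iff_AE[OF int2] by (simp add: v_def)
    then have "AE x in distr P borel (\<lambda>x. x - \<theta>). x = 0" by (subst AE_distr_iff) auto
    moreover obtain y where "attracted_law (distr P borel (\<lambda>x. x - \<theta>)) y"
      by (rule DAN_attracted[OF P])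
    then interpret A: attracted_law "distr P borel (\<lambda>x. x - \<theta>)" y .
    have "\<not> (AE x in distr P borel (\<lambda>x. x - \<theta>). x = 0)" by (rule A.nontrivial)
    ultimately show False by contradiction
  qed
  then have v: "0 < v" using v0 by simp
  have sd: "stddev P = sqrt v" by (simp add: stddev_def mean v_def)
  then show sd0: "0 < stddev P" using v by simp
  have sd2: "(stddev P)\<^sup>2 = v" using v by (simp add: sd)
  show "centred_law Q"
    unfolding Q_def using mean by (intro centred_law_affine[OF real int]) (simp add: mean_def)
  show "integrable Q (\<lambda>x. \<bar>x\<bar> ^ 3)"
    unfolding Q_def using int3 by (subst integrable_distr_eq) (auto simp: abs_divide power_divide)
  show "(\<integral>x. x\<^sup>2 \<partial>Q) = 1"
    unfolding Q_def using v by (subst integral_distr) (auto simp: power_divide sd2 v_def[symmetric])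
  show "(\<integral>x. \<bar>x\<bar> ^ 3 \<partial>Q) = (\<integral>x. \<bar>x - mean P\<bar> ^ 3 \<partial>P) / stddev P ^ 3"
    unfolding Q_def using sd0 by (subst integral_distr) (auto simp: power_divide abs_divide mean)
qed

lemma AE_tendsto_imp_measure_tendsto_0:
  fixes L :: "nat \<Rightarrow> 'a \<Rightarrow> real"
  assumes M: "prob_space M" and [measurable]: "\<And>n. L n \<in> borel_measurable M"
    and lim: "AE \<omega> in M. (\<lambda>n. L n \<omega>) \<longlonglongrightarrow> l" and d: "0 < d"
  shows "(\<lambda>n. measure M {\<omega>\<in>space M. d < \<bar>L n \<omega> - l\<bar>}) \<longlonglongrightarrow> 0"
proof -
  interpret prob_space M by (rule M)
  have "(\<lambda>n. \<integral>\<omega>. indicator {\<omega>\<in>space M. d < \<bar>L n \<omega> - l\<bar>} \<omega> \<partial>M) \<longlonglongrightarrow> (\<integral>\<omega>. 0 \<partial>M :: real)"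
  proof (rule integral_dominated_convergence[where w="\<lambda>_. 1"])
    show "AE \<omega> in M. (\<lambda>n. indicator {\<omega>\<in>space M. d < \<bar>L n \<omega> - l\<bar>} \<omega>) \<longlonglongrightarrow> (0 :: real)"
      using lim
    proof eventually_elim
      case (elim \<omega>)
      have "\<forall>\<^sub>F n in sequentially. dist (L n \<omega>) l < d" using elim d by (rule tendstoD)
      then have "\<forall>\<^sub>F n in sequentially. 0 = (indicator {\<omega>\<in>space M. d < \<bar>L n \<omega> - l\<bar>} \<omega> :: real)"
        by eventually_elim (simp add: dist_real_def)
      then show ?case by (rule Lim_transform_eventually[OF tendsto_const])
    qed
  qed auto
  then show ?thesis by simp
qed

lemma sharp_asymptotic_evar_IWR:
  fixes M :: "'a measure"
  assumes P: "P \<in> DAN \<theta>" and iid: "iid_with_law M X P"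
    and meas: "\<And>n. L n \<in> borel_measurable M" and nonneg: "\<And>n. AE \<omega> in M. 0 \<le> L n \<omega>"
    and lim: "AE \<omega> in M. (\<lambda>n. L n \<omega>) \<longlonglongrightarrow> l" and bounded: "AE \<omega> in M. \<forall>n. \<bar>L n \<omega>\<bar> \<le> C"
  shows "sharp_asymptotic_evar M (\<lambda>n \<omega>. ennreal (E_IWR X n \<theta> (L n \<omega>) \<omega>))"
proof -
  obtain y where att: "attracted_law (distr P borel (\<lambda>x. x - \<theta>)) y"
    by (rule DAN_attracted[OF P])
  have iid': "iid_with_law M (\<lambda>i \<omega>. (X i \<omega> - \<theta>) / 1) (distr P borel (\<lambda>x. x - \<theta>))"
    using iid_with_law_affine[OF iid, of \<theta> 1] by simp
  have prob_M: "prob_space M" using iid by (simp add: iid_with_law_def)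
  have L_bounded: "AE \<omega> in M. 0 \<le> L n \<omega> \<and> L n \<omega> \<le> C" for n
    using nonneg[of n] bounded by eventually_elim (auto simp: abs_le_iff)
  note main = IWR_expectation_tendsto_1[where Q="{distr P borel (\<lambda>x. x - \<theta>)}" and M="\<lambda>_. M"
      and P="\<lambda>_. distr P borel (\<lambda>x. x - \<theta>)" and X="\<lambda>_ i \<omega>. (X i \<omega> - \<theta>) / 1" and L=L and C=C and l=l,
      OF attracted_law.uniformly_gaussian_singleton[OF att] singletonI iid' meas L_bounded
      AE_tendsto_imp_measure_tendsto_0[OF prob_M meas lim]]
  have "integrable M (\<lambda>\<omega>. E_IWR X n \<theta> (L n \<omega>) \<omega>)" for n
    using main(2)[of n] by (simp only: E_IWR_affine[OF zero_less_one])
  then have "(\<integral>\<^sup>+\<omega>. ennreal (E_IWR X n \<theta> (L n \<omega>) \<omega>) \<partial>M) = ennreal (\<integral>\<omega>. E_IWR X n \<theta> (L n \<omega>) \<omega> \<partial>M)" for n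
    by (rule nn_integral_eq_integral) (simp add: E_IWR_def)
  moreover have "(\<lambda>n. ennreal (\<integral>\<omega>. E_IWR X n \<theta> (L n \<omega>) \<omega> \<partial>M)) \<longlonglongrightarrow> ennreal 1"
    using main(1) by (intro tendsto_ennrealI) (simp only: E_IWR_affine[OF zero_less_one])
  ultimately show ?thesis
    unfolding sharp_asymptotic_evar_def by (intro lim_imp_Limsup) simp_all
qed

text \<open>Since the quotient \<open>S / V\<close> is invariant under scaling, the laws may be standardised, and the
  standardised laws form a uniformly Gaussian class. Uniformity then follows from the limit theorem
  for sequences of laws, applied to laws that nearly violate the bound for each \<open>n\<close>.\<close>

lemma uniform_asymptotic_evar_IWR:
  fixes Pr :: "real measure \<Rightarrow> 'a measure"
  assumes DAN: "\<P> \<subseteq> DAN \<theta>" and iid: "\<And>P. P \<in> \<P> \<Longrightarrow> iid_with_law (Pr P) X P"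
    and skew: "uniformly_bounded_skew \<P>" and nonneg: "\<And>n. 0 \<le> ls n" and lim: "ls \<longlonglongrightarrow> l"
  shows "uniform_asymptotic_evar Pr \<P> (\<lambda>n \<omega>. ennreal (E_IWR X n \<theta> (ls n) \<omega>))"
proof (cases "\<P> = {}")
  case True
  then show ?thesis by (simp add: uniform_asymptotic_evar_def Limsup_const bot_ennreal)
next
  case False
  then obtain P0 where P0: "P0 \<in> \<P>" by blast
  obtain \<rho> where \<rho>: "\<And>P. P \<in> \<P> \<Longrightarrow> (\<integral>x. \<bar>x - mean P\<bar> ^ 3 \<partial>P) / stddev P ^ 3 \<le> \<rho>"
    using skew unfolding uniformly_bounded_skew_def bdd_above_def by blast
  have int3: "integrable P (\<lambda>x. \<bar>x - mean P\<bar> ^ 3)" if "P \<in> \<P>" for P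
    using skew that by (simp add: uniformly_bounded_skew_def)
  define st where "st P = distr P borel (\<lambda>x. (x - \<theta>) / stddev P)" for P
  have sd: "0 < stddev P" if "P \<in> \<P>" for P using DAN_standardised(1) DAN that int3 by blast
  have gaussian: "uniformly_gaussian (st ` \<P>)"
  proof (rule uniformly_gaussian_if_bounded_skew[where \<rho>=\<rho>])
    fix Q assume "Q \<in> st ` \<P>"
    then obtain P where P: "P \<in> \<P>" "Q = st P" by blast
    note std = DAN_standardised[OF subsetD[OF DAN P(1)] int3[OF P(1)], folded st_def]
    show "centred_law Q \<and> integrable Q (\<lambda>x. \<bar>x\<bar> ^ 3) \<and> (\<integral>x. x\<^sup>2 \<partial>Q) = 1 \<and> (\<integral>x. \<bar>x\<bar> ^ 3 \<partial>Q) \<le> \<rho>"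
      using std \<rho>[OF P(1)] by (simp add: P(2))
  qed
  have "Bseq ls" using lim by (intro convergent_imp_Bseq convergentI)
  then obtain C where "\<And>n. norm (ls n) \<le> C" unfolding Bseq_def by blast
  then have C: "ls n \<le> C" for n using abs_le_D1 by fastforce
  define E where "E P n = (\<integral>\<^sup>+\<omega>. ennreal (E_IWR X n \<theta> (ls n) \<omega>) \<partial>Pr P)" for P n
  have seq: "(\<lambda>n. E (Ps n) n) \<longlonglongrightarrow> 1" if Ps: "\<And>n. Ps n \<in> \<P>" for Ps
  proof -
    have iid': "iid_with_law (Pr (Ps n)) (\<lambda>i \<omega>. (X i \<omega> - \<theta>) / stddev (Ps n)) (st (Ps n))" for n
      unfolding st_def by (rule iid_with_law_affine[OF iid[OF Ps]])
    have L_lim: "(\<lambda>n. measure (Pr (Ps n)) {\<omega>\<in>space (Pr (Ps n)). d < \<bar>ls n - l\<bar>}) \<longlonglongrightarrow> 0" if "0 < d" for d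
    proof (rule tendsto_eventually)
      have "\<forall>\<^sub>F n in sequentially. dist (ls n) l < d" using lim that by (rule tendstoD)
      then show "\<forall>\<^sub>F n in sequentially. measure (Pr (Ps n)) {\<omega>\<in>space (Pr (Ps n)). d < \<bar>ls n - l\<bar>} = 0"
        by eventually_elim (simp add: dist_real_def)
    qed
    note main = IWR_expectation_tendsto_1[where Q="st ` \<P>" and M="\<lambda>n. Pr (Ps n)" and P="\<lambda>n. st (Ps n)"
        and X="\<lambda>n i \<omega>. (X i \<omega> - \<theta>) / stddev (Ps n)" and L="\<lambda>n _. ls n" and C=C and l=l,
        OF gaussian imageI[OF Ps] iid' borel_measurable_const AE_I2[OF conjI[OF nonneg C]] L_lim]
    have "integrable (Pr (Ps n)) (\<lambda>\<omega>. E_IWR X n \<theta> (ls n) \<omega>)" for n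
      using main(2)[of n] by (simp only: E_IWR_affine[OF sd[OF Ps]])
    then have "E (Ps n) n = ennreal (\<integral>\<omega>. E_IWR X n \<theta> (ls n) \<omega> \<partial>Pr (Ps n))" for n
      unfolding E_def by (rule nn_integral_eq_integral) (simp add: E_IWR_def)
    moreover have "(\<lambda>n. ennreal (\<integral>\<omega>. E_IWR X n \<theta> (ls n) \<omega> \<partial>Pr (Ps n))) \<longlonglongrightarrow> ennreal 1"
      using main(1) by (intro tendsto_ennrealI) (simp only: E_IWR_affine[OF sd[OF Ps]])
    ultimately show ?thesis by simp
  qed
  show ?thesis
    unfolding uniform_asymptotic_evar_def E_def[symmetric] Limsup_le_iff
  proof (intro allI impI)
    fix z :: ennreal assume "1 < z"
    then obtain w where w: "1 < w" "w < z" using dense by blast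
    \<comment> \<open>A sequence of laws that exceeds \<open>w\<close> whenever some law in \<open>\<P>\<close> does.\<close>
    define Ps where "Ps n = (if \<exists>P\<in>\<P>. w < E P n then SOME P. P \<in> \<P> \<and> w < E P n else P0)" for n
    have Ps: "Ps n \<in> \<P> \<and> ((\<exists>P\<in>\<P>. w < E P n) \<longrightarrow> w < E (Ps n) n)" for n
    proof (cases "\<exists>P\<in>\<P>. w < E P n")
      case True
      then have "\<exists>P. P \<in> \<P> \<and> w < E P n" by blast
      from someI_ex[OF this] show ?thesis using True by (simp add: Ps_def)
    qed (use P0 in \<open>simp add: Ps_def\<close>)
    have "(\<lambda>n. E (Ps n) n) \<longlonglongrightarrow> 1" using Ps by (intro seq) blast
    from order_tendstoD(2)[OF this w(1)]
    show "\<forall>\<^sub>F n in sequentially. (SUP P\<in>\<P>. E P n) < z"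
    proof eventually_elim
      case (elim n)
      then have "\<not> (\<exists>P\<in>\<P>. w < E P n)" using Ps[of n] by (meson order_less_asym)
      then have "(SUP P\<in>\<P>. E P n) \<le> w" by (intro SUP_least) (auto simp: not_less)
      then show ?case using w(2) by (rule le_less_trans)
    qed
  qed
qed

theorem theorem3p1:
  fixes \<theta> l :: real
    and X :: "nat \<Rightarrow> 'a \<Rightarrow> real"
  shows
    "(\<forall>(M :: 'a measure) (P :: real measure) (\<Lambda> :: nat \<Rightarrow> 'a \<Rightarrow> real).
        P \<in> DAN \<theta> \<longrightarrow>
        iid_with_law M X P \<longrightarrow>
        (\<forall>n. \<Lambda> n \<in> borel_measurable M) \<longrightarrow>
        (\<forall>n. AE \<omega> in M. 0 \<le> \<Lambda> n \<omega>) \<longrightarrow>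
        (AE \<omega> in M. (\<lambda>n. \<Lambda> n \<omega>) \<longlonglongrightarrow> l) \<longrightarrow>
        (\<exists>C :: real. AE \<omega> in M. \<forall>n. \<bar>\<Lambda> n \<omega>\<bar> \<le> C) \<longrightarrow>
        sharp_asymptotic_evar M (\<lambda>n \<omega>. ennreal (E_IWR X n \<theta> (\<Lambda> n \<omega>) \<omega>)))
     \<and>
     (\<forall>(\<P> :: real measure set) (Pr :: real measure \<Rightarrow> 'a measure) (ls :: nat \<Rightarrow> real).
        \<P> \<subseteq> DAN \<theta> \<longrightarrow>
        (\<forall>P\<in>\<P>. iid_with_law (Pr P) X P) \<longrightarrow>
        uniformly_bounded_skew \<P> \<longrightarrow>
        (\<forall>n. 0 \<le> ls n) \<longrightarrow>
        ls \<longlonglongrightarrow> l \<longrightarrow>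
        uniform_asymptotic_evar Pr \<P> (\<lambda>n \<omega>. ennreal (E_IWR X n \<theta> (ls n) \<omega>)))"
proof (intro conjI allI impI, goal_cases)
  case (1 M P \<Lambda>)
  then obtain C where "AE \<omega> in M. \<forall>n. \<bar>\<Lambda> n \<omega>\<bar> \<le> C" by blast
  with 1 show ?case by (intro sharp_asymptotic_evar_IWR) auto
next
  case (2 \<P> Pr ls)
  then show ?case by (intro uniform_asymptotic_evar_IWR) auto
qed

end
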